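(* Let $A\in\mathbb{R}^{n\times n}$, $B\in\mathbb{R}^{n\times m}$ and $C=I_n$. Let $N>0$ be an integer and $h>0$ a constant delay. Let $\Phi_N$ (depending on $P_N,S,R$), $T$, $k$, $r_j$, $J_j$ and $F_W$ be as defined in the context, let $\tilde A=T^{-1}AT$, $\tilde B=T^{-1}B$, and let $\mathcal M=\begin{bmatrix}I_n&-\tilde A&0_n&0_{n,nN}\end{bmatrix}$. If there exist matrices $P_N\in\mathbb{S}_+^{(N+1)n}$, $S,R\in\mathbb{S}_+^n$, $\bar K\in\mathbb{R}^{m\times n}$ and $X_j\in\mathbb{R}^{r_j\times r_j}$ ($j=1,\dots,k$) such that, with $X=\sum_{j=1}^kJ_j^{\top}X_jJ_j$ and $\tilde X=\mathrm{diag}(X,\dots,X)$ ($N+3$ copies of $X$), $$\Phi_N+\mathrm{He}\left(\left(\mathcal M\tilde X+\begin{bmatrix}0_n&0_n&-\tilde B\bar K&0_{n,nN}\end{bmatrix}\right)^{\top}F_W\right)\prec 0,$$ then the time-delay system $$\dot x(t)=Ax(t)+Bu(t-h),\quad y(t)=Cx(t),\quad u(t)=Ky(t)\quad (t>0),\qquad x(t)=\phi(t)\ \ (t\in[-h,0]),$$ i.e. $\dot x(t)=Ax(t)+BKx(t-h)$, is asymptotically stable with the state feedback gain $K=\bar KX^{-1}T^{-1}$.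
   Context: Notation: $\mathbb{S}^q$ (resp. $\mathbb{S}_+^q$) is the set of real symmetric (resp. symmetric positive definite) $q\times q$ matrices; $\mathrm{He}(A)=A+A^{\top}$; $\prec0$ means symmetric negative definite; $I_q$ is the identity, $0_{q,r}$ the $q\times r$ zero matrix and $0_q=0_{q,q}$; $\mathrm{diag}$ denotes block-diagonal matrices. The initial condition $\phi$ is continuous on $[-h,0]$. Matrix $\Phi_N$: for $P_N\in\mathbb{S}_+^{(N+1)n}$, $S,R\in\mathbb{S}_+^n$, $$\Phi_N=\mathrm{He}(G_N^{\top}P_NH_N)+\tilde S_N+h^2F_N^{\top}RF_N-\begin{bmatrix}\Gamma_N(0)\\ \vdots\\ \Gamma_N(N)\end{bmatrix}^{\top}R_N\begin{bmatrix}\Gamma_N(0)\\ \vdots\\ \Gamma_N(N)\end{bmatrix},$$ where $\tilde S_N=\mathrm{diag}(0_n,S,-S,0_{Nn})$, $R_N=\mathrm{diag}(R,3R,\dots,(2N+1)R)$, $F_N=\begin{bmatrix}I_n&0_n&0_n&0_{n,nN}\end{bmatrix}$, $$G_N=\begin{bmatrix}0_n&I_n&0_n&0_{n,nN}\\0_{nN,n}&0_{nN,n}&0_{nN,n}&hI_{nN}\end{bmatrix},\qquad H_N=\begin{bmatrix}F_N^{\top}&\Gamma_N^{\top}(0)&\cdots&\Gamma_N^{\top}(N-1)\end{bmatrix}^{\top},$$ $\Gamma_N(q)=\begin{bmatrix}0_n&I_n&(-1)^{q+1}I_n&\gamma_{Nq}^0I_n&\cdots&\gamma_{Nq}^{N-1}I_n\end{bmatrix}$,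 with $\gamma_{Nq}^i=-(2i+1)(1-(-1)^{q+i})$ if $i\le q$ and $\gamma_{Nq}^i=0$ otherwise. Jordan structure and slack variables: $T\in\mathbb{R}^{n\times n}$ is a non singular matrix such that $T^{-1}(-A)T=-\tilde A$ is a real Jordan form of $-A$, with the real Jordan blocks belonging to the same eigenvalue (or the same pair of complex conjugate eigenvalues) placed consecutively. $k$ is the number of distinct eigenvalues (conjugate pairs counted once), $r_j$ is the total size of the blocks of the $j$-th one (so $r_1+\dots+r_k=n$), and $J_j=\begin{bmatrix}0&I_{r_j}&0\end{bmatrix}\in\mathbb{R}^{r_j\times n}$ has $I_{r_j}$ in columns $r_1+\dots+r_{j-1}+1,\dots,r_1+\dots+r_j$. Given real numbers $\varepsilon_i(j)$ ($1\le i\le N+3$, $1\le j\le k$), $\mathcal E_i=\sum_{j=1}^k\varepsilon_i(j)J_j^{\top}J_j$ and $F_W=\begin{bmatrix}\mathcal E_1&\cdots&\mathcal E_{N+3}\end{bmatrix}\in\mathbb{R}^{n\times n(N+3)}$. *)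

theory Defs
  imports
    "HOL-Analysis.Analysis"
    "Jordan_Normal_Form.Gauss_Jordan_Elimination"
    "Jordan_Normal_Form.Jordan_Normal_Form"
begin

section \<open>Matrices\<close>

text \<open>All sizes here are expressions in \<open>n\<close> and \<open>N\<close>, so matrices and vectors are those of
  Jordan_Normal_Form, with the dimensions recorded by carrier sets. Families of blocks are indexed
  from 0.\<close>

text \<open>\<open>the (mat_inverse M)\<close> is the inverse of an invertible square matrix and unspecified otherwise.\<close>

definition mat_inv :: "real mat \<Rightarrow> real mat" where
  "mat_inv M = the (mat_inverse M)"

definition He :: "real mat \<Rightarrow> real mat" where
  "He M = M + transpose_mat M"

definition sym_mat :: "nat \<Rightarrow> real mat \<Rightarrow> bool" where
  "sym_mat q M \<longleftrightarrow> M \<in> carrier_mat q q \<and> transpose_mat M = M"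

definition pos_def :: "nat \<Rightarrow> real mat \<Rightarrow> bool" where
  "pos_def q M \<longleftrightarrow> sym_mat q M \<and>
     (\<forall>v\<in>carrier_vec q. v \<noteq> 0\<^sub>v q \<longrightarrow> scalar_prod v (M *\<^sub>v v) > 0)"

definition neg_def :: "nat \<Rightarrow> real mat \<Rightarrow> bool" where
  "neg_def q M \<longleftrightarrow> sym_mat q M \<and>
     (\<forall>v\<in>carrier_vec q. v \<noteq> 0\<^sub>v q \<longrightarrow> scalar_prod v (M *\<^sub>v v) < 0)"

definition block_col :: "nat \<Rightarrow> real mat list \<Rightarrow> real mat" where
  "block_col nc Ms = foldr append_rows Ms (0\<^sub>m 0 nc)"

definition block_row :: "nat \<Rightarrow> real mat list \<Rightarrow> real mat" where
  "block_row nr Ms = transpose_mat (block_col nr (map transpose_mat Ms))"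

definition sum_mats :: "nat \<Rightarrow> (nat \<Rightarrow> real mat) \<Rightarrow> nat \<Rightarrow> real mat" where
  "sum_mats n f k = Matrix.mat n n (\<lambda>(a, b). \<Sum>j<k. f j $$ (a, b))"


section \<open>The matrix \<open>\<Phi>\<^sub>N\<close>\<close>

definition gamma_coeff :: "nat \<Rightarrow> nat \<Rightarrow> real" where
  "gamma_coeff q i = (if i \<le> q then - (2 * real i + 1) * (1 - (-1) ^ (q + i)) else 0)"

definition Gamma_mat :: "nat \<Rightarrow> nat \<Rightarrow> nat \<Rightarrow> real mat" where
  "Gamma_mat n N q = block_row n
     ([0\<^sub>m n n, 1\<^sub>m n, (-1) ^ (q + 1) \<cdot>\<^sub>m 1\<^sub>m n] @ map (\<lambda>i. gamma_coeff q i \<cdot>\<^sub>m 1\<^sub>m n) [0..<N])"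

definition F_mat :: "nat \<Rightarrow> nat \<Rightarrow> real mat" where
  "F_mat n N = block_row n [1\<^sub>m n, 0\<^sub>m n n, 0\<^sub>m n n, 0\<^sub>m n (n * N)]"

definition G_mat :: "nat \<Rightarrow> nat \<Rightarrow> real \<Rightarrow> real mat" where
  "G_mat n N h = block_col ((N + 3) * n)
     [block_row n [0\<^sub>m n n, 1\<^sub>m n, 0\<^sub>m n n, 0\<^sub>m n (n * N)],
      block_row (n * N) [0\<^sub>m (n * N) n, 0\<^sub>m (n * N) n, 0\<^sub>m (n * N) n, h \<cdot>\<^sub>m 1\<^sub>m (n * N)]]"

definition H_mat :: "nat \<Rightarrow> nat \<Rightarrow> real mat" where
  "H_mat n N = block_col ((N + 3) * n) (F_mat n N # map (Gamma_mat n N) [0..<N])"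

definition S_tilde :: "nat \<Rightarrow> nat \<Rightarrow> real mat \<Rightarrow> real mat" where
  "S_tilde n N S = diag_block_mat [0\<^sub>m n n, S, - S, 0\<^sub>m (n * N) (n * N)]"

definition R_diag :: "nat \<Rightarrow> real mat \<Rightarrow> real mat" where
  "R_diag N R = diag_block_mat (map (\<lambda>q. (2 * real q + 1) \<cdot>\<^sub>m R) [0..<N + 1])"

definition Phi_mat :: "nat \<Rightarrow> nat \<Rightarrow> real \<Rightarrow> real mat \<Rightarrow> real mat \<Rightarrow> real mat \<Rightarrow> real mat" where
  "Phi_mat n N h P S R =
     (let F = F_mat n N;
          \<Gamma> = block_col ((N + 3) * n) (map (Gamma_mat n N) [0..<N + 1])
      in He (transpose_mat (G_mat n N h) * P * H_mat n N) + S_tilde n N S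
         + h\<^sup>2 \<cdot>\<^sub>m (transpose_mat F * R * F) - transpose_mat \<Gamma> * R_diag N R * \<Gamma>)"


section \<open>Real Jordan forms\<close>

text \<open>A real eigenvalue \<open>z\<close> gives an ordinary Jordan block; a conjugate pair \<open>a \<plusminus> b \<i>\<close>, encoded by
  either of its members, gives the block upper bidiagonal matrix with \<open>p\<close> diagonal blocks
  \<open>[[a, b], [-b, a]]\<close> and identity blocks of order 2 above them. Since either member may be used,
  both usual sign conventions are covered.\<close>

definition real_jordan_block :: "nat \<Rightarrow> complex \<Rightarrow> real mat" where
  "real_jordan_block p z =
     (if Im z = 0 then jordan_block p (Re z)
      else Matrix.mat (2 * p) (2 * p) (\<lambda>(a, b).
        if a = b then Re z
        else if even a \<and> b = a + 1 then Im z
        else if odd a \<and> a = b + 1 then - Im z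
        else if b = a + 2 then 1
        else 0))"

text \<open>A grouped real Jordan form is a list of pairs \<open>(z, ps)\<close>: one pair for each real eigenvalue
  or conjugate pair, with \<open>ps\<close> the sizes of its Jordan blocks.\<close>

type_synonym jordan_groups = "(complex \<times> nat list) list"

definition wf_groups :: "jordan_groups \<Rightarrow> bool" where
  "wf_groups gs \<longleftrightarrow> (\<forall>(z, ps) \<in> set gs. ps \<noteq> [] \<and> (\<forall>p\<in>set ps. p > 0)) \<and>
     (\<forall>i<length gs. \<forall>j<length gs. i \<noteq> j \<longrightarrow>
        fst (gs ! i) \<noteq> fst (gs ! j) \<and> fst (gs ! i) \<noteq> cnj (fst (gs ! j)))"

definition group_mat :: "complex \<times> nat list \<Rightarrow> real mat" where
  "group_mat g = diag_block_mat (map (\<lambda>p. real_jordan_block p (fst g)) (snd g))"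

definition real_jordan_mat :: "jordan_groups \<Rightarrow> real mat" where
  "real_jordan_mat gs = diag_block_mat (map group_mat gs)"

definition group_size :: "jordan_groups \<Rightarrow> nat \<Rightarrow> nat" where
  "group_size gs j = dim_row (group_mat (gs ! j))"

definition J_mat :: "nat \<Rightarrow> (nat \<Rightarrow> nat) \<Rightarrow> nat \<Rightarrow> real mat" where
  "J_mat n r j = Matrix.mat (r j) n (\<lambda>(a, b). if b = (\<Sum>i<j. r i) + a then 1 else 0)"

definition F_W :: "nat \<Rightarrow> nat \<Rightarrow> nat \<Rightarrow> (nat \<Rightarrow> nat) \<Rightarrow> (nat \<Rightarrow> nat \<Rightarrow> real) \<Rightarrow> real mat" where
  "F_W n N k r \<epsilon> = block_row n
     (map (\<lambda>i. sum_mats n (\<lambda>j. \<epsilon> i j \<cdot>\<^sub>m (transpose_mat (J_mat n r j) * J_mat n r j)) k) [0..<N + 3])"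


section \<open>Delay systems\<close>

definition vnorm :: "real Matrix.vec \<Rightarrow> real" where
  "vnorm v = sqrt (scalar_prod v v)"

definition vec_continuous_on :: "nat \<Rightarrow> real set \<Rightarrow> (real \<Rightarrow> real Matrix.vec) \<Rightarrow> bool" where
  "vec_continuous_on n I x \<longleftrightarrow>
     (\<forall>t\<in>I. x t \<in> carrier_vec n) \<and> (\<forall>i<n. continuous_on I (\<lambda>t. vec_index (x t) i))"

text \<open>Solutions of \<open>x'(t) = A x(t) + B u(t - h)\<close> for \<open>t > 0\<close> under output feedback
  \<open>y = C x\<close>, \<open>u = K y\<close>. The feedback law is also used at the times \<open>t - h\<close> in \<open>[-h, 0]\<close>,
  so the closed loop reads \<open>x'(t) = A x(t) + B K C x(t - h)\<close> for all \<open>t > 0\<close>.\<close>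

definition closed_loop_solution ::
  "nat \<Rightarrow> real \<Rightarrow> real mat \<Rightarrow> real mat \<Rightarrow> real mat \<Rightarrow> real mat \<Rightarrow>
   (real \<Rightarrow> real Matrix.vec) \<Rightarrow> (real \<Rightarrow> real Matrix.vec) \<Rightarrow> bool" where
  "closed_loop_solution n h A B C K \<phi> x \<longleftrightarrow>
     vec_continuous_on n {-h..} x \<and> (\<forall>t\<in>{-h..0}. x t = \<phi> t) \<and>
     (\<forall>t>0. \<forall>i<n. ((\<lambda>s. vec_index (x s) i) has_real_derivative
        vec_index (A *\<^sub>v x t + B *\<^sub>v (K *\<^sub>v (C *\<^sub>v x (t - h)))) i) (at t))"

text \<open>Lyapunov stability with respect to the supremum norm of the initial function, together with
  convergence to 0 of every solution (by linearity, local and global attractivity coincide).\<close>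

definition closed_loop_asymptotically_stable ::
  "nat \<Rightarrow> real \<Rightarrow> real mat \<Rightarrow> real mat \<Rightarrow> real mat \<Rightarrow> real mat \<Rightarrow> bool" where
  "closed_loop_asymptotically_stable n h A B C K \<longleftrightarrow>
     (\<forall>e>0. \<exists>d>0. \<forall>\<phi> x. vec_continuous_on n {-h..0} \<phi> \<and> closed_loop_solution n h A B C K \<phi> x \<and>
        (\<forall>t\<in>{-h..0}. vnorm (\<phi> t) < d) \<longrightarrow> (\<forall>t\<ge>0. vnorm (x t) < e)) \<and>
     (\<forall>\<phi> x. vec_continuous_on n {-h..0} \<phi> \<and> closed_loop_solution n h A B C K \<phi> x \<longrightarrow>
        ((\<lambda>t. vnorm (x t)) \<longlongrightarrow> 0) at_top)"

end

theory Submission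
  imports Defs
begin

text \<open>
  If \<open>X\<close> is invertible, the coordinates \<open>w = X\<^sup>-\<^sup>1 T\<^sup>-\<^sup>1 x\<close> turn the closed loop into a delay system whose
  vectors \<open>\<xi> = (w'(t), w(t), w(t - h), \<Omega>\<^sub>0 / h, \<dots>)\<close>, with \<open>\<Omega>\<^sub>q\<close> the Legendre moments of \<open>w\<close> on \<open>[t - h, t]\<close>, are
  annihilated by \<open>\<M> X + [0, 0, - B K, 0]\<close>. The slack term therefore vanishes at \<open>\<xi>\<close>, and
  the matrix inequality gives \<open>\<xi>\<^sup>T \<Phi>\<^sub>N \<xi> \<le> - \<delta> |\<xi>|\<^sup>2\<close>. The left-hand side bounds the derivative of a
  Lyapunov-Krasovskii functional by Bessel's inequality for the Legendre polynomials applied to \<open>w'\<close>;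
  stability follows, and attractivity by Barbalat's argument. Invertibility of \<open>X\<close> is automatic: if \<open>X v = 0\<close>, then \<open>\<xi> = (v, 0, \<dots>, 0)\<close> is
  annihilated too, but \<open>\<xi>\<^sup>T \<Phi>\<^sub>N \<xi> = h\<^sup>2 v\<^sup>T R v \<ge> 0\<close>.
\<close>

unbundle no inner_syntax
no_notation Finite_Cartesian_Product.vec_nth (infixl \<open>$\<close> 90)

section \<open>Bounds for quadratic forms\<close>

text \<open>The slack row multiplies \<open>w'\<close> and \<open>w\<close> by \<open>X\<close>, but
  the delayed component only by the product of \<open>B\<close> and \<open>Kbar\<close>: with the
  gain \<open>Kbar * mat_inv X * mat_inv T\<close> the delayed input is \<open>Kbar\<close> applied
  to \<open>w(t - h)\<close>, so the product of gain and slack variable becomes a linear unknown.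
  Bessel's inequality can be expressed on the vectors of the overview because the Legendre moments
  of \<open>w'\<close> are no new data: integration by parts turns them into \<open>w(t)\<close>,
  \<open>w(t - h)\<close> and the moments of \<open>w\<close>, and the numbers
  \<open>gamma_coeff q i\<close> are, up to sign, the coordinates of \<open>L_q'\<close> in the
  basis of the \<open>L_i\<close>. The obstacle is the start of the motion. A solution is
  differentiable only at positive times and the functional contains \<open>w'\<close> on all of
  \<open>[t - h, t]\<close>, so its descent is available only for \<open>t > h\<close>. The initial
  function reaches that range through a growth estimate over the first two delays. The integral
  terms are written with antiderivatives, so that differentiation and estimation reduce to the chain
  rule and the mean value theorem.\<close>

lemma scalar_prod_self_nonneg: "v \<bullet> v \<ge> (0::real)"
  by (simp add: scalar_prod_def sum_nonneg)

lemma scalar_prod_mult_mat_vec: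
  assumes "M \<in> carrier_mat n m" "v \<in> carrier_vec n" "w \<in> carrier_vec m"
  shows "v \<bullet> (M *\<^sub>v w) = (\<Sum>i<n. \<Sum>j<m. v $ i * M $$ (i, j) * w $ j)"
proof -
  have "v \<bullet> (M *\<^sub>v w) = (\<Sum>i<n. v $ i * (\<Sum>j<m. M $$ (i, j) * w $ j))"
    using assms by (simp add: scalar_prod_def atLeast0LessThan)
  then show ?thesis by (simp add: sum_distrib_left mult.assoc)
qed

lemma quad_form_le:
  fixes M :: "real mat"
  assumes M: "M \<in> carrier_mat n n"
  obtains c where "c > 0" "\<And>v. v \<in> carrier_vec n \<Longrightarrow> v \<bullet> (M *\<^sub>v v) \<le> c * (v \<bullet> v)"
proof
  \<comment> \<open>Since \<open>\<bar>v $ i * v $ j\<bar>\<close> is at most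
    \<open>v \<bullet> v\<close>, the sum of the moduli of the entries suffices; the summand 1 only
    makes the constant strictly positive when \<open>M\<close> is zero.\<close>
  define c where "c = (\<Sum>i<n. \<Sum>j<n. \<bar>M $$ (i, j)\<bar>) + 1"
  have c1: "(\<Sum>i<n. \<Sum>j<n. \<bar>M $$ (i, j)\<bar>) \<ge> 0" by (intro sum_nonneg) auto
  then show "c > 0" by (simp add: c_def)
  fix v :: "real Matrix.vec" assume v: "v \<in> carrier_vec n"
  have sq: "(v $ i)\<^sup>2 \<le> v \<bullet> v" if "i < n" for i
    unfolding scalar_prod_def power2_eq_square using v that
    by (intro member_le_sum[of i "{0..<dim_vec v}" "\<lambda>i. v $ i * v $ i"]) auto
  have "v $ i * M $$ (i, j) * v $ j \<le> \<bar>M $$ (i, j)\<bar> * (v \<bullet> v)" if "i < n" "j < n" for i j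
  proof -
    have "\<bar>v $ i * v $ j\<bar> \<le> v \<bullet> v"
    proof -
      have "2 * \<bar>v $ i * v $ j\<bar> \<le> (v $ i)\<^sup>2 + (v $ j)\<^sup>2"
        using sum_squares_bound[of "\<bar>v $ i\<bar>" "\<bar>v $ j\<bar>"] by (simp add: abs_mult)
      with sq[OF that(1)] sq[OF that(2)] show ?thesis by linarith
    qed
    then have "\<bar>M $$ (i, j)\<bar> * \<bar>v $ i * v $ j\<bar> \<le> \<bar>M $$ (i, j)\<bar> * (v \<bullet> v)"
      by (rule mult_left_mono) simp
    moreover have "v $ i * M $$ (i, j) * v $ j \<le> \<bar>M $$ (i, j)\<bar> * \<bar>v $ i * v $ j\<bar>"
    proof -
      have "v $ i * M $$ (i, j) * v $ j = M $$ (i, j) * (v $ i * v $ j)" by simp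
      also have "\<dots> \<le> \<bar>M $$ (i, j) * (v $ i * v $ j)\<bar>" by (rule abs_ge_self)
      also have "\<dots> = \<bar>M $$ (i, j)\<bar> * \<bar>v $ i * v $ j\<bar>" by (rule abs_mult)
      finally show ?thesis .
    qed
    ultimately show ?thesis by linarith
  qed
  then have "v \<bullet> (M *\<^sub>v v) \<le> (\<Sum>i<n. \<Sum>j<n. \<bar>M $$ (i, j)\<bar> * (v \<bullet> v))"
    unfolding scalar_prod_mult_mat_vec[OF M v v] by (intro sum_mono) auto
  also have "\<dots> \<le> c * (v \<bullet> v)"
    unfolding c_def using scalar_prod_self_nonneg[of v]
    by (simp add: sum_distrib_right distrib_right)
  finally show "v \<bullet> (M *\<^sub>v v) \<le> c * (v \<bullet> v)" .
qed

text \<open>The squared length of \<open>M *\<^sub>v v\<close> is the quadratic form of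
  \<open>transpose_mat M * M\<close> at \<open>v\<close>.\<close>

lemma mult_mat_vec_bound:
  fixes M :: "real mat"
  assumes M: "M \<in> carrier_mat m n"
  obtains c where "c > 0"
    "\<And>v. v \<in> carrier_vec n \<Longrightarrow> (M *\<^sub>v v) \<bullet> (M *\<^sub>v v) \<le> c * (v \<bullet> v)"
proof -
  obtain c where c: "c > 0"
    "\<And>v. v \<in> carrier_vec n \<Longrightarrow> v \<bullet> ((transpose_mat M * M) *\<^sub>v v) \<le> c * (v \<bullet> v)"
    using quad_form_le[of "transpose_mat M * M" n] M by auto
  have "(M *\<^sub>v v) \<bullet> (M *\<^sub>v v) = v \<bullet> ((transpose_mat M * M) *\<^sub>v v)" if "v \<in> carrier_vec n" for v
  proof -
    have "(transpose_mat M * M) *\<^sub>v v = transpose_mat M *\<^sub>v (M *\<^sub>v v)"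
      using M that by auto
    moreover have "v \<bullet> (transpose_mat M *\<^sub>v (M *\<^sub>v v)) = (transpose_mat M *\<^sub>v (M *\<^sub>v v)) \<bullet> v"
      using M that by (intro comm_scalar_prod[of _ n]) auto
    ultimately show ?thesis using transpose_vec_mult_scalar[OF M that] M that by auto
  qed
  with c that show thesis by metis
qed

lemma sym_scalar_prod:
  assumes "sym_mat n M" "v \<in> carrier_vec n" "w \<in> carrier_vec n"
  shows "v \<bullet> (M *\<^sub>v w) = w \<bullet> (M *\<^sub>v v)"
proof -
  have M: "M \<in> carrier_mat n n" "transpose_mat M = M" using assms(1) by (auto simp: sym_mat_def)
  have "(transpose_mat M *\<^sub>v v) \<bullet> w = v \<bullet> (M *\<^sub>v w)"
    by (rule transpose_vec_mult_scalar[OF M(1) assms(3,2)])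
  then show ?thesis unfolding M(2) using M(1) assms comm_scalar_prod[of w n "M *\<^sub>v v"] by auto
qed

text \<open>\<open>mat_inv\<close> unwraps an option, so it has to be shown that
  \<open>mat_inverse\<close> does return a value: a trivial kernel gives a nonzero determinant,
  hence a unit of the matrix ring.\<close>

lemma kernel_trivial_imp_inverse:
  fixes M :: "real mat"
  assumes M: "M \<in> carrier_mat n n"
    and ker: "\<And>v. v \<in> carrier_vec n \<Longrightarrow> v \<noteq> 0\<^sub>v n \<Longrightarrow> M *\<^sub>v v \<noteq> 0\<^sub>v n"
  shows "mat_inv M \<in> carrier_mat n n" "M * mat_inv M = 1\<^sub>m n" "mat_inv M * M = 1\<^sub>m n"
    "invertible_mat M"
proof -
  have "det M \<noteq> 0" using ker unfolding det_0_iff_vec_prod_zero_field[OF M] by auto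
  then have "M \<in> Units (ring_mat TYPE(real) n ())" by (rule det_non_zero_imp_unit[OF M])
  then obtain Q where "mat_inverse M = Some Q"
    using mat_inverse(1)[OF M, where b = "()"] by (cases "mat_inverse M") auto
  then show *: "mat_inv M \<in> carrier_mat n n" "M * mat_inv M = 1\<^sub>m n" "mat_inv M * M = 1\<^sub>m n"
    using mat_inverse(2)[OF M] by (auto simp: mat_inv_def)
  then show "invertible_mat M"
    using M unfolding invertible_mat_def inverts_mat_def by auto
qed

lemma invertible_mat_inv:
  fixes M :: "real mat"
  assumes M: "M \<in> carrier_mat n n" and inv: "invertible_mat M"
  shows "mat_inv M \<in> carrier_mat n n" "M * mat_inv M = 1\<^sub>m n" "mat_inv M * M = 1\<^sub>m n"
proof -
  obtain B where B: "M * B = 1\<^sub>m n" "B * M = 1\<^sub>m (dim_row B)"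
    using inv M by (auto simp: invertible_mat_def inverts_mat_def)
  \<comment> \<open>The size of \<open>B\<close> is not part of \<open>invertible_mat\<close>;
    comparing column counts in the two product equations fixes it.\<close>
  have "B \<in> carrier_mat n n"
    using arg_cong[OF B(1), of dim_col] arg_cong[OF B(2), of dim_col] M by auto
  then have ker: "M *\<^sub>v v \<noteq> 0\<^sub>v n" if "v \<in> carrier_vec n" "v \<noteq> 0\<^sub>v n" for v
  proof -
    have "B *\<^sub>v (M *\<^sub>v v) = (B * M) *\<^sub>v v" using \<open>B \<in> carrier_mat n n\<close> M that by auto
    also have "\<dots> = v" using B \<open>B \<in> carrier_mat n n\<close> that by auto
    finally have "B *\<^sub>v (M *\<^sub>v v) = v" .
    moreover have "B *\<^sub>v 0\<^sub>v n = 0\<^sub>v n"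
      using \<open>B \<in> carrier_mat n n\<close> by (intro eq_vecI) auto
    ultimately show ?thesis using that(2) by auto
  qed
  then show "mat_inv M \<in> carrier_mat n n" "M * mat_inv M = 1\<^sub>m n" "mat_inv M * M = 1\<^sub>m n"
    using kernel_trivial_imp_inverse[OF M] by auto
qed

text \<open>Neither compactness of the sphere nor eigenvalues are used: if \<open>c\<close> bounds
  the form of the inverse matrix from above, then \<open>1 / c\<close> bounds the form of
  \<open>M\<close> from below. This is Cauchy-Schwarz for the inner product given by
  \<open>M\<close>, applied to \<open>v\<close> and its preimage under \<open>M\<close>.\<close>

lemma pos_def_coercive:
  assumes "pos_def n M"
  obtains c where "c > 0" "\<And>v. v \<in> carrier_vec n \<Longrightarrow> c * (v \<bullet> v) \<le> v \<bullet> (M *\<^sub>v v)"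
proof -
  have sym: "sym_mat n M" and M: "M \<in> carrier_mat n n"
    using assms by (auto simp: pos_def_def sym_mat_def)
  have nonneg: "v \<bullet> (M *\<^sub>v v) \<ge> 0" if "v \<in> carrier_vec n" for v
    using assms M that by (cases "v = 0\<^sub>v n") (auto simp: pos_def_def less_imp_le)
  have "M *\<^sub>v v \<noteq> 0\<^sub>v n" if "v \<in> carrier_vec n" "v \<noteq> 0\<^sub>v n" for v
    using assms that by (auto simp: pos_def_def)
  note Q = kernel_trivial_imp_inverse[OF M this]
  let ?Q = "mat_inv M"
  obtain c where c: "c > 0" "\<And>v. v \<in> carrier_vec n \<Longrightarrow> v \<bullet> (?Q *\<^sub>v v) \<le> c * (v \<bullet> v)"
    using quad_form_le[OF Q(1)] by auto
  have "(1 / c) * (v \<bullet> v) \<le> v \<bullet> (M *\<^sub>v v)" if v: "v \<in> carrier_vec n" for v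
  proof -
    \<comment> \<open>expand the form at \<open>v - M\<^sup>-\<^sup>1 v / c\<close>\<close>
    define y where "y = ?Q *\<^sub>v v"
    have y: "y \<in> carrier_vec n" unfolding y_def using Q v by auto
    have "M *\<^sub>v y = (M * ?Q) *\<^sub>v v"
      unfolding y_def by (rule assoc_mult_mat_vec[OF M Q(1) v, symmetric])
    then have My: "M *\<^sub>v y = v" using Q v by auto
    have Mv: "M *\<^sub>v v \<in> carrier_vec n" using M v by auto
    define \<tau> where "\<tau> = - (1 / c)"
    have ty: "\<tau> \<cdot>\<^sub>v y \<in> carrier_vec n" using y by auto
    have Mt: "M *\<^sub>v (\<tau> \<cdot>\<^sub>v y) = \<tau> \<cdot>\<^sub>v v" using mult_mat_vec[OF M y] My by simp
    have "0 \<le> (v + \<tau> \<cdot>\<^sub>v y) \<bullet> (M *\<^sub>v (v + \<tau> \<cdot>\<^sub>v y))"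
      using v ty by (intro nonneg) auto
    also have "M *\<^sub>v (v + \<tau> \<cdot>\<^sub>v y) = M *\<^sub>v v + \<tau> \<cdot>\<^sub>v v"
      using mult_add_distrib_mat_vec[OF M v ty] Mt by simp
    also have "(v + \<tau> \<cdot>\<^sub>v y) \<bullet> \<dots> = v \<bullet> (M *\<^sub>v v) + \<tau> * (v \<bullet> v) + \<tau> * (y \<bullet> (M *\<^sub>v v)) + \<tau>\<^sup>2 * (y \<bullet> v)"
      using v y ty Mv
      by (simp add: add_scalar_prod_distrib[of _ n] scalar_prod_add_distrib[of _ n] algebra_simps power2_eq_square)
    also have "y \<bullet> (M *\<^sub>v v) = v \<bullet> v" using sym_scalar_prod[OF sym y v] My by simp
    finally have 1: "0 \<le> v \<bullet> (M *\<^sub>v v) + 2 * \<tau> * (v \<bullet> v) + \<tau>\<^sup>2 * (y \<bullet> v)" by simp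
    have "y \<bullet> v = v \<bullet> y" using v y by (simp add: comm_scalar_prod)
    then have "y \<bullet> v \<le> c * (v \<bullet> v)" using c(2)[OF v] y_def by simp
    then have "\<tau>\<^sup>2 * (y \<bullet> v) \<le> \<tau>\<^sup>2 * (c * (v \<bullet> v))" by (intro mult_left_mono) auto
    also have "\<dots> = (1 / c) * (v \<bullet> v)" using c(1) by (simp add: \<tau>_def power2_eq_square)
    finally show ?thesis using 1 by (simp add: \<tau>_def)
  qed
  with c(1) that[of "1 / c"] show thesis by auto
qed

section \<open>Shifted Legendre polynomials\<close>

text \<open>Bonnet's recursion for the Legendre polynomials at \<open>2 * u - 1\<close>, which makes
  them orthogonal on \<open>[0, 1]\<close>. The value at the right endpoint is 1.\<close>

fun leg :: "nat \<Rightarrow> real \<Rightarrow> real" where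
  "leg 0 u = 1"
| "leg (Suc 0) u = 2 * u - 1"
| "leg (Suc (Suc q)) u =
     ((2 * real q + 3) * (2 * u - 1) * leg (Suc q) u - (real q + 1) * leg q u) / (real q + 2)"

text \<open>The derivative of \<open>leg\<close>, obtained by differentiating Bonnet's recursion, so
  that identities between the two families can be proved by induction.\<close>

fun legd :: "nat \<Rightarrow> real \<Rightarrow> real" where
  "legd 0 u = 0"
| "legd (Suc 0) u = 2"
| "legd (Suc (Suc q)) u =
     ((2 * real q + 3) * (2 * leg (Suc q) u + (2 * u - 1) * legd (Suc q) u) - (real q + 1) * legd q u)
       / (real q + 2)"

lemma has_derivative_leg: "(leg q has_real_derivative legd q u) (at u within A)"
proof (induction q u rule: leg.induct)
  case (1 u)
  show ?case by simp
next
  case (2 u)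
  have "leg (Suc 0) = (\<lambda>u. 2 * u - 1)" by auto
  then show ?case by (auto intro!: derivative_eq_intros)
next
  case (3 q u)
  have *: "leg (Suc (Suc q)) = (\<lambda>u. ((2 * real q + 3) * ((2 * u - 1) * leg (Suc q) u) - (real q + 1) * leg q u) / (real q + 2))"
    by (auto simp: mult.assoc)
  have "((\<lambda>u. ((2 * real q + 3) * ((2 * u - 1) * leg (Suc q) u) - (real q + 1) * leg q u) / (real q + 2))
    has_real_derivative legd (Suc (Suc q)) u) (at u within A)"
    by (auto intro!: derivative_eq_intros 3)
  then show ?case unfolding * .
qed

lemma continuous_on_leg: "continuous_on A (leg q)"
  using has_derivative_leg by (meson DERIV_continuous continuous_on_eq_continuous_within)

lemma continuous_on_leg_comp [continuous_intros]:
  "continuous_on A f \<Longrightarrow> continuous_on A (\<lambda>u. leg q (f u))"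
  using continuous_on_compose2[OF continuous_on_leg[of UNIV]] by auto

lemma leg_1: "leg q 1 = 1"
  by (induction q "1::real" rule: leg.induct) (auto simp: field_simps)

lemma leg_0: "leg q 0 = (-1) ^ q"
  by (induction q "0::real" rule: leg.induct) (auto simp: field_simps)

text \<open>The two classical derivative identities support each other, hence the joint induction:
  the first at \<open>Suc q\<close> needs the second at \<open>q\<close>, and the second at
  \<open>Suc q\<close> needs both at \<open>q\<close> and the new first one. The factors 2 are the
  derivative of \<open>2 * u - 1\<close>.\<close>

lemma legd_rec:
  shows legd_Suc: "legd (Suc q) u = (2 * u - 1) * legd q u + 2 * (real q + 1) * leg q u"
    and legd_Suc': "(2 * u - 1) * legd (Suc q) u = legd q u + 2 * (real q + 1) * leg (Suc q) u"
proof (induction q)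
  case 0
  { case 1 show ?case by simp }
  { case 2 show ?case by simp }
next
  case (Suc q)
  define x where "x = 2 * u - 1"
  define m where "m = real q"
  have m: "m + 2 \<noteq> 0" and Suc_m: "real (Suc q) = m + 1" by (auto simp: m_def)
  have L: "(m + 2) * leg (Suc (Suc q)) u = (2 * m + 3) * x * leg (Suc q) u - (m + 1) * leg q u"
    using m by (simp add: m_def x_def)
  have D: "(m + 2) * legd (Suc (Suc q)) u =
      (2 * m + 3) * (2 * leg (Suc q) u + x * legd (Suc q) u) - (m + 1) * legd q u"
    using m by (simp add: m_def x_def)
  note IH = Suc.IH[folded x_def m_def]
  have "(m + 2) * legd (Suc (Suc q)) u = (m + 2) * (x * legd (Suc q) u + 2 * (m + 2) * leg (Suc q) u)"
  proof -
    have D0: "legd q u = x * legd (Suc q) u - 2 * (m + 1) * leg (Suc q) u" using IH(2) by simp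
    show ?thesis unfolding D D0 by (simp add: algebra_simps del: leg.simps legd.simps)
  qed
  then have *: "legd (Suc (Suc q)) u = x * legd (Suc q) u + 2 * (m + 2) * leg (Suc q) u"
    using mult_left_cancel[OF m] by blast
  { case 1 show ?case using * by (simp add: x_def m_def add.commute del: legd.simps) }
  have "x * legd (Suc (Suc q)) u = legd (Suc q) u + 2 * ((m + 2) * leg (Suc (Suc q)) u)"
  proof -
    have "x * (x * legd (Suc q) u) =
        legd (Suc q) u - 2 * (m + 1) * leg q u + 2 * (m + 1) * (x * leg (Suc q) u)"
      unfolding IH(2) using IH(1) by (simp add: algebra_simps del: leg.simps legd.simps)
    then show ?thesis unfolding * L by (simp add: algebra_simps del: leg.simps legd.simps)
  qed
  { case 2 show ?case using \<open>x * legd (Suc (Suc q)) u = _\<close>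
      by (simp add: x_def m_def algebra_simps del: legd.simps leg.simps) }
qed

text \<open>The origin of \<open>gamma_coeff\<close>. Eliminating
  \<open>(2 * u - 1) * legd (Suc q) u\<close> between the two identities of \<open>legd_rec\<close>
  gives \<open>L_(q+2)' = L_q' + 2 (2 q + 3) L_(q+1)\<close>. Hence only indices of parity opposite
  to \<open>q\<close> occur, with coefficient \<open>2 (2 i + 1)\<close>.\<close>

lemma legd_expansion: "legd q u = - (\<Sum>i<q. gamma_coeff q i * leg i u)"
proof (induction q u rule: leg.induct)
  case (1 u)
  show ?case by simp
next
  case (2 u)
  show ?case by (simp add: gamma_coeff_def)
next
  case (3 q u)
  have A: "(\<Sum>i<q. gamma_coeff (Suc (Suc q)) i * leg i u) = (\<Sum>i<q. gamma_coeff q i * leg i u)"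
    by (intro sum.cong) (auto simp: gamma_coeff_def)
  have B: "gamma_coeff (Suc (Suc q)) (Suc q) = - (2 * (2 * real q + 3))"
    "gamma_coeff (Suc (Suc q)) q = 0"
    by (auto simp: gamma_coeff_def simp flip: mult_2)
  have "legd (Suc (Suc q)) u = legd q u + 2 * (2 * real q + 3) * leg (Suc q) u"
    using legd_Suc[of "Suc q" u] legd_Suc'[of u q] by (simp add: algebra_simps del: legd.simps leg.simps)
  then show ?case unfolding 3(2) sum.lessThan_Suc A B by (simp add: algebra_simps del: legd.simps leg.simps)
qed

text \<open>Legendre's equation in self-adjoint form, whose weight \<open>u\<^sup>2 - u\<close>
  vanishes at both endpoints of \<open>[0, 1]\<close>.\<close>

lemma leg_ode:
  "((\<lambda>u. (u\<^sup>2 - u) * legd q u) has_real_derivative real q * (real q + 1) * leg q u) (at u within A)"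
proof (cases q)
  case 0
  then show ?thesis by simp
next
  case (Suc m)
  \<comment> \<open>Removing \<open>legd\<close> before differentiating avoids second derivatives;
    the formula comes from \<open>4 (u\<^sup>2 - u) = (2 u - 1)\<^sup>2 - 1\<close> and
    \<open>legd_rec\<close>.\<close>
  have eq: "(u\<^sup>2 - u) * legd q u = (real m + 1) / 2 * ((2 * u - 1) * leg (Suc m) u - leg m u)" for u
  proof -
    have "4 * (u\<^sup>2 - u) * legd (Suc m) u = 2 * (real m + 1) * ((2 * u - 1) * leg (Suc m) u - leg m u)"
    proof -
      have "4 * (u\<^sup>2 - u) * legd (Suc m) u = (2 * u - 1) * ((2 * u - 1) * legd (Suc m) u) - legd (Suc m) u"
        by (simp add: algebra_simps power2_eq_square del: leg.simps legd.simps)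
      also have "\<dots> = 2 * (real m + 1) * ((2 * u - 1) * leg (Suc m) u - leg m u)"
        unfolding legd_Suc' using legd_Suc[of m u]
        by (simp add: algebra_simps del: leg.simps legd.simps)
      finally show ?thesis .
    qed
    moreover have "a * d = k / 2 * z" if "4 * a * d = 2 * k * z" for a d k z :: real
      using that by simp
    ultimately show ?thesis unfolding Suc by blast
  qed
  have "((\<lambda>u. (real m + 1) / 2 * ((2 * u - 1) * leg (Suc m) u - leg m u)) has_real_derivative
      (real m + 1) / 2 * (2 * leg (Suc m) u + (2 * u - 1) * legd (Suc m) u - legd m u)) (at u within A)"
    by (auto intro!: derivative_eq_intros has_derivative_leg simp del: leg.simps legd.simps)
  also have "2 * leg (Suc m) u + (2 * u - 1) * legd (Suc m) u - legd m u = 2 * (real q + 1) * leg q u"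
    using legd_Suc'[of u m] unfolding Suc by (simp add: algebra_simps del: leg.simps legd.simps)
  finally show ?thesis unfolding eq
    by (rule DERIV_cong) (simp add: Suc field_simps del: leg.simps legd.simps)
qed

lemma leg_orthogonal:
  assumes "p \<noteq> q"
  shows "((\<lambda>u. leg p u * leg q u) has_integral 0) {0..1}"
proof -
  \<comment> \<open>The Sturm-Liouville bracket of \<open>L_p\<close> and \<open>L_q\<close>: in its
    derivative the products of first derivatives cancel, and it vanishes at 0 and 1.\<close>
  define F where "F u = (u\<^sup>2 - u) * legd p u * leg q u - (u\<^sup>2 - u) * legd q u * leg p u" for u
  define c where "c = real p * (real p + 1) - real q * (real q + 1)"
  have "(F has_real_derivative c * (leg p u * leg q u)) (at u within {0..1})" for u
    unfolding F_def
    by (rule DERIV_cong[OF DERIV_diff[OF DERIV_mult[OF leg_ode has_derivative_leg]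
          DERIV_mult[OF leg_ode has_derivative_leg]]]) (simp add: c_def algebra_simps)
  then have "((\<lambda>u. c * (leg p u * leg q u)) has_integral F 1 - F 0) {0..1}"
    by (intro fundamental_theorem_of_calculus) (auto simp: has_real_derivative_iff_has_vector_derivative)
  then have "((\<lambda>u. (1 / c) * (c * (leg p u * leg q u))) has_integral (1 / c) * 0) {0..1}"
    by (intro has_integral_mult_right) (simp add: F_def)
  moreover have "c \<noteq> 0"
  proof -
    have "c = (real p - real q) * (real p + real q + 1)" by (simp add: c_def algebra_simps)
    then show ?thesis using assms by (auto simp: add_eq_0_iff)
  qed
  ultimately show ?thesis by simp
qed

lemma leg_norm: "((\<lambda>u. leg q u * leg q u) has_integral 1 / (2 * real q + 1)) {0..1}"
proof (cases q)
  case 0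
  then show ?thesis using has_integral_const_real[of "1::real" 0 1] by simp
next
  case (Suc m)
  \<comment> \<open>\<open>F\<close> increases by 2 over \<open>[0, 1]\<close>. By
    \<open>legd_rec\<close> its derivative is \<open>2 (2 q + 1) L_q\<^sup>2\<close> plus
    \<open>2 L_q L_m'\<close>, and \<open>L_m'\<close> is a combination of lower Legendre
    polynomials, orthogonal to \<open>L_q\<close>.\<close>
  define F where "F u = (2 * u - 1) * leg q u * leg q u" for u
  have "(F has_real_derivative (2 * leg q u * leg q u + 2 * leg q u * ((2 * u - 1) * legd q u))) (at u within {0..1})" for u
    unfolding F_def
    by (auto intro!: derivative_eq_intros has_derivative_leg simp: algebra_simps)
  moreover have "2 * leg q u * leg q u + 2 * leg q u * ((2 * u - 1) * legd q u)
      = 2 * (2 * real q + 1) * (leg q u * leg q u) - 2 * (\<Sum>i<m. gamma_coeff m i * (leg q u * leg i u))" for u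
    unfolding Suc legd_Suc'[of u m] legd_expansion[of m]
    by (simp add: algebra_simps sum_distrib_left del: leg.simps legd.simps)
  ultimately have "((\<lambda>u. 2 * (2 * real q + 1) * (leg q u * leg q u)
      - 2 * (\<Sum>i<m. gamma_coeff m i * (leg q u * leg i u))) has_integral F 1 - F 0) {0..1}"
    by (intro fundamental_theorem_of_calculus)
      (auto simp: has_real_derivative_iff_has_vector_derivative)
  moreover have "F 1 - F 0 = 2" by (simp add: F_def leg_0 leg_1 flip: power_add mult_2)
  moreover have "((\<lambda>u. 2 * (\<Sum>i<m. gamma_coeff m i * (leg q u * leg i u))) has_integral
      2 * (\<Sum>i<m. gamma_coeff m i * 0)) {0..1}"
    using Suc by (intro has_integral_mult_right has_integral_sum leg_orthogonal) auto
  ultimately have "((\<lambda>u. 2 * (2 * real q + 1) * (leg q u * leg q u)) has_integral 2) {0..1}"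
    by (auto dest: has_integral_add)
  have eq: "1 / (2 * (2 * real q + 1)) * (2 * (2 * real q + 1) * z) = z" for z
    by (simp add: add_pos_nonneg order.strict_implies_not_eq field_simps)
  have eq2: "1 / (2 * K) * 2 = 1 / K" for K :: real by simp
  from has_integral_mult_right[OF \<open>(_ has_integral 2) _\<close>, of "1 / (2 * (2 * real q + 1))"]
  show ?thesis unfolding eq eq2 .
qed

text \<open>The form \<open>R\<close> is nonnegative at the difference of \<open>f\<close> and its Legendre projection; integrate.\<close>

lemma legendre_bessel:
  fixes f :: "real \<Rightarrow> real Matrix.vec" and R :: "real mat"
  assumes R: "R \<in> carrier_mat n n" and nonneg: "\<And>v. v \<in> carrier_vec n \<Longrightarrow> v \<bullet> (R *\<^sub>v v) \<ge> 0"
    and f: "vec_continuous_on n {0..1} f"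
    and c: "\<And>q. q < M \<Longrightarrow> c q \<in> carrier_vec n"
    and c_int: "\<And>q i. q < M \<Longrightarrow> i < n \<Longrightarrow> ((\<lambda>u. leg q u * f u $ i) has_integral c q $ i) {0..1}"
    and I: "((\<lambda>u. f u \<bullet> (R *\<^sub>v f u)) has_integral I) {0..1}"
  shows "(\<Sum>q<M. (2 * real q + 1) * (c q \<bullet> (R *\<^sub>v c q))) \<le> I"
proof -
  \<comment> \<open>The Legendre projection of \<open>f\<close>; the weights \<open>2 q + 1\<close>
    are the reciprocal squared norms from \<open>leg_norm\<close>.\<close>
  define prj where "prj u i = (\<Sum>q<M. (2 * real q + 1) * c q $ i * leg q u)" for u i
  define J where "J i j = integral {0..1} (\<lambda>u. f u $ i * f u $ j)" for i j
  have fc: "f u \<in> carrier_vec n" if "u \<in> {0..1}" for u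
    using f that by (auto simp: vec_continuous_on_def)
  have J: "((\<lambda>u. f u $ i * f u $ j) has_integral J i j) {0..1}" if "i < n" "j < n" for i j
    unfolding J_def using f that
    by (intro integrable_integral integrable_continuous_interval continuous_on_mult)
      (auto simp: vec_continuous_on_def)
  have fprj: "((\<lambda>u. f u $ i * prj u j) has_integral (\<Sum>q<M. (2 * real q + 1) * c q $ j * c q $ i)) {0..1}"
    if "i < n" "j < n" for i j
  proof -
    have "((\<lambda>u. \<Sum>q<M. (2 * real q + 1) * c q $ j * (leg q u * f u $ i)) has_integral
        (\<Sum>q<M. (2 * real q + 1) * c q $ j * c q $ i)) {0..1}"
      using that by (intro has_integral_sum has_integral_mult_right c_int) auto
    then show ?thesis by (simp add: prj_def sum_distrib_left mult_ac)
  qed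
  have prjprj: "((\<lambda>u. prj u i * prj u j) has_integral (\<Sum>q<M. (2 * real q + 1) * c q $ j * c q $ i)) {0..1}"
    for i j
  proof -
    have LL: "((\<lambda>u. leg p u * leg q u) has_integral (if p = q then 1 / (2 * real q + 1) else 0)) {0..1}" for p q
      using leg_orthogonal[of p q] leg_norm[of q] by auto
    have "((\<lambda>u. \<Sum>p<M. \<Sum>q<M. (2 * real p + 1) * c p $ i * ((2 * real q + 1) * c q $ j) * (leg p u * leg q u))
       has_integral (\<Sum>p<M. \<Sum>q<M. (2 * real p + 1) * c p $ i * ((2 * real q + 1) * c q $ j)
         * (if p = q then 1 / (2 * real q + 1) else 0))) {0..1}"
      by (intro has_integral_sum has_integral_mult_right LL) auto
    moreover have "(\<Sum>q<M. (2 * real p + 1) * c p $ i * ((2 * real q + 1) * c q $ j)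
         * (if p = q then 1 / (2 * real q + 1) else 0)) = (2 * real p + 1) * c p $ j * c p $ i" if "p < M" for p
    proof -
      have nz: "2 * real p + 1 \<noteq> 0" by (rule less_imp_neq[symmetric]) (simp add: add_nonneg_pos)
      have "(\<Sum>q<M. (2 * real p + 1) * c p $ i * ((2 * real q + 1) * c q $ j)
         * (if p = q then 1 / (2 * real q + 1) else 0)) = (\<Sum>q<M. if p = q then (2 * real p + 1) * c p $ j * c p $ i else 0)"
        using nz by (intro sum.cong) auto
      then show ?thesis using that by simp
    qed
    ultimately show ?thesis by (simp add: prj_def sum_product mult_ac)
  qed
  define e where "e u = Matrix.vec n (\<lambda>i. f u $ i - prj u i)" for u
  have e: "((\<lambda>u. e u $ i * e u $ j) has_integral (J i j - (\<Sum>q<M. (2 * real q + 1) * c q $ i * c q $ j))) {0..1}"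
    if "i < n" "j < n" for i j
  proof -
    \<comment> \<open>Both mixed terms and the square of the projection have the same integral, so
      one copy with negative sign remains: Pythagoras, entry by entry.\<close>
    have "((\<lambda>u. f u $ i * f u $ j - f u $ i * prj u j - f u $ j * prj u i + prj u i * prj u j) has_integral
        J i j - (\<Sum>q<M. (2 * real q + 1) * c q $ j * c q $ i)
          - (\<Sum>q<M. (2 * real q + 1) * c q $ i * c q $ j)
          + (\<Sum>q<M. (2 * real q + 1) * c q $ j * c q $ i)) {0..1}"
      using that by (intro has_integral_add has_integral_diff J fprj prjprj)
    then show ?thesis using that by (simp add: e_def algebra_simps)
  qed
  have "((\<lambda>u. \<Sum>i<n. \<Sum>j<n. R $$ (i, j) * (f u $ i * f u $ j)) has_integral
      (\<Sum>i<n. \<Sum>j<n. R $$ (i, j) * J i j)) {0..1}"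
    by (intro has_integral_sum has_integral_mult_right J) auto
  then have "((\<lambda>u. f u \<bullet> (R *\<^sub>v f u)) has_integral (\<Sum>i<n. \<Sum>j<n. R $$ (i, j) * J i j)) {0..1}"
    by (rule has_integral_eq[rotated]) (use fc R in \<open>auto simp: scalar_prod_mult_mat_vec mult_ac\<close>)
  then have IJ: "I = (\<Sum>i<n. \<Sum>j<n. R $$ (i, j) * J i j)"
    using I has_integral_unique by blast
  have "((\<lambda>u. \<Sum>i<n. \<Sum>j<n. R $$ (i, j) * (e u $ i * e u $ j)) has_integral
      (\<Sum>i<n. \<Sum>j<n. R $$ (i, j) * (J i j - (\<Sum>q<M. (2 * real q + 1) * c q $ i * c q $ j)))) {0..1}"
    by (intro has_integral_sum has_integral_mult_right e) auto
  then have "0 \<le> (\<Sum>i<n. \<Sum>j<n. R $$ (i, j) * (J i j - (\<Sum>q<M. (2 * real q + 1) * c q $ i * c q $ j)))"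
  proof (rule has_integral_nonneg)
    fix u :: real assume "u \<in> {0..1}"
    have "e u \<in> carrier_vec n" by (simp add: e_def)
    from nonneg[OF this] show "0 \<le> (\<Sum>i<n. \<Sum>j<n. R $$ (i, j) * (e u $ i * e u $ j))"
      unfolding scalar_prod_mult_mat_vec[OF R \<open>e u \<in> _\<close> \<open>e u \<in> _\<close>] by (simp add: mult_ac)
  qed
  also have "\<dots> = I - (\<Sum>i<n. \<Sum>j<n. \<Sum>q<M. R $$ (i, j) * ((2 * real q + 1) * c q $ i * c q $ j))"
    by (simp add: IJ right_diff_distrib sum_subtractf sum_distrib_left)
  also have "(\<Sum>i<n. \<Sum>j<n. \<Sum>q<M. R $$ (i, j) * ((2 * real q + 1) * c q $ i * c q $ j))
     = (\<Sum>i<n. \<Sum>q<M. \<Sum>j<n. R $$ (i, j) * ((2 * real q + 1) * c q $ i * c q $ j))"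
    by (intro sum.cong refl sum.swap)
  also have "\<dots> = (\<Sum>q<M. \<Sum>i<n. \<Sum>j<n. R $$ (i, j) * ((2 * real q + 1) * c q $ i * c q $ j))"
    by (rule sum.swap)
  also have "\<dots> = (\<Sum>q<M. (2 * real q + 1) * (c q \<bullet> (R *\<^sub>v c q)))"
    using c R by (intro sum.cong) (auto simp: scalar_prod_mult_mat_vec sum_distrib_left mult_ac)
  finally show ?thesis by simp
qed

section \<open>Derivatives of vector-valued functions\<close>

text \<open>Dimensions are demanded at every \<open>s\<close>, not only near \<open>t\<close>,
  because the meaning of an index into \<open>f s @\<^sub>v g s\<close> depends on the length of
  \<open>f s\<close>.\<close>

definition vec_deriv :: "nat \<Rightarrow> (real \<Rightarrow> real Matrix.vec) \<Rightarrow> real Matrix.vec \<Rightarrow> real \<Rightarrow> bool" where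
  "vec_deriv n f f' t \<longleftrightarrow> (\<forall>s. f s \<in> carrier_vec n) \<and> f' \<in> carrier_vec n \<and>
     (\<forall>i<n. ((\<lambda>s. f s $ i) has_real_derivative f' $ i) (at t))"

definition vcat :: "real Matrix.vec list \<Rightarrow> real Matrix.vec" where
  "vcat vs = foldr append_vec vs (0\<^sub>v 0)"

lemma vcat_Nil [simp]: "vcat [] = 0\<^sub>v 0"
  and vcat_Cons [simp]: "vcat (v # vs) = v @\<^sub>v vcat vs"
  by (simp_all add: vcat_def)

lemma vec_deriv_append:
  assumes "vec_deriv n f f' t" "vec_deriv m g g' t"
  shows "vec_deriv (n + m) (\<lambda>s. f s @\<^sub>v g s) (f' @\<^sub>v g') t"
  unfolding vec_deriv_def
proof (intro conjI allI impI)
  have car: "f s \<in> carrier_vec n" "g s \<in> carrier_vec m" "f' \<in> carrier_vec n" "g' \<in> carrier_vec m" for s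
    using assms by (auto simp: vec_deriv_def)
  show "f s @\<^sub>v g s \<in> carrier_vec (n + m)" for s using car by simp
  show "f' @\<^sub>v g' \<in> carrier_vec (n + m)" using car by simp
  fix i assume "i < n + m"
  then have "(f s @\<^sub>v g s) $ i = (if i < n then f s $ i else g s $ (i - n))"
    "(f' @\<^sub>v g') $ i = (if i < n then f' $ i else g' $ (i - n))" for s
    using car(1)[of s] car(2)[of s] car(3,4) by auto
  then show "((\<lambda>s. (f s @\<^sub>v g s) $ i) has_real_derivative (f' @\<^sub>v g') $ i) (at t)"
    using assms \<open>i < n + m\<close> by (cases "i < n") (auto simp: vec_deriv_def)
qed

lemma vec_deriv_vcat:
  assumes "\<And>k. k \<in> set ks \<Longrightarrow> vec_deriv n (f k) (f' k) t"
  shows "vec_deriv (length ks * n) (\<lambda>s. vcat (map (\<lambda>k. f k s) ks)) (vcat (map f' ks)) t"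
  using assms
proof (induction ks)
  case Nil
  then show ?case by (simp add: vec_deriv_def)
next
  case (Cons k ks)
  then show ?case using vec_deriv_append[of n "f k" "f' k" t] by simp
qed

lemma scalar_prod_vcat_self:
  assumes "\<And>k. k \<in> set ks \<Longrightarrow> f k \<in> carrier_vec n"
  shows "vcat (map f ks) \<in> carrier_vec (length ks * n)"
    and "vcat (map f ks) \<bullet> vcat (map f ks) = (\<Sum>k\<leftarrow>ks. f k \<bullet> f k)"
proof -
  have "vcat (map f ks) \<in> carrier_vec (length ks * n) \<and>
    vcat (map f ks) \<bullet> vcat (map f ks) = (\<Sum>k\<leftarrow>ks. f k \<bullet> f k)"
    using assms
    by (induction ks) (auto simp: scalar_prod_append[of _ n _ "_ * n"])
  then show "vcat (map f ks) \<in> carrier_vec (length ks * n)"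
    "vcat (map f ks) \<bullet> vcat (map f ks) = (\<Sum>k\<leftarrow>ks. f k \<bullet> f k)" by auto
qed

lemma has_derivative_quad_form:
  assumes sym: "sym_mat n M" and f: "vec_deriv n f f' t"
  shows "((\<lambda>s. f s \<bullet> (M *\<^sub>v f s)) has_real_derivative 2 * (f t \<bullet> (M *\<^sub>v f'))) (at t)"
proof -
  have M: "M \<in> carrier_mat n n" using sym by (simp add: sym_mat_def)
  have car: "f s \<in> carrier_vec n" "f' \<in> carrier_vec n" for s using f by (auto simp: vec_deriv_def)
  have "((\<lambda>s. f s $ i * M $$ (i, j) * f s $ j) has_real_derivative
      f' $ i * M $$ (i, j) * f t $ j + f t $ i * M $$ (i, j) * f' $ j) (at t)"
    if "i < n" "j < n" for i j
  proof -
    have "((\<lambda>s. f s $ i) has_real_derivative f' $ i) (at t)" "((\<lambda>s. f s $ j) has_real_derivative f' $ j) (at t)"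
      using f that by (auto simp: vec_deriv_def)
    then show ?thesis by (auto intro!: derivative_eq_intros)
  qed
  then have "((\<lambda>s. f s \<bullet> (M *\<^sub>v f s)) has_real_derivative
      (\<Sum>i<n. \<Sum>j<n. f' $ i * M $$ (i, j) * f t $ j + f t $ i * M $$ (i, j) * f' $ j)) (at t)"
    unfolding scalar_prod_mult_mat_vec[OF M car(1) car(1)] by (intro DERIV_sum) auto
  also have "(\<Sum>i<n. \<Sum>j<n. f' $ i * M $$ (i, j) * f t $ j + f t $ i * M $$ (i, j) * f' $ j)
      = f' \<bullet> (M *\<^sub>v f t) + f t \<bullet> (M *\<^sub>v f')"
    using car by (simp add: scalar_prod_mult_mat_vec[OF M] sum.distrib)
  also have "\<dots> = 2 * (f t \<bullet> (M *\<^sub>v f'))" using sym_scalar_prod[OF sym car(2) car(1)] by simp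
  finally show ?thesis .
qed

lemma continuous_on_quad_form:
  assumes M: "M \<in> carrier_mat n n" and f: "vec_continuous_on n A f"
  shows "continuous_on A (\<lambda>s. f s \<bullet> (M *\<^sub>v f s))"
proof -
  have "continuous_on A (\<lambda>s. \<Sum>i<n. \<Sum>j<n. f s $ i * M $$ (i, j) * f s $ j)"
    using f by (intro continuous_intros) (auto simp: vec_continuous_on_def)
  then show ?thesis
    by (rule continuous_on_eq) (use f M in \<open>auto simp: vec_continuous_on_def scalar_prod_mult_mat_vec\<close>)
qed

text \<open>Turns integrals over a moving window into differences \<open>G t - G (t - h)\<close>.
  Continuity up to 0 is included so that an antiderivative can itself be integrated again.\<close>

lemma antiderivative_exists:
  fixes g :: "real \<Rightarrow> real"
  assumes "continuous_on {0..} g"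
  obtains G where "continuous_on {0..} G" "\<And>t. t > 0 \<Longrightarrow> (G has_real_derivative g t) (at t)"
proof
  let ?G = "\<lambda>t. integral {0..t} g"
  have D: "(?G has_real_derivative g t) (at t within {0..b})" if "t \<in> {0..b}" for t b
    using assms that by (intro integral_has_real_derivative) (auto elim: continuous_on_subset)
  show "continuous_on {0..} ?G"
    unfolding continuous_on_eq_continuous_within
  proof
    fix t :: real assume t: "t \<in> {0..}"
    have "at t within {0..} = at t within {0..t + 1}"
      by (rule at_within_nhd[of _ "{t - 1<..<t + 1}"]) auto
    with DERIV_continuous[OF D[of t "t + 1"]] t show "continuous (at t within {0..}) ?G" by simp
  qed
  show "(?G has_real_derivative g t) (at t)" if "t > 0" for t
    using D[of t "t + 1"] that at_within_Icc_at[of 0 t "t + 1"] by simp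
qed

text \<open>\<open>G\<close> is nondecreasing and bounded, so its increments over a fixed length
  \<open>d\<close> die out. The mean value theorem then finds a point near \<open>t\<close> where
  \<open>u\<close> is small, and the bound on \<open>u'\<close> carries this back to
  \<open>t\<close>.\<close>

lemma barbalat_square_integrable:
  fixes u G :: "real \<Rightarrow> real"
  assumes G: "\<And>t. t \<ge> a \<Longrightarrow> (G has_real_derivative u t) (at t)"
    and u: "\<And>t. t \<ge> a \<Longrightarrow> (u has_real_derivative u' t) (at t)"
    and nonneg: "\<And>t. t \<ge> a \<Longrightarrow> u t \<ge> 0" and bdd: "\<And>t. t \<ge> a \<Longrightarrow> G t \<le> K"
    and L: "\<And>t. t \<ge> a \<Longrightarrow> \<bar>u' t\<bar> \<le> L"
  shows "(u \<longlongrightarrow> 0) at_top"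
proof -
  have mono: "G s \<le> G t" if "a \<le> s" "s \<le> t" for s t
  proof (rule DERIV_nonneg_imp_nondecreasing[OF that(2)])
    fix z assume "s \<le> z" "z \<le> t"
    then show "\<exists>y. DERIV G z :> y \<and> 0 \<le> y"
      using G[of z] nonneg[of z] that(1) by (intro exI[of _ "u z"]) auto
  qed
  define Sp where "Sp = (SUP t\<in>{a..}. G t)"
  have bdd': "bdd_above (G ` {a..})" using bdd by (auto intro!: bdd_aboveI)
  have lim: "eventually (\<lambda>t. Sp - e < G t \<and> G t \<le> Sp) at_top" if e: "e > 0" for e
  proof -
    obtain s where s: "s \<ge> a" "Sp - e < G s"
      using less_cSUP_iff[OF _ bdd', of "Sp - e"] e unfolding Sp_def[symmetric] by auto
    have "Sp - e < G t \<and> G t \<le> Sp" if "t \<ge> s" for t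
      using mono[of s t] s that cSUP_upper[OF _ bdd', of t] unfolding Sp_def[symmetric] by auto
    then show ?thesis unfolding eventually_at_top_linorder by blast
  qed
  define L' where "L' = max L 1"
  have L': "L' > 0" by (simp add: L'_def)
  show ?thesis
  proof (rule tendstoI)
    fix e :: real assume e: "e > 0"
    \<comment> \<open>Over a time \<open>d\<close> the function \<open>u\<close> can change by at
      most \<open>d * L' = e / 2\<close>; the maximum with 1 in \<open>L'\<close> makes this
      division legitimate.\<close>
    define d where "d = e / (2 * L')"
    have d: "d > 0" using e L' by (simp add: d_def)
    have "eventually (\<lambda>t. (Sp - d * (e / 2) < G t \<and> G t \<le> Sp) \<and> t \<ge> a) at_top"
      using eventually_conj[OF lim[of "d * (e / 2)"] eventually_ge_at_top[of a]] d e by simp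
    then show "eventually (\<lambda>t. dist (u t) 0 < e) at_top"
    proof eventually_elim
      case (elim t)
      have up: "G (t + d) \<le> Sp"
        using cSUP_upper[OF _ bdd', of "t + d"] elim d unfolding Sp_def[symmetric] by auto
      obtain z where z: "t < z" "z < t + d" "G (t + d) - G t = (t + d - t) * u z"
        using MVT2[of t "t + d" G u] G elim d by auto
      obtain z' where z': "t < z'" "z' < z" "u z - u t = (z - t) * u' z'"
        using MVT2[of t z u u'] u elim z(1) by auto
      have "d * u z < d * (e / 2)" using z(3) up elim by auto
      then have 1: "u z < e / 2" using d by simp
      have "- u' z' \<le> L'" using L[of z'] z' elim by (auto simp: L'_def)
      then have "(z - t) * - u' z' \<le> d * L'"
        using z d L' by (intro order.trans[OF mult_left_mono[of _ L'] mult_right_mono]) auto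
      also have "\<dots> = e / 2" using L' by (simp add: d_def)
      finally have "u t < e" using z'(3) 1 by simp
      then show ?case using nonneg[of t] elim by simp
    qed
  qed
qed

section \<open>The Lyapunov-Krasovskii functional\<close>

locale delay_system =
  fixes n :: nat and h :: real and A0 A1 :: "real mat"
  assumes h: "h > 0" and A0: "A0 \<in> carrier_mat n n" and A1: "A1 \<in> carrier_mat n n"
begin

text \<open>Stands for the derivative of a solution. As a formula it is continuous on all of
  \<open>[0, \<infinity>)\<close>, also at 0, where differentiability of the solution is not
  demanded.\<close>

definition rhs :: "(real \<Rightarrow> real Matrix.vec) \<Rightarrow> real \<Rightarrow> real Matrix.vec" where
  "rhs w t = A0 *\<^sub>v w t + A1 *\<^sub>v w (t - h)"

text \<open>The dimension is fixed at all real times, also before \<open>-h\<close>, as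
  \<open>vec_deriv\<close> demands.\<close>

definition sol :: "(real \<Rightarrow> real Matrix.vec) \<Rightarrow> bool" where
  "sol w \<longleftrightarrow> (\<forall>t. w t \<in> carrier_vec n) \<and> vec_continuous_on n {-h..} w \<and>
     (\<forall>t>0. vec_deriv n w (rhs w t) t)"

text \<open>\<open>moment q f t\<close> is the integral of \<open>L\<^sub>q((s - t + h) / h) f(s)\<close> over \<open>s \<in> [t - h, t]\<close>.\<close>

definition moment :: "nat \<Rightarrow> (real \<Rightarrow> real Matrix.vec) \<Rightarrow> real \<Rightarrow> real Matrix.vec" where
  "moment q f t = Matrix.vec n (\<lambda>i. h * integral {0..1} (\<lambda>u. leg q u * f (t - h + h * u) $ i))"

lemma sol_carrier: "sol w \<Longrightarrow> w t \<in> carrier_vec n"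
  by (simp add: sol_def)

lemma rhs_carrier: "sol w \<Longrightarrow> rhs w t \<in> carrier_vec n"
  using A0 A1 by (auto simp: rhs_def sol_def)

lemma moment_carrier [simp]: "moment q f t \<in> carrier_vec n"
  by (simp add: moment_def)

lemma continuous_on_mult_mat_vec:
  assumes "M \<in> carrier_mat n n" "vec_continuous_on n A f"
  shows "vec_continuous_on n A (\<lambda>t. M *\<^sub>v f t)"
proof -
  have f: "f t \<in> carrier_vec n" if "t \<in> A" for t using assms that by (auto simp: vec_continuous_on_def)
  have "continuous_on A (\<lambda>t. (M *\<^sub>v f t) $ i)" if i: "i < n" for i
  proof -
    have "continuous_on A (\<lambda>t. \<Sum>j<n. M $$ (i, j) * f t $ j)"
      using assms by (intro continuous_intros) (auto simp: vec_continuous_on_def)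
    moreover have "(\<Sum>j<n. M $$ (i, j) * f t $ j) = (M *\<^sub>v f t) $ i" if "t \<in> A" for t
      using f[OF that] assms(1) i by (auto simp: scalar_prod_def atLeast0LessThan intro!: sum.cong)
    ultimately show ?thesis by (rule continuous_on_eq)
  qed
  then show ?thesis using assms f by (auto simp: vec_continuous_on_def)
qed

lemma vec_continuous_on_compose:
  assumes "vec_continuous_on n B f" "continuous_on A g" "g ` A \<subseteq> B"
  shows "vec_continuous_on n A (\<lambda>t. f (g t))"
  using assms unfolding vec_continuous_on_def by (auto intro: continuous_on_compose2)

lemma vec_continuous_on_subset:
  "vec_continuous_on n B f \<Longrightarrow> A \<subseteq> B \<Longrightarrow> vec_continuous_on n A f"
  unfolding vec_continuous_on_def by (auto intro: continuous_on_subset)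

lemma sol_continuous: "sol w \<Longrightarrow> vec_continuous_on n {-h..} w"
  by (simp add: sol_def)

lemma rhs_continuous:
  assumes "sol w"
  shows "vec_continuous_on n {0..} (rhs w)"
proof -
  have "vec_continuous_on n {0..} (\<lambda>t. A0 *\<^sub>v w t)"
    using h by (intro continuous_on_mult_mat_vec A0 vec_continuous_on_subset[OF sol_continuous[OF assms]]) auto
  moreover have "vec_continuous_on n {0..} (\<lambda>t. A1 *\<^sub>v w (t - h))"
    using h by (intro continuous_on_mult_mat_vec A1 vec_continuous_on_compose[OF sol_continuous[OF assms]]
        continuous_intros) auto
  ultimately show ?thesis
    unfolding rhs_def vec_continuous_on_def using A0 A1
    by (auto intro!: continuous_on_add)
qed

lemma window_continuous:
  assumes "vec_continuous_on n {0..} f" "t \<ge> h"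
  shows "vec_continuous_on n {0..1} (\<lambda>u. f (t - h + h * u))"
  using assms h by (intro vec_continuous_on_compose[OF assms(1)] continuous_intros) auto

lemma moment_has_integral:
  assumes "vec_continuous_on n {0..} f" "t \<ge> h" "i < n"
  shows "((\<lambda>u. leg q u * f (t - h + h * u) $ i) has_integral moment q f t $ i / h) {0..1}"
proof -
  have "(\<lambda>u. leg q u * f (t - h + h * u) $ i) integrable_on {0..1}"
    using window_continuous[OF assms(1,2)] assms(3)
    by (intro integrable_continuous_interval continuous_on_mult continuous_on_leg)
      (auto simp: vec_continuous_on_def)
  then show ?thesis using assms(3) h by (simp add: moment_def has_integral_integral)
qed

text \<open>The window is rescaled to the fixed interval \<open>[0, 1]\<close>, so differentiation
  under the integral produces no boundary terms and simply replaces \<open>w\<close> by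
  \<open>w'\<close>. The condition \<open>t > h\<close> keeps the whole window inside the positive
  times.\<close>

lemma moment_deriv:
  assumes w: "sol w" and t: "t > h"
  shows "vec_deriv n (moment q w) (moment q (rhs w) t) t"
  unfolding vec_deriv_def
proof (intro conjI allI impI)
  fix i assume i: "i < n"
  have wc: "vec_continuous_on n {0..} w"
    using vec_continuous_on_subset[OF sol_continuous[OF w]] h by auto
  have rc: "vec_continuous_on n {0..} (rhs w)" by (rule rhs_continuous[OF w])
  have "((\<lambda>s. integral (cbox 0 1) (\<lambda>u. leg q u * w (s - h + h * u) $ i)) has_field_derivative
      integral (cbox 0 1) (\<lambda>u. leg q u * rhs w (t - h + h * u) $ i)) (at t within {h<..})"
  proof (rule leibniz_rule_field_derivative)
    fix s u :: real assume s: "s \<in> {h<..}" and u: "u \<in> cbox 0 1"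
    have "s - h + h * u > 0" using s u h by (simp add: add_pos_nonneg)
    then have D: "((\<lambda>s. w s $ i) has_real_derivative rhs w (s - h + h * u) $ i) (at (s - h + h * u))"
      using w i by (auto simp: sol_def vec_deriv_def)
    have "((\<lambda>s. s - h + h * u) has_real_derivative 1) (at s within {h<..})"
      by (auto intro!: derivative_eq_intros)
    from DERIV_chain2[OF D this]
    show "((\<lambda>s. leg q u * w (s - h + h * u) $ i) has_field_derivative
        leg q u * rhs w (s - h + h * u) $ i) (at s within {h<..})"
      using DERIV_cmult by fastforce
  next
    fix s :: real assume "s \<in> {h<..}"
    then show "(\<lambda>u. leg q u * w (s - h + h * u) $ i) integrable_on cbox 0 1"
      using moment_has_integral[OF wc _ i, of s q] by auto
  next
    have "continuous_on {0..} (\<lambda>t. rhs w t $ i)" using rc i by (auto simp: vec_continuous_on_def)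
    then have "continuous_on ({h<..} \<times> cbox 0 1) (\<lambda>p. rhs w (fst p - h + h * snd p) $ i)"
      by (rule continuous_on_compose2) (use h in \<open>auto intro!: continuous_intros\<close>)
    then show "continuous_on ({h<..} \<times> cbox 0 1) (\<lambda>(s, u). leg q u * rhs w (s - h + h * u) $ i)"
      unfolding case_prod_beta by (intro continuous_intros)
  qed (use t in auto)
  then have "((\<lambda>s. integral {0..1} (\<lambda>u. leg q u * w (s - h + h * u) $ i)) has_field_derivative
      integral {0..1} (\<lambda>u. leg q u * rhs w (t - h + h * u) $ i)) (at t)"
    using t at_within_open[of t "{h<..}"] by auto
  from DERIV_cmult[OF this, of h]
  show "((\<lambda>s. moment q w s $ i) has_real_derivative moment q (rhs w) t $ i) (at t)"
    using i by (simp add: moment_def)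
qed auto

text \<open>Integration by parts: \<open>leg_1\<close> and \<open>leg_0\<close> give the two
  boundary terms, and \<open>legd_expansion\<close> turns the remaining integral into moments of
  \<open>w\<close>. The right-hand side is what the matrix \<open>Gamma_mat n N q\<close>
  computes.\<close>

lemma moment_rhs:
  assumes w: "sol w" and t: "t > h" and i: "i < n" and q: "q \<le> N"
  shows "moment q (rhs w) t $ i =
    w t $ i + (-1) ^ (q + 1) * w (t - h) $ i + (\<Sum>j<N. gamma_coeff q j * (moment j w t $ i / h))"
proof -
  have wc: "vec_continuous_on n {0..} w"
    using vec_continuous_on_subset[OF sol_continuous[OF w]] h by auto
  have rc: "vec_continuous_on n {0..} (rhs w)" by (rule rhs_continuous[OF w])
  define F where "F u = leg q u * w (t - h + h * u) $ i" for u
  have "(F has_real_derivative legd q u * w (t - h + h * u) $ i + leg q u * (rhs w (t - h + h * u) $ i * h))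
      (at u within {0..1})" if u: "u \<in> {0..1}" for u
  proof -
    have "t - h + h * u > 0" using t u h by (simp add: add_pos_nonneg)
    then have D: "((\<lambda>s. w s $ i) has_real_derivative rhs w (t - h + h * u) $ i) (at (t - h + h * u))"
      using w i by (auto simp: sol_def vec_deriv_def)
    have "((\<lambda>u. t - h + h * u) has_real_derivative h) (at u within {0..1})"
      by (auto intro!: derivative_eq_intros)
    from DERIV_mult[OF has_derivative_leg DERIV_chain2[OF D this]]
    show ?thesis unfolding F_def by (rule DERIV_cong) simp
  qed
  then have "((\<lambda>u. legd q u * w (t - h + h * u) $ i + leg q u * (rhs w (t - h + h * u) $ i * h))
      has_integral F 1 - F 0) {0..1}"
    by (intro fundamental_theorem_of_calculus) (auto simp: has_real_derivative_iff_has_vector_derivative)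
  moreover have "F 1 - F 0 = w t $ i + (-1) ^ (q + 1) * w (t - h) $ i"
    by (simp add: F_def leg_0 leg_1)
  moreover have "((\<lambda>u. - (\<Sum>j<q. gamma_coeff q j * (leg j u * w (t - h + h * u) $ i))
        + h * (leg q u * rhs w (t - h + h * u) $ i))
      has_integral - (\<Sum>j<q. gamma_coeff q j * (moment j w t $ i / h)) + h * (moment q (rhs w) t $ i / h)) {0..1}"
    using t i by (intro has_integral_add has_integral_neg has_integral_sum has_integral_mult_right
        moment_has_integral wc rc) auto
  moreover have "legd q u * w (t - h + h * u) $ i + leg q u * (rhs w (t - h + h * u) $ i * h) =
    - (\<Sum>j<q. gamma_coeff q j * (leg j u * w (t - h + h * u) $ i))
        + h * (leg q u * rhs w (t - h + h * u) $ i)" for u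
    by (simp add: legd_expansion sum_distrib_left sum_distrib_right mult_ac)
  ultimately have "w t $ i + (-1) ^ (q + 1) * w (t - h) $ i =
      - (\<Sum>j<q. gamma_coeff q j * (moment j w t $ i / h)) + h * (moment q (rhs w) t $ i / h)"
    using has_integral_unique by (metis (no_types, lifting) ext)
  \<comment> \<open>The sum may be extended up to \<open>N\<close>: \<open>gamma_coeff q j\<close>
    vanishes for \<open>j = q\<close> by parity and for \<open>j > q\<close> by definition.\<close>
  moreover have "(\<Sum>j<q. gamma_coeff q j * (moment j w t $ i / h)) =
      (\<Sum>j<N. gamma_coeff q j * (moment j w t $ i / h))"
  proof (rule sum.mono_neutral_left)
    show "\<forall>j\<in>{..<N} - {..<q}. gamma_coeff q j * (moment j w t $ i / h) = 0"
      by (auto simp: gamma_coeff_def simp flip: mult_2)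
  qed (use q in auto)
  ultimately show ?thesis using h by simp
qed

text \<open>\<open>legendre_bessel\<close> on the rescaled window. The coefficients on
  \<open>[0, 1]\<close> are the moments divided by \<open>h\<close>, and the substitution divides
  the integral by \<open>h\<close>; clearing both leaves the single factor \<open>h\<close>.\<close>

lemma moment_bessel:
  assumes R: "R \<in> carrier_mat n n" and nonneg: "\<And>v. v \<in> carrier_vec n \<Longrightarrow> v \<bullet> (R *\<^sub>v v) \<ge> 0"
    and f: "vec_continuous_on n {0..} f" and t: "t > h"
    and G: "\<And>s. s > 0 \<Longrightarrow> (G has_real_derivative f s \<bullet> (R *\<^sub>v f s)) (at s)"
  shows "(\<Sum>q<M. (2 * real q + 1) * (moment q f t \<bullet> (R *\<^sub>v moment q f t))) \<le> h * (G t - G (t - h))"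
proof -
  define c where "c q = (1 / h) \<cdot>\<^sub>v moment q f t" for q
  have "((\<lambda>u. G (t - h + h * u) / h) has_real_derivative
      f (t - h + h * u) \<bullet> (R *\<^sub>v f (t - h + h * u))) (at u within {0..1})" if "u \<in> {0..1}" for u
  proof -
    have "t - h + h * u > 0" using t that h by (simp add: add_pos_nonneg)
    note D = G[OF this]
    have "((\<lambda>u. t - h + h * u) has_real_derivative h) (at u within {0..1})"
      by (auto intro!: derivative_eq_intros)
    from DERIV_cdivide[OF DERIV_chain2[OF D this], of h] show ?thesis using h by simp
  qed
  then have "((\<lambda>u. f (t - h + h * u) \<bullet> (R *\<^sub>v f (t - h + h * u))) has_integral
      G (t - h + h * 1) / h - G (t - h + h * 0) / h) {0..1}"
    by (intro fundamental_theorem_of_calculus) (auto simp: has_real_derivative_iff_has_vector_derivative)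
  then have I: "((\<lambda>u. f (t - h + h * u) \<bullet> (R *\<^sub>v f (t - h + h * u))) has_integral
      (G t - G (t - h)) / h) {0..1}" by (simp add: diff_divide_distrib)
  have "(\<Sum>q<M. (2 * real q + 1) * (c q \<bullet> (R *\<^sub>v c q))) \<le> (G t - G (t - h)) / h"
  proof (rule legendre_bessel[OF R nonneg _ _ _ I])
    show "vec_continuous_on n {0..1} (\<lambda>u. f (t - h + h * u))" using window_continuous[OF f] t by simp
    show "c q \<in> carrier_vec n" for q by (simp add: c_def)
    show "((\<lambda>u. leg q u * f (t - h + h * u) $ i) has_integral c q $ i) {0..1}" if "i < n" for q i
    proof -
      have "c q $ i = moment q f t $ i / h" using that by (simp add: c_def moment_def)
      then show ?thesis using moment_has_integral[OF f _ that, of t q] t by simp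
    qed
  qed
  moreover have "c q \<bullet> (R *\<^sub>v c q) = (moment q f t \<bullet> (R *\<^sub>v moment q f t)) / h\<^sup>2" for q
  proof -
    have "R *\<^sub>v c q = (1 / h) \<cdot>\<^sub>v (R *\<^sub>v moment q f t)"
      unfolding c_def using R by (intro mult_mat_vec) auto
    moreover have "R *\<^sub>v moment q f t \<in> carrier_vec n" using R by auto
    ultimately show ?thesis
      unfolding c_def by (simp add: power2_eq_square smult_scalar_prod_distrib[of _ n] scalar_prod_smult_distrib[of _ n])
  qed
  ultimately have "(\<Sum>q<M. (2 * real q + 1) * (moment q f t \<bullet> (R *\<^sub>v moment q f t))) / h\<^sup>2
      \<le> (G t - G (t - h)) / h"
    by (simp add: sum_divide_distrib)
  then have "(\<Sum>q<M. (2 * real q + 1) * (moment q f t \<bullet> (R *\<^sub>v moment q f t)))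
      \<le> (G t - G (t - h)) / h * h\<^sup>2" using h by (simp add: pos_divide_le_eq)
  also have "\<dots> = h * (G t - G (t - h))" using h by (simp add: power2_eq_square)
  finally show ?thesis .
qed

end

text \<open>Upper bound for the derivative of the functional, with \<open>a\<close>, \<open>b\<close>, \<open>c\<close> in the roles of \<open>x'(t)\<close>, \<open>x(t)\<close>,
  \<open>x(t - h)\<close>, and \<open>z q\<close>, \<open>g q\<close> in those of the Legendre moments of \<open>x\<close> and \<open>x'\<close> on \<open>[t - h, t]\<close>.\<close>

definition dissipation ::
  "nat \<Rightarrow> nat \<Rightarrow> real \<Rightarrow> real mat \<Rightarrow> real mat \<Rightarrow> real mat \<Rightarrow>
   real Matrix.vec \<Rightarrow> real Matrix.vec \<Rightarrow> real Matrix.vec \<Rightarrow>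
   (nat \<Rightarrow> real Matrix.vec) \<Rightarrow> (nat \<Rightarrow> real Matrix.vec) \<Rightarrow> real" where
  "dissipation n N h P S R a b c z g =
     2 * (vcat (b # map z [0..<N]) \<bullet> (P *\<^sub>v vcat (a # map g [0..<N])))
     + b \<bullet> (S *\<^sub>v b) - c \<bullet> (S *\<^sub>v c) + h\<^sup>2 * (a \<bullet> (R *\<^sub>v a))
     - (\<Sum>q<N + 1. (2 * real q + 1) * (g q \<bullet> (R *\<^sub>v g q)))"

text \<open>The right-hand side of \<open>moment_rhs\<close> for free vectors, with
  \<open>z j\<close> in the place of the moments of \<open>w\<close>. It allows the dissipation
  estimate to be stated without any solution.\<close>

definition legendre_moment ::
  "nat \<Rightarrow> nat \<Rightarrow> real \<Rightarrow> real Matrix.vec \<Rightarrow> real Matrix.vec \<Rightarrow> (nat \<Rightarrow> real Matrix.vec) \<Rightarrow> nat \<Rightarrow> real Matrix.vec" where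
  "legendre_moment n N h b c z q = Matrix.vec n (\<lambda>i.
     b $ i + (-1) ^ (q + 1) * c $ i + (\<Sum>j<N. gamma_coeff q j * (z j $ i / h)))"

lemma sq_sum_le:
  assumes "v \<in> carrier_vec n" "w \<in> carrier_vec n"
  shows "(v + w) \<bullet> (v + w) \<le> 2 * (v \<bullet> v) + 2 * (w \<bullet> (w :: real Matrix.vec))"
proof -
  have "(v $ i + w $ i) * (v $ i + w $ i) \<le> 2 * (v $ i * v $ i) + 2 * (w $ i * w $ i)" for i
    using zero_le_square[of "v $ i - w $ i"] by (simp add: algebra_simps)
  then have "(\<Sum>i<n. (v $ i + w $ i) * (v $ i + w $ i)) \<le> (\<Sum>i<n. 2 * (v $ i * v $ i) + 2 * (w $ i * w $ i))"
    by (intro sum_mono)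
  then show ?thesis
    using assms by (simp add: scalar_prod_def atLeast0LessThan sum.distrib sum_distrib_left)
qed

lemma scalar_prod_two_le:
  assumes "v \<in> carrier_vec n" "w \<in> carrier_vec n"
  shows "\<bar>2 * (v \<bullet> w)\<bar> \<le> v \<bullet> v + w \<bullet> (w :: real Matrix.vec)"
proof -
  have "\<bar>2 * (\<Sum>i<n. v $ i * w $ i)\<bar> \<le> (\<Sum>i<n. \<bar>2 * (v $ i * w $ i)\<bar>)"
    by (simp add: sum_distrib_left sum_abs)
  also have "\<dots> \<le> (\<Sum>i<n. v $ i * v $ i + w $ i * w $ i)"
  proof (rule sum_mono)
    fix i
    show "\<bar>2 * (v $ i * w $ i)\<bar> \<le> v $ i * v $ i + w $ i * w $ i"
      using zero_le_square[of "v $ i - w $ i"] zero_le_square[of "v $ i + w $ i"]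
      by (intro abs_leI) (simp_all add: algebra_simps)
  qed
  finally show ?thesis
    using assms by (simp add: scalar_prod_def atLeast0LessThan sum.distrib)
qed

section \<open>The functional along solutions of a dissipative system\<close>

text \<open>\<open>dissipative\<close> is the interface between algebra and analysis: it speaks of
  arbitrary vectors, with \<open>x'\<close> and its moments already eliminated. A decay term in
  \<open>b\<close> alone suffices, since attractivity will follow from the integrability of
  \<open>w t \<bullet> w t\<close>.\<close>

locale lyapunov_krasovskii = delay_system +
  fixes N :: nat and P S R :: "real mat" and \<delta> :: real
  assumes P: "pos_def ((N + 1) * n) P" and S: "pos_def n S" and R: "pos_def n R" and \<delta>: "\<delta> > 0"
    and dissipative: "\<And>b c z. b \<in> carrier_vec n \<Longrightarrow> c \<in> carrier_vec n \<Longrightarrow> (\<And>q. z q \<in> carrier_vec n) \<Longrightarrow>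
      dissipation n N h P S R (A0 *\<^sub>v b + A1 *\<^sub>v c) b c z (legendre_moment n N h b c z) \<le> - \<delta> * (b \<bullet> b)"
begin

lemma SR_carrier: "S \<in> carrier_mat n n" "R \<in> carrier_mat n n" "sym_mat n S" "sym_mat n R"
  and P_carrier: "P \<in> carrier_mat ((N + 1) * n) ((N + 1) * n)" "sym_mat ((N + 1) * n) P"
  using P S R by (auto simp: pos_def_def sym_mat_def)

lemma pos_def_nonneg:
  assumes "pos_def m M" "v \<in> carrier_vec m"
  shows "v \<bullet> (M *\<^sub>v v) \<ge> 0"
  using pos_def_coercive[OF assms(1)] scalar_prod_self_nonneg assms(2)
  by (metis less_eq_real_def mult_nonneg_nonneg order.trans)

definition state :: "(real \<Rightarrow> real Matrix.vec) \<Rightarrow> real \<Rightarrow> real Matrix.vec" where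
  "state w t = vcat (w t # map (\<lambda>q. moment q w t) [0..<N])"

lemma state_deriv:
  assumes w: "sol w" and t: "t > h"
  shows "vec_deriv ((N + 1) * n) (state w) (vcat (rhs w t # map (\<lambda>q. moment q (rhs w) t) [0..<N])) t"
proof -
  have "vec_deriv n w (rhs w t) t" using w t h by (simp add: sol_def)
  from vec_deriv_append[OF this vec_deriv_vcat[of "[0..<N]" n "\<lambda>q. moment q w" "\<lambda>q. moment q (rhs w) t"]]
  show ?thesis using moment_deriv[OF w t] by (simp add: state_def[abs_def])
qed

lemma dissipation_along_sol:
  assumes w: "sol w" and t: "t > h"
  shows "dissipation n N h P S R (rhs w t) (w t) (w (t - h)) (\<lambda>q. moment q w t) (\<lambda>q. moment q (rhs w) t)
    \<le> - \<delta> * (w t \<bullet> w t)"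
proof -
  have "moment q (rhs w) t = legendre_moment n N h (w t) (w (t - h)) (\<lambda>q. moment q w t) q" if "q \<le> N" for q
  proof (rule eq_vecI)
    fix i assume "i < dim_vec (legendre_moment n N h (w t) (w (t - h)) (\<lambda>q. moment q w t) q)"
    then have "i < n" by (simp add: legendre_moment_def)
    then show "moment q (rhs w) t $ i = legendre_moment n N h (w t) (w (t - h)) (\<lambda>q. moment q w t) q $ i"
      using moment_rhs[OF w t _ that, of i] by (simp add: legendre_moment_def)
  qed (simp add: legendre_moment_def moment_def)
  then have "dissipation n N h P S R (rhs w t) (w t) (w (t - h)) (\<lambda>q. moment q w t) (\<lambda>q. moment q (rhs w) t)
    = dissipation n N h P S R (rhs w t) (w t) (w (t - h)) (\<lambda>q. moment q w t)
      (legendre_moment n N h (w t) (w (t - h)) (\<lambda>q. moment q w t))"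
    \<comment> \<open>\<open>dissipation\<close> reads its last argument only at indices up to
      \<open>N\<close>, where the two families of moments agree.\<close>
    unfolding dissipation_def
    by (intro arg_cong2[where f = "(-)"] arg_cong2[where f = "(+)"] refl sum.cong
        arg_cong[where f = "\<lambda>v. 2 * (_ \<bullet> (_ *\<^sub>v vcat (_ # v)))"] map_cong) auto
  then show ?thesis
    using dissipative[of "w t" "w (t - h)" "\<lambda>q. moment q w t"] sol_carrier[OF w] by (simp add: rhs_def)
qed

lemma rhs_bound:
  obtains c where "c > 0"
    "\<And>w t D. sol w \<Longrightarrow> w t \<bullet> w t \<le> D \<Longrightarrow> w (t - h) \<bullet> w (t - h) \<le> D \<Longrightarrow> rhs w t \<bullet> rhs w t \<le> c * D"
proof -
  obtain c0 where c0: "c0 > 0" "\<And>v. v \<in> carrier_vec n \<Longrightarrow> (A0 *\<^sub>v v) \<bullet> (A0 *\<^sub>v v) \<le> c0 * (v \<bullet> v)"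
    using mult_mat_vec_bound[OF A0] by auto
  obtain c1 where c1: "c1 > 0" "\<And>v. v \<in> carrier_vec n \<Longrightarrow> (A1 *\<^sub>v v) \<bullet> (A1 *\<^sub>v v) \<le> c1 * (v \<bullet> v)"
    using mult_mat_vec_bound[OF A1] by auto
  show thesis
  proof
    show "2 * c0 + 2 * c1 > 0" using c0 c1 by simp
    fix w t D assume w: "sol w" and D: "w t \<bullet> w t \<le> D" "w (t - h) \<bullet> w (t - h) \<le> D"
    have "rhs w t \<bullet> rhs w t \<le> 2 * ((A0 *\<^sub>v w t) \<bullet> (A0 *\<^sub>v w t)) + 2 * ((A1 *\<^sub>v w (t - h)) \<bullet> (A1 *\<^sub>v w (t - h)))"
      unfolding rhs_def using A0 A1 sol_carrier[OF w] by (intro sq_sum_le[of _ n]) auto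
    also have "\<dots> \<le> 2 * (c0 * D) + 2 * (c1 * D)"
    proof -
      have "(A0 *\<^sub>v w t) \<bullet> (A0 *\<^sub>v w t) \<le> c0 * D"
        using c0(2)[OF sol_carrier[OF w, of t]] mult_left_mono[OF D(1), of c0] c0(1) by linarith
      moreover have "(A1 *\<^sub>v w (t - h)) \<bullet> (A1 *\<^sub>v w (t - h)) \<le> c1 * D"
        using c1(2)[OF sol_carrier[OF w, of "t - h"]] mult_left_mono[OF D(2), of c1] c1(1) by linarith
      ultimately show ?thesis by linarith
    qed
    finally show "rhs w t \<bullet> rhs w t \<le> (2 * c0 + 2 * c1) * D" by (simp add: algebra_simps)
  qed
qed

text \<open>The three parts of \<open>V\<close> produce the terms of \<open>dissipation\<close>: the
  form of \<open>P\<close> at the state gives the \<open>P\<close> term, the integral of the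
  \<open>S\<close> form the two \<open>S\<close> terms, and the double integral gives
  \<open>h\<^sup>2\<close> times the \<open>R\<close> form of \<open>w'\<close> minus
  \<open>h\<close> times its integral over the window. \<open>moment_bessel\<close> bounds that
  integral below by the sum over the moments. The lower bound on \<open>V\<close> comes from
  \<open>P\<close>, because \<open>w t\<close> is the first block of the state.\<close>

lemma lyapunov_functional:
  obtains l C where "l > 0" "C > 0"
    "\<And>w. sol w \<Longrightarrow> \<exists>V. (\<forall>t>h. \<exists>V'. (V has_real_derivative V') (at t) \<and> V' \<le> - \<delta> * (w t \<bullet> w t)) \<and>
       (\<forall>t>h. l * (w t \<bullet> w t) \<le> V t) \<and>
       (\<forall>t>h. \<forall>D. (\<forall>s\<in>{-h..t}. w s \<bullet> w s \<le> D) \<longrightarrow> V t \<le> C * D)"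
proof -
  obtain l where l: "l > 0" "\<And>v. v \<in> carrier_vec ((N + 1) * n) \<Longrightarrow> l * (v \<bullet> v) \<le> v \<bullet> (P *\<^sub>v v)"
    using pos_def_coercive[OF P] by auto
  obtain cP where cP: "cP > 0" "\<And>v. v \<in> carrier_vec ((N + 1) * n) \<Longrightarrow> v \<bullet> (P *\<^sub>v v) \<le> cP * (v \<bullet> v)"
    using quad_form_le[OF P_carrier(1)] by auto
  obtain cS where cS: "cS > 0" "\<And>v. v \<in> carrier_vec n \<Longrightarrow> v \<bullet> (S *\<^sub>v v) \<le> cS * (v \<bullet> v)"
    using quad_form_le[OF SR_carrier(1)] by auto
  obtain cR where cR: "cR > 0" "\<And>v. v \<in> carrier_vec n \<Longrightarrow> v \<bullet> (R *\<^sub>v v) \<le> cR * (v \<bullet> v)"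
    using quad_form_le[OF SR_carrier(2)] by auto
  obtain cy where cy: "cy > 0"
    "\<And>w t D. sol w \<Longrightarrow> w t \<bullet> w t \<le> D \<Longrightarrow> w (t - h) \<bullet> w (t - h) \<le> D \<Longrightarrow> rhs w t \<bullet> rhs w t \<le> cy * D"
    using rhs_bound by blast
  \<comment> \<open>One summand for each part of \<open>V\<close>: \<open>1 + h\<^sup>2\<close>
    bounds the squared state, \<open>h\<close> is the length of the window, and the double integral
    contributes \<open>h\<^sup>2\<close> on top of its outer factor \<open>h\<close>.\<close>
  define C where "C = cP * (1 + h\<^sup>2) + h * cS + h * (h * (h * (cR * cy)))"
  have C: "C > 0" unfolding C_def using cP cS cR cy h by (simp add: add_pos_pos)
  show thesis
  proof (rule that[OF l(1) C])
    fix w assume w: "sol w"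
    note car = sol_carrier[OF w]
    have wc: "vec_continuous_on n {0..} w"
      using vec_continuous_on_subset[OF sol_continuous[OF w]] h by auto
    have yc: "vec_continuous_on n {0..} (rhs w)" by (rule rhs_continuous[OF w])
    obtain Q where Q: "\<And>t. t > 0 \<Longrightarrow> (Q has_real_derivative w t \<bullet> (S *\<^sub>v w t)) (at t)"
      using antiderivative_exists[OF continuous_on_quad_form[OF SR_carrier(1) wc]] by metis
    obtain G where G: "continuous_on {0..} G" "\<And>t. t > 0 \<Longrightarrow> (G has_real_derivative rhs w t \<bullet> (R *\<^sub>v rhs w t)) (at t)"
      using antiderivative_exists[OF continuous_on_quad_form[OF SR_carrier(2) yc]] by metis
    obtain GG where GG: "\<And>t. t > 0 \<Longrightarrow> (GG has_real_derivative G t) (at t)"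
      using antiderivative_exists[OF G(1)] by metis
    define V1 where "V1 t = state w t \<bullet> (P *\<^sub>v state w t)" for t
    define V2 where "V2 t = Q t - Q (t - h)" for t
    \<comment> \<open>\<open>V3\<close> is \<open>h\<close> times the double integral \<open>\<integral>\<^sub>-\<^sub>h\<^sup>0 \<integral>\<^sub>t\<^sub>+\<^sub>\<theta>\<^sup>t x'(s)\<^sup>T R x'(s) ds d\<theta>\<close>, written with antiderivatives.\<close>
    define V3 where "V3 t = h * (h * G t - (GG t - GG (t - h)))" for t
    have shift: "((\<lambda>s. f (s - h)) has_real_derivative d) (at t)"
      if "(f has_real_derivative d) (at (t - h))" for f :: "real \<Rightarrow> real" and d t
    proof -
      have "((\<lambda>s. s - h) has_real_derivative 1) (at t)" by (auto intro!: derivative_eq_intros)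
      with DERIV_chain2[where g = "\<lambda>s. s - h" and f = f and x = t] that show ?thesis by fastforce
    qed
    have deriv: "\<exists>V'. ((\<lambda>t. V1 t + V2 t + V3 t) has_real_derivative V') (at t) \<and> V' \<le> - \<delta> * (w t \<bullet> w t)"
      if t: "t > h" for t
    proof -
      have t0: "t > 0" "t - h > 0" using t h by auto
      let ?d1 = "2 * (state w t \<bullet> (P *\<^sub>v vcat (rhs w t # map (\<lambda>q. moment q (rhs w) t) [0..<N])))"
      let ?d2 = "w t \<bullet> (S *\<^sub>v w t) - w (t - h) \<bullet> (S *\<^sub>v w (t - h))"
      let ?d3 = "h * (h * (rhs w t \<bullet> (R *\<^sub>v rhs w t)) - (G t - G (t - h)))"
      have "(V1 has_real_derivative ?d1) (at t)"
        unfolding V1_def by (rule has_derivative_quad_form[OF P_carrier(2) state_deriv[OF w t]])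
      moreover have "(V2 has_real_derivative ?d2) (at t)"
        unfolding V2_def by (intro DERIV_diff Q shift t0)
      moreover have "(V3 has_real_derivative ?d3) (at t)"
        unfolding V3_def by (intro DERIV_cmult DERIV_diff G GG shift t0)
      ultimately have "((\<lambda>t. V1 t + V2 t + V3 t) has_real_derivative ?d1 + ?d2 + ?d3) (at t)"
        by (intro DERIV_add)
      moreover have "?d1 + ?d2 + ?d3 \<le> - \<delta> * (w t \<bullet> w t)"
      proof -
        have "(\<Sum>q<N + 1. (2 * real q + 1) * (moment q (rhs w) t \<bullet> (R *\<^sub>v moment q (rhs w) t)))
            \<le> h * (G t - G (t - h))"
          by (rule moment_bessel[OF SR_carrier(2) pos_def_nonneg[OF R] yc t G(2)])
        moreover have "?d3 = h\<^sup>2 * (rhs w t \<bullet> (R *\<^sub>v rhs w t)) - h * (G t - G (t - h))"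
          by (simp add: algebra_simps power2_eq_square)
        ultimately show ?thesis
          using dissipation_along_sol[OF w t] unfolding dissipation_def state_def by linarith
      qed
      ultimately show ?thesis by blast
    qed
    \<comment> \<open>By the mean value theorem the integral terms become single values of the
      \<open>S\<close> and \<open>R\<close> forms; their signs and their upper bounds can then be
      read off.\<close>
    have V2: "\<exists>s\<in>{0..t}. V2 t = h * (w s \<bullet> (S *\<^sub>v w s))" if t: "t > h" for t
    proof -
      obtain s where "t - h < s" "s < t" "Q t - Q (t - h) = (t - (t - h)) * (w s \<bullet> (S *\<^sub>v w s))"
        using MVT2[of "t - h" t Q "\<lambda>s. w s \<bullet> (S *\<^sub>v w s)"] Q t h by auto
      then show ?thesis using t by (intro bexI[of _ s]) (auto simp: V2_def)
    qed
    have V3: "\<exists>s\<in>{0..t}. \<exists>r\<in>{0..h}. V3 t = h * (h * (r * (rhs w s \<bullet> (R *\<^sub>v rhs w s))))" if t: "t > h" for t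
    proof -
      obtain z where z: "t - h < z" "z < t" "GG t - GG (t - h) = (t - (t - h)) * G z"
        using MVT2[of "t - h" t GG G] GG t h by auto
      obtain s where s: "z < s" "s < t" "G t - G z = (t - z) * (rhs w s \<bullet> (R *\<^sub>v rhs w s))"
        using MVT2[of z t G "\<lambda>s. rhs w s \<bullet> (R *\<^sub>v rhs w s)"] G z t h by auto
      \<comment> \<open>The average of \<open>G\<close> over the window is its value at some
        \<open>z\<close>, so a second mean value, now for \<open>G\<close> on \<open>[z, t]\<close>,
        reaches the \<open>R\<close> form with weight \<open>t - z\<close> at most
        \<open>h\<close>.\<close>
      have "V3 t = h * (h * (G t - G z))" unfolding V3_def z(3) by (simp add: algebra_simps)
      with s z t show ?thesis by (intro bexI[of _ s] bexI[of _ "t - z"]) auto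
    qed
    have state_sq: "state w t \<in> carrier_vec ((N + 1) * n)"
      "state w t \<bullet> state w t = w t \<bullet> w t + (\<Sum>q<N. moment q w t \<bullet> moment q w t)" for t
    proof -
      have *: "vcat (map (\<lambda>q. moment q w t) [0..<N]) \<in> carrier_vec (length [0..<N] * n)"
        "vcat (map (\<lambda>q. moment q w t) [0..<N]) \<bullet> vcat (map (\<lambda>q. moment q w t) [0..<N])
          = (\<Sum>q\<leftarrow>[0..<N]. moment q w t \<bullet> moment q w t)"
        by (rule scalar_prod_vcat_self[where n = n], rule moment_carrier)+
      show "state w t \<in> carrier_vec ((N + 1) * n)" using *(1) car[of t] by (auto simp: state_def)
      show "state w t \<bullet> state w t = w t \<bullet> w t + (\<Sum>q<N. moment q w t \<bullet> moment q w t)"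
        unfolding state_def vcat_Cons scalar_prod_append[OF car *(1) car *(1)] *(2)
        by (simp add: interv_sum_list_conv_sum_set_nat atLeast0LessThan)
    qed
    have low: "l * (w t \<bullet> w t) \<le> V1 t + V2 t + V3 t" if t: "t > h" for t
    proof -
      have "l * (w t \<bullet> w t) \<le> l * (state w t \<bullet> state w t)"
        unfolding state_sq(2) using l(1) by (intro mult_left_mono) (auto intro!: sum_nonneg scalar_prod_self_nonneg)
      also have "\<dots> \<le> V1 t" unfolding V1_def by (rule l(2)[OF state_sq(1)])
      finally have "l * (w t \<bullet> w t) \<le> V1 t" .
      moreover have "V2 t \<ge> 0" using V2[OF t] pos_def_nonneg[OF S car] h by auto
      moreover have "V3 t \<ge> 0" using V3[OF t] pos_def_nonneg[OF R rhs_carrier[OF w]] h by auto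
      ultimately show ?thesis by linarith
    qed
    have up: "V1 t + V2 t + V3 t \<le> C * D" if t: "t > h" and D: "\<forall>s\<in>{-h..t}. w s \<bullet> w s \<le> D" for t D
    proof -
      have D0: "D \<ge> 0" using D[rule_format, of t] t h scalar_prod_self_nonneg[of "w t"] by auto
      have "(\<Sum>q<N. moment q w t \<bullet> moment q w t) \<le> h\<^sup>2 * D"
      proof -
        obtain W where W: "\<And>t. t > 0 \<Longrightarrow> (W has_real_derivative w t \<bullet> (1\<^sub>m n *\<^sub>v w t)) (at t)"
          using antiderivative_exists[OF continuous_on_quad_form[OF one_carrier_mat wc]] by metis
        have "(\<Sum>q<N. moment q w t \<bullet> moment q w t)
          \<le> (\<Sum>q<N. (2 * real q + 1) * (moment q w t \<bullet> (1\<^sub>m n *\<^sub>v moment q w t)))"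
        proof (rule sum_mono)
          fix q
          have "0 \<le> (2 * real q) * (moment q w t \<bullet> moment q w t)" using scalar_prod_self_nonneg by simp
          then show "moment q w t \<bullet> moment q w t \<le> (2 * real q + 1) * (moment q w t \<bullet> (1\<^sub>m n *\<^sub>v moment q w t))"
            by (simp add: distrib_right one_mult_mat_vec[of _ n])
        qed
        also have "\<dots> \<le> h * (W t - W (t - h))"
          by (rule moment_bessel[OF one_carrier_mat _ wc t W]) (auto simp: scalar_prod_self_nonneg)
        also obtain s where s: "t - h < s" "s < t" "W t - W (t - h) = (t - (t - h)) * (w s \<bullet> (1\<^sub>m n *\<^sub>v w s))"
          using MVT2[of "t - h" t W "\<lambda>s. w s \<bullet> (1\<^sub>m n *\<^sub>v w s)"] W t h by auto
        have "W t - W (t - h) \<le> h * D"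
          using s D[rule_format, of s] t h car[of s] by auto
        then have "h * (W t - W (t - h)) \<le> h\<^sup>2 * D" using h by (simp add: power2_eq_square)
        finally show ?thesis .
      qed
      then have "state w t \<bullet> state w t \<le> (1 + h\<^sup>2) * D"
        unfolding state_sq(2) using D[rule_format, of t] t h by (simp add: distrib_right)
      then have 1: "V1 t \<le> cP * ((1 + h\<^sup>2) * D)"
        unfolding V1_def using cP(2)[OF state_sq(1)[of t]] cP(1) by (meson order.trans mult_left_mono less_imp_le)
      have 2: "V2 t \<le> h * (cS * D)"
      proof -
        obtain s where s: "s \<in> {0..t}" "V2 t = h * (w s \<bullet> (S *\<^sub>v w s))" using V2[OF t] by auto
        have "w s \<bullet> (S *\<^sub>v w s) \<le> cS * (w s \<bullet> w s)" by (rule cS(2)[OF car])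
        also have "\<dots> \<le> cS * D" using D[rule_format, of s] s h cS(1) by simp
        finally show ?thesis using s(2) h by simp
      qed
      have 3: "V3 t \<le> h * (h * (h * (cR * (cy * D))))"
      proof -
        obtain s r where s: "s \<in> {0..t}" "r \<in> {0..h}" "V3 t = h * (h * (r * (rhs w s \<bullet> (R *\<^sub>v rhs w s))))"
          using V3[OF t] by auto
        have "rhs w s \<bullet> (R *\<^sub>v rhs w s) \<le> cR * (rhs w s \<bullet> rhs w s)" by (rule cR(2)[OF rhs_carrier[OF w]])
        also have "\<dots> \<le> cR * (cy * D)"
          using cy(2)[OF w, of s D] D[rule_format, of s] D[rule_format, of "s - h"] s h cR(1) by simp
        finally have "r * (rhs w s \<bullet> (R *\<^sub>v rhs w s)) \<le> h * (cR * (cy * D))"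
          using s(2) pos_def_nonneg[OF R rhs_carrier[OF w]] h by (intro mult_mono) auto
        then show ?thesis unfolding s(3) using h by simp
      qed
      have "C * D = cP * ((1 + h\<^sup>2) * D) + h * (cS * D) + h * (h * (h * (cR * (cy * D))))"
        unfolding C_def by (simp add: algebra_simps)
      with 1 2 3 show ?thesis by linarith
    qed
    show "\<exists>V. (\<forall>t>h. \<exists>V'. (V has_real_derivative V') (at t) \<and> V' \<le> - \<delta> * (w t \<bullet> w t)) \<and>
       (\<forall>t>h. l * (w t \<bullet> w t) \<le> V t) \<and>
       (\<forall>t>h. \<forall>D. (\<forall>s\<in>{-h..t}. w s \<bullet> w s \<le> D) \<longrightarrow> V t \<le> C * D)"
      using deriv low up by (intro exI[of _ "\<lambda>t. V1 t + V2 t + V3 t"]) blast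
  qed
qed

end

section \<open>Boundedness and attractivity of solutions\<close>

context lyapunov_krasovskii
begin

lemma norm_sq_deriv:
  assumes w: "sol w" and t: "t > 0"
  shows "((\<lambda>t. w t \<bullet> w t) has_real_derivative 2 * (w t \<bullet> rhs w t)) (at t)"
proof -
  have "sym_mat n (1\<^sub>m n)" by (simp add: sym_mat_def)
  moreover have "vec_deriv n w (rhs w t) t" using w t by (simp add: sol_def)
  ultimately have "((\<lambda>t. w t \<bullet> (1\<^sub>m n *\<^sub>v w t)) has_real_derivative 2 * (w t \<bullet> (1\<^sub>m n *\<^sub>v rhs w t))) (at t)"
    by (rule has_derivative_quad_form)
  then show ?thesis using sol_carrier[OF w] rhs_carrier[OF w] by simp
qed

lemma norm_sq_continuous:
  assumes w: "sol w"
  shows "continuous_on {-h..} (\<lambda>t. w t \<bullet> w t)"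
  using continuous_on_quad_form[OF one_carrier_mat sol_continuous[OF w]] sol_carrier[OF w] by simp

text \<open>A Gronwall estimate over one delay. There \<open>w (s - h)\<close> is still governed by
  the old bound \<open>D\<close>, so the squared norm \<open>u\<close> satisfies
  \<open>u' \<le> (1 + k) (u + D)\<close>, where \<open>k\<close> comes from
  \<open>rhs_bound\<close> and the 1 from splitting
  \<open>2 * (w s \<bullet> rhs w s)\<close>.\<close>

lemma growth_one_delay:
  obtains c where "c \<ge> 1"
    "\<And>w \<tau> D. sol w \<Longrightarrow> \<tau> \<ge> 0 \<Longrightarrow> (\<And>t. t \<in> {-h..\<tau>} \<Longrightarrow> w t \<bullet> w t \<le> D) \<Longrightarrow>
      (\<And>t. t \<in> {-h..\<tau> + h} \<Longrightarrow> w t \<bullet> w t \<le> c * D)"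
proof -
  obtain k where k: "k > 0"
    "\<And>w t D. sol w \<Longrightarrow> w t \<bullet> w t \<le> D \<Longrightarrow> w (t - h) \<bullet> w (t - h) \<le> D \<Longrightarrow> rhs w t \<bullet> rhs w t \<le> k * D"
    using rhs_bound by blast
  define c where "c = 2 * exp ((1 + k) * h)"
  have "exp ((1 + k) * h) \<ge> 1" using k h by simp
  then have c: "c \<ge> 1" unfolding c_def by linarith
  show thesis
  proof (rule that[OF c])
    fix w \<tau> D t assume w: "sol w" and \<tau>: "\<tau> \<ge> 0" and D: "\<And>t. t \<in> {-h..\<tau>} \<Longrightarrow> w t \<bullet> w t \<le> D"
      and t: "t \<in> {-h..\<tau> + h}"
    have D0: "D \<ge> 0" using D[of \<tau>] \<tau> h scalar_prod_self_nonneg[of "w \<tau>"] by auto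
    show "w t \<bullet> w t \<le> c * D"
    proof (cases "t \<le> \<tau>")
      case True
      then have "w t \<bullet> w t \<le> 1 * D" using D t by simp
      also have "\<dots> \<le> c * D" using c D0 by (rule mult_right_mono)
      finally show ?thesis .
    next
      case False
      define F where "F s = (w s \<bullet> w s + D) * exp (- (1 + k) * s)" for s
      have "F \<tau> \<ge> F t"
      \<comment> \<open>A derivative is needed only in the open interval: for
        \<open>\<tau> = 0\<close> differentiability at the left end is not known, only
        continuity.\<close>
      proof (rule DERIV_nonpos_imp_decreasing_open[of \<tau> t F])
        show "\<tau> \<le> t" using False by simp
        show "continuous_on {\<tau>..t} F"
          unfolding F_def using \<tau> h
          by (intro continuous_intros continuous_on_subset[OF norm_sq_continuous[OF w]]) auto
        fix s assume s: "\<tau> < s" "s < t"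
        let ?u = "w s \<bullet> w s"
        have sD: "w (s - h) \<bullet> w (s - h) \<le> D" using s t \<tau> by (intro D) auto
        have "rhs w s \<bullet> rhs w s \<le> k * (?u + D)"
          using sD D0 scalar_prod_self_nonneg[of "w s"] by (intro k(2)[OF w]) auto
        moreover have "2 * (w s \<bullet> rhs w s) \<le> ?u + rhs w s \<bullet> rhs w s"
          using scalar_prod_two_le[OF sol_carrier[OF w] rhs_carrier[OF w], of s s] by linarith
        ultimately have "2 * (w s \<bullet> rhs w s) \<le> (1 + k) * (?u + D)"
          using D0 by (simp add: algebra_simps)
        then have "(2 * (w s \<bullet> rhs w s) - (1 + k) * (?u + D)) * exp (- (1 + k) * s) \<le> 0"
          by (intro mult_nonpos_nonneg) auto
        moreover have "(F has_real_derivative (2 * (w s \<bullet> rhs w s) - (1 + k) * (?u + D)) * exp (- (1 + k) * s)) (at s)"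
        proof -
          have "s > 0" using s \<tau> by simp
          show ?thesis unfolding F_def
            by (auto intro!: derivative_eq_intros norm_sq_deriv[OF w \<open>s > 0\<close>] simp: algebra_simps)
        qed
        ultimately show "\<exists>y. DERIV F s :> y \<and> y \<le> 0" by blast
      qed
      then have "(w t \<bullet> w t + D) * exp (- (1 + k) * t) \<le> (D + D) * exp (- (1 + k) * \<tau>)"
        using D[of \<tau>] \<tau> h by (intro order.trans[OF \<open>F t \<le> F \<tau>\<close>[unfolded F_def] mult_right_mono]) auto
      then have "(w t \<bullet> w t + D) * exp (- (1 + k) * t) * exp ((1 + k) * t) \<le> (D + D) * exp (- (1 + k) * \<tau>) * exp ((1 + k) * t)"
        by (rule mult_right_mono) simp
      then have "w t \<bullet> w t + D \<le> (D + D) * exp ((1 + k) * (t - \<tau>))"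
        by (simp add: mult.assoc algebra_simps flip: exp_add)
      also have "\<dots> \<le> (D + D) * exp ((1 + k) * h)"
        using t k D0 by (intro mult_left_mono) auto
      also have "\<dots> = c * D" by (simp add: c_def)
      finally show ?thesis using D0 by linarith
    qed
  qed
qed

text \<open>Two growth steps give \<open>c * c * D\<close> up to time \<open>2 * h\<close>.
  Afterwards \<open>l * (w t \<bullet> w t) \<le> V t \<le> V (2 * h) \<le> K * c * c * D\<close>.
  The two summands of \<open>C\<close> serve these two ranges.\<close>

lemma sol_bounded:
  obtains C where "C > 0"
    "\<And>w D t. sol w \<Longrightarrow> (\<And>s. s \<in> {-h..0} \<Longrightarrow> w s \<bullet> w s \<le> D) \<Longrightarrow> t \<ge> - h \<Longrightarrow> w t \<bullet> w t \<le> C * D"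
proof -
  obtain c where c: "c \<ge> 1"
    "\<And>w \<tau> D t. sol w \<Longrightarrow> \<tau> \<ge> 0 \<Longrightarrow> (\<And>t. t \<in> {-h..\<tau>} \<Longrightarrow> w t \<bullet> w t \<le> D) \<Longrightarrow>
      t \<in> {-h..\<tau> + h} \<Longrightarrow> w t \<bullet> w t \<le> c * D"
    using growth_one_delay by metis
  obtain l K where l: "l > 0" and K: "K > 0" and V:
    "\<And>w. sol w \<Longrightarrow> \<exists>V. (\<forall>t>h. \<exists>V'. (V has_real_derivative V') (at t) \<and> V' \<le> - \<delta> * (w t \<bullet> w t)) \<and>
       (\<forall>t>h. l * (w t \<bullet> w t) \<le> V t) \<and>
       (\<forall>t>h. \<forall>D. (\<forall>s\<in>{-h..t}. w s \<bullet> w s \<le> D) \<longrightarrow> V t \<le> K * D)"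
    using lyapunov_functional by metis
  \<comment> \<open>\<open>w\<close> is differentiable only for \<open>t > 0\<close> and \<open>V\<close> only for \<open>t > h\<close>, so the descent starts at \<open>2 h\<close>.\<close>
  define C where "C = c * c + K * (c * c) / l"
  have C: "C > 0" using c(1) l K by (simp add: C_def add_pos_pos)
  show thesis
  proof (rule that[OF C])
    fix w D t assume w: "sol w" and D: "\<And>s. s \<in> {-h..0} \<Longrightarrow> w s \<bullet> w s \<le> D" and t: "t \<ge> - h"
    have D0: "D \<ge> 0" using D[of 0] h scalar_prod_self_nonneg[of "w 0"] by auto
    have 1: "w s \<bullet> w s \<le> c * D" if "s \<in> {-h..h}" for s
      using c(2)[OF w _ D, of 0] that by simp
    have 2: "w s \<bullet> w s \<le> c * (c * D)" if "s \<in> {-h..h + h}" for s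
      using c(2)[OF w _ 1, of h] that h by simp
    have CD: "c * (c * D) \<le> C * D" "K * (c * (c * D)) / l \<le> C * D"
      using c(1) l K D0 by (simp_all add: C_def algebra_simps)
    show "w t \<bullet> w t \<le> C * D"
    proof (cases "t \<le> 2 * h")
      case True
      then show ?thesis using 2[of t] t CD by simp
    next
      case False
      obtain V where V: "\<And>t. t > h \<Longrightarrow> \<exists>V'. (V has_real_derivative V') (at t) \<and> V' \<le> - \<delta> * (w t \<bullet> w t)"
        "\<And>t. t > h \<Longrightarrow> l * (w t \<bullet> w t) \<le> V t"
        "\<And>t D. t > h \<Longrightarrow> (\<forall>s\<in>{-h..t}. w s \<bullet> w s \<le> D) \<Longrightarrow> V t \<le> K * D"
        using V[OF w] by blast
      have "V (2 * h) \<ge> V t"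
      proof (rule DERIV_nonpos_imp_nonincreasing[of "2 * h" t V])
        fix s assume "2 * h \<le> s" "s \<le> t"
        then have "s > h" using h by simp
        from V(1)[OF this] show "\<exists>y. DERIV V s :> y \<and> y \<le> 0"
          using mult_nonneg_nonneg[OF less_imp_le[OF \<delta>] scalar_prod_self_nonneg[of "w s"]] by fastforce
      next
        show "2 * h \<le> t" using False by simp
      qed
      moreover have "V (2 * h) \<le> K * (c * (c * D))" using h 2 by (intro V(3)) auto
      moreover have "l * (w t \<bullet> w t) \<le> V t" using False h by (intro V(2)) auto
      ultimately have "l * (w t \<bullet> w t) \<le> K * (c * (c * D))" by linarith
      then have "w t \<bullet> w t \<le> K * (c * (c * D)) / l" using l by (simp add: pos_le_divide_eq mult.commute)
      with CD show ?thesis by linarith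
    qed
  qed
qed

text \<open>\<open>V\<close> plus \<open>\<delta>\<close> times an antiderivative of the squared
  norm is nonincreasing, and \<open>V\<close> is nonnegative, so that antiderivative stays bounded.
  The squared norm has bounded derivative because the solution is bounded, its initial segment being
  so by compactness; Barbalat's lemma applies.\<close>

lemma sol_tendsto_0:
  assumes w: "sol w"
  shows "((\<lambda>t. w t \<bullet> w t) \<longlongrightarrow> 0) at_top"
proof -
  have "bdd_above ((\<lambda>t. w t \<bullet> w t) ` {-h..0})"
    using norm_sq_continuous[OF w]
    by (intro bounded_imp_bdd_above compact_imp_bounded compact_continuous_image)
      (auto elim: continuous_on_subset)
  then obtain D0 where "\<forall>y\<in>(\<lambda>t. w t \<bullet> w t) ` {-h..0}. y \<le> D0" unfolding bdd_above_def by blast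
  then have D0: "w s \<bullet> w s \<le> D0" if "s \<in> {-h..0}" for s using that by blast
  obtain C where C: "C > 0" "\<And>w D t. sol w \<Longrightarrow> (\<And>s. s \<in> {-h..0} \<Longrightarrow> w s \<bullet> w s \<le> D) \<Longrightarrow> t \<ge> - h \<Longrightarrow> w t \<bullet> w t \<le> C * D"
    using sol_bounded by blast
  define D where "D = C * D0"
  have D: "w t \<bullet> w t \<le> D" if "t \<ge> - h" for t unfolding D_def using C(2)[OF w D0 that] by simp
  obtain k where k: "k > 0"
    "\<And>w t D. sol w \<Longrightarrow> w t \<bullet> w t \<le> D \<Longrightarrow> w (t - h) \<bullet> w (t - h) \<le> D \<Longrightarrow> rhs w t \<bullet> rhs w t \<le> k * D"
    using rhs_bound by blast
  obtain l V where V: "l > 0" "\<And>t. t > h \<Longrightarrow> \<exists>V'. (V has_real_derivative V') (at t) \<and> V' \<le> - \<delta> * (w t \<bullet> w t)"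
    "\<And>t. t > h \<Longrightarrow> l * (w t \<bullet> w t) \<le> V t"
    using lyapunov_functional w by metis
  have "continuous_on {0..} (\<lambda>t. w t \<bullet> w t)"
    using h by (intro continuous_on_subset[OF norm_sq_continuous[OF w]]) auto
  then obtain G where G: "\<And>t. t > 0 \<Longrightarrow> (G has_real_derivative w t \<bullet> w t) (at t)"
    by (rule antiderivative_exists) auto
  show ?thesis
  proof (rule barbalat_square_integrable[where a = "2 * h" and G = G])
    show "(G has_real_derivative w t \<bullet> w t) (at t)" if "t \<ge> 2 * h" for t
      using that h by (intro G) auto
    show "((\<lambda>t. w t \<bullet> w t) has_real_derivative 2 * (w t \<bullet> rhs w t)) (at t)" if "t \<ge> 2 * h" for t
      using that h by (intro norm_sq_deriv[OF w]) auto
    show "0 \<le> w t \<bullet> w t" for t by (rule scalar_prod_self_nonneg)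
    show "\<bar>2 * (w t \<bullet> rhs w t)\<bar> \<le> D + k * D" if "t \<ge> 2 * h" for t
      using scalar_prod_two_le[OF sol_carrier[OF w] rhs_carrier[OF w], of t t]
        k(2)[OF w, of t D] D[of t] D[of "t - h"] that h by auto
    show "G t \<le> G (2 * h) + V (2 * h) / \<delta>" if t: "t \<ge> 2 * h" for t
    proof -
      have "V (2 * h) + \<delta> * G (2 * h) \<ge> V t + \<delta> * G t"
      proof (rule DERIV_nonpos_imp_nonincreasing[of "2 * h" t "\<lambda>s. V s + \<delta> * G s", OF t])
        fix s assume "2 * h \<le> s" "s \<le> t"
        then have s: "s > h" "s > 0" using h by auto
        obtain V' where V': "(V has_real_derivative V') (at s)" "V' \<le> - \<delta> * (w s \<bullet> w s)" using V(2)[OF s(1)] by auto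
        have "((\<lambda>s. V s + \<delta> * G s) has_real_derivative V' + \<delta> * (w s \<bullet> w s)) (at s)"
          by (intro DERIV_add DERIV_cmult V' G s)
        with V'(2) show "\<exists>y. DERIV (\<lambda>s. V s + \<delta> * G s) s :> y \<and> y \<le> 0"
          by (intro exI[of _ "V' + \<delta> * (w s \<bullet> w s)"]) auto
      qed
      moreover have "V t \<ge> 0"
        using V(3)[of t] V(1) scalar_prod_self_nonneg[of "w t"] t h
        by (intro order.trans[OF _ V(3)] mult_nonneg_nonneg) auto
      ultimately have "\<delta> * G t \<le> V (2 * h) + \<delta> * G (2 * h)" by linarith
      then show ?thesis using \<delta> by (simp add: field_simps)
    qed
  qed
qed

end

section \<open>Block matrices acting on concatenated vectors\<close>

lemma append_vec_empty [simp]: "v @\<^sub>v vNil = v"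
  by (intro eq_vecI) auto

lemma vcat_append: "vcat (us @ vs) = vcat us @\<^sub>v vcat vs"
proof (induction us)
  case Nil
  show ?case by (intro eq_vecI) auto
next
  case (Cons u us)
  have "(u @\<^sub>v x) @\<^sub>v y = u @\<^sub>v (x @\<^sub>v y)" for x y
    by (intro eq_vecI) auto
  with Cons show ?case by simp
qed

lemma dim_vcat: "dim_vec (vcat vs) = sum_list (map dim_vec vs)"
  by (induction vs) auto

lemma vcat_carrier:
  assumes "\<And>v. v \<in> set vs \<Longrightarrow> v \<in> carrier_vec n"
  shows "vcat vs \<in> carrier_vec (length vs * n)"
  using assms by (induction vs) (auto simp del: carrier_vec_dim_vec)

lemma smult_vcat: "k \<cdot>\<^sub>v vcat vs = vcat (map (\<lambda>v. k \<cdot>\<^sub>v v) vs)"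
proof (induction vs)
  case (Cons v vs)
  have "k \<cdot>\<^sub>v (v @\<^sub>v x) = k \<cdot>\<^sub>v v @\<^sub>v k \<cdot>\<^sub>v x" for x by (intro eq_vecI) auto
  with Cons show ?case by simp
qed auto

lemma scalar_prod_vcat:
  assumes "list_all2 (\<lambda>u v. dim_vec u = dim_vec v) us vs"
  shows "vcat us \<bullet> vcat vs = (\<Sum>(u, v)\<leftarrow>zip us vs. u \<bullet> v)"
  using assms
proof (induction rule: list_all2_induct)
  case (Cons u us v vs)
  have "dim_vec (vcat us) = dim_vec (vcat vs)"
    using Cons(2) unfolding dim_vcat by (induction rule: list_all2_induct) auto
  then have "vcat (u # us) \<bullet> vcat (v # vs) = u \<bullet> v + vcat us \<bullet> vcat vs"
    unfolding vcat_Cons using Cons(1)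
    by (intro scalar_prod_append[of _ "dim_vec v" _ "dim_vec (vcat vs)"] carrier_vecI) simp_all
  with Cons(3) show ?case by simp
qed simp

lemma block_col_carrier:
  assumes "\<And>M. M \<in> set Ms \<Longrightarrow> dim_col M = nc"
  shows "block_col nc Ms \<in> carrier_mat (sum_list (map dim_row Ms)) nc"
  using assms by (induction Ms) (auto simp: block_col_def)

lemma block_col_mult_vec:
  assumes "\<And>M. M \<in> set Ms \<Longrightarrow> dim_col M = nc" and v: "v \<in> carrier_vec nc"
  shows "block_col nc Ms *\<^sub>v v = vcat (map (\<lambda>M. M *\<^sub>v v) Ms)"
  using assms(1)
proof (induction Ms)
  case Nil
  show ?case by (intro eq_vecI) (auto simp: block_col_def)
next
  case (Cons M Ms)
  have "(M @\<^sub>r block_col nc Ms) *\<^sub>v v = M *\<^sub>v v @\<^sub>v block_col nc Ms *\<^sub>v v"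
    using Cons.prems block_col_carrier[of Ms nc] v by (intro mat_mult_append) auto
  with Cons show ?case by (simp add: block_col_def)
qed

lemma block_col_transpose_carrier:
  assumes "\<And>M. M \<in> set Ms \<Longrightarrow> dim_row M = nr"
  shows "block_col nr (map transpose_mat Ms) \<in> carrier_mat (sum_list (map dim_col Ms)) nr"
  using assms
proof (induction Ms)
  case (Cons M Ms)
  have "transpose_mat M @\<^sub>r block_col nr (map transpose_mat Ms)
      \<in> carrier_mat (dim_col M + sum_list (map dim_col Ms)) nr"
    using Cons by (intro carrier_append_rows) auto
  then show ?case by (simp add: block_col_def)
qed (auto simp: block_col_def)

lemma block_row_carrier:
  assumes "\<And>M. M \<in> set Ms \<Longrightarrow> dim_row M = nr"
  shows "block_row nr Ms \<in> carrier_mat nr (sum_list (map dim_col Ms))"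
  using block_col_transpose_carrier[OF assms] by (simp add: block_row_def)

text \<open>Row \<open>i\<close> of \<open>block_row\<close> is column \<open>i\<close> of the
  stacked transposes, and a scalar product with a stacked vector splits along the blocks. Working
  coordinatewise keeps the sum over the list a sum of reals, with no dimension to track.\<close>

lemma block_row_mult_vec:
  assumes "list_all2 (\<lambda>M v. dim_row M = nr \<and> v \<in> carrier_vec (dim_col M)) Ms vs" and i: "i < nr"
  shows "(block_row nr Ms *\<^sub>v vcat vs) $ i = (\<Sum>(M, v)\<leftarrow>zip Ms vs. (M *\<^sub>v v) $ i)"
  using assms(1)
proof (induction rule: list_all2_induct)
  case Nil
  then show ?case using i by (simp add: block_row_def block_col_def scalar_prod_def)
next
  case (Cons M Ms v vs)
  let ?B = "block_col nr (map transpose_mat Ms)"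
  have Ms: "\<forall>M\<in>set Ms. dim_row M = nr" and dim: "map dim_vec vs = map dim_col Ms"
    using Cons(2) by (induction rule: list_all2_induct) auto
  have B: "?B \<in> carrier_mat (dim_vec (vcat vs)) nr"
    using block_col_transpose_carrier[of Ms nr] Ms by (simp add: dim_vcat dim)
  have MT: "transpose_mat M \<in> carrier_mat (dim_vec v) nr" using Cons(1) by auto
  have bl: "block_row nr (M # Ms) = transpose_mat (transpose_mat M @\<^sub>r ?B)"
    by (simp add: block_row_def block_col_def)
  have "(block_row nr (M # Ms) *\<^sub>v vcat (v # vs)) $ i = col (transpose_mat M @\<^sub>r ?B) i \<bullet> vcat (v # vs)"
    unfolding bl using carrier_append_rows[OF MT B] i by (subst index_mult_mat_vec) auto
  also have "col (transpose_mat M @\<^sub>r ?B) i = col (transpose_mat M) i @\<^sub>v col ?B i"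
    unfolding append_rows_def using MT B i
    by (intro col_four_block_mat(1)[where ?nr1.0 = "dim_vec v" and ?nc1.0 = nr and ?nr2.0 = "dim_vec (vcat vs)" and ?nc2.0 = 0]) auto
  also have "\<dots> \<bullet> vcat (v # vs) = col (transpose_mat M) i \<bullet> v + col ?B i \<bullet> vcat vs"
    unfolding vcat_Cons using MT B i by (intro scalar_prod_append[of _ "dim_vec v" _ "dim_vec (vcat vs)"]) auto
  also have "col (transpose_mat M) i \<bullet> v = (M *\<^sub>v v) $ i" using Cons(1) i by auto
  also have "col ?B i \<bullet> vcat vs = (block_row nr Ms *\<^sub>v vcat vs) $ i"
    unfolding block_row_def using B i by auto
  finally show ?case using Cons(3) by simp
qed

lemma diag_block_mat_mult_vcat:
  assumes "list_all2 (\<lambda>M v. M \<in> carrier_mat (dim_vec v) (dim_vec v)) Ms vs"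
  shows "diag_block_mat Ms *\<^sub>v vcat vs = vcat (map2 (*\<^sub>v) Ms vs)"
    and "diag_block_mat Ms \<in> carrier_mat (dim_vec (vcat vs)) (dim_vec (vcat vs))"
proof -
  have "diag_block_mat Ms *\<^sub>v vcat vs = vcat (map2 (*\<^sub>v) Ms vs) \<and>
     diag_block_mat Ms \<in> carrier_mat (dim_vec (vcat vs)) (dim_vec (vcat vs))"
    using assms
  proof (induction rule: list_all2_induct)
    case Nil
    then show ?case by (auto intro!: eq_vecI)
  next
    case (Cons M Ms v vs)
    let ?B = "diag_block_mat Ms" and ?m = "dim_vec (vcat vs)"
    have B: "?B \<in> carrier_mat ?m ?m" using Cons(3) by auto
    have "diag_block_mat (M # Ms) = four_block_mat M (0\<^sub>m (dim_vec v) ?m) (0\<^sub>m ?m (dim_vec v)) ?B"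
      using Cons(1) B by (auto simp: Let_def)
    moreover have "\<dots> *\<^sub>v vcat (v # vs) = M *\<^sub>v v @\<^sub>v ?B *\<^sub>v vcat vs"
      unfolding vcat_Cons by (rule mult_mat_vec_split[OF Cons(1) B]) simp_all
    moreover have "four_block_mat M (0\<^sub>m (dim_vec v) ?m) (0\<^sub>m ?m (dim_vec v)) ?B \<in> carrier_mat (dim_vec v + ?m) (dim_vec v + ?m)"
      using Cons(1) B by auto
    ultimately show ?case using Cons(3) by simp
  qed
  then show "diag_block_mat Ms *\<^sub>v vcat vs = vcat (map2 (*\<^sub>v) Ms vs)"
    "diag_block_mat Ms \<in> carrier_mat (dim_vec (vcat vs)) (dim_vec (vcat vs))" by auto
qed

text \<open>Moving the transposed factor to the left argument means that only the actions of
  \<open>G_mat\<close>, \<open>H_mat\<close>, \<open>F_mat\<close> and the stacked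
  \<open>Gamma_mat\<close> on one vector have to be computed, never the entries of
  \<open>Phi_mat\<close>.\<close>

lemma quad_form_triple:
  fixes A B P :: "real mat"
  assumes "A \<in> carrier_mat p m" "P \<in> carrier_mat p q" "B \<in> carrier_mat q m" "v \<in> carrier_vec m"
  shows "v \<bullet> ((transpose_mat A * P * B) *\<^sub>v v) = (A *\<^sub>v v) \<bullet> (P *\<^sub>v (B *\<^sub>v v))"
proof -
  let ?y = "P *\<^sub>v (B *\<^sub>v v)"
  have y: "?y \<in> carrier_vec p" using assms by auto
  have "(transpose_mat A * P * B) *\<^sub>v v = (transpose_mat A * P) *\<^sub>v (B *\<^sub>v v)"
    using assms by (intro assoc_mult_mat_vec) auto
  also have "\<dots> = transpose_mat A *\<^sub>v ?y"
    using assms by (intro assoc_mult_mat_vec) auto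
  finally have "v \<bullet> ((transpose_mat A * P * B) *\<^sub>v v) = (transpose_mat A *\<^sub>v ?y) \<bullet> v"
    using assms y by (simp add: comm_scalar_prod[of v m])
  also have "\<dots> = ?y \<bullet> (A *\<^sub>v v)" by (rule transpose_vec_mult_scalar[OF assms(1,4) y])
  also have "\<dots> = (A *\<^sub>v v) \<bullet> ?y" using assms y by (intro comm_scalar_prod[of _ p]) auto
  finally show ?thesis .
qed

lemma quad_form_He:
  assumes M: "M \<in> carrier_mat m m" and v: "v \<in> carrier_vec m"
  shows "v \<bullet> (He M *\<^sub>v v) = 2 * (v \<bullet> (M *\<^sub>v v))"
proof -
  have "He M *\<^sub>v v = M *\<^sub>v v + transpose_mat M *\<^sub>v v"
    unfolding He_def using M v by (intro add_mult_distrib_mat_vec) auto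
  moreover have "v \<bullet> (transpose_mat M *\<^sub>v v) = v \<bullet> (M *\<^sub>v v)"
    using transpose_vec_mult_scalar[OF M v v] M v by (simp add: comm_scalar_prod[of v m])
  ultimately show ?thesis using M v by (simp add: scalar_prod_add_distrib[of _ m])
qed

lemma quad_form_add:
  fixes A B :: "real mat"
  assumes "A \<in> carrier_mat m m" "B \<in> carrier_mat m m" "v \<in> carrier_vec m"
  shows "v \<bullet> ((A + B) *\<^sub>v v) = v \<bullet> (A *\<^sub>v v) + v \<bullet> (B *\<^sub>v v)"
    and "v \<bullet> ((A - B) *\<^sub>v v) = v \<bullet> (A *\<^sub>v v) - v \<bullet> (B *\<^sub>v v)"
    and "v \<bullet> ((k \<cdot>\<^sub>m A) *\<^sub>v v) = k * (v \<bullet> (A *\<^sub>v v))"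
    and "v \<bullet> (- A *\<^sub>v v) = - (v \<bullet> (A *\<^sub>v v))"
proof -
  have c: "A + B \<in> carrier_mat m m" "A - B \<in> carrier_mat m m" "k \<cdot>\<^sub>m A \<in> carrier_mat m m" "- A \<in> carrier_mat m m"
    using assms by auto
  note q = scalar_prod_mult_mat_vec[OF _ assms(3,3)]
  note qs = q[OF assms(1)] q[OF assms(2)] q[OF c(1)] q[OF c(2)] q[OF c(3)] q[OF c(4)]
  show "v \<bullet> ((A + B) *\<^sub>v v) = v \<bullet> (A *\<^sub>v v) + v \<bullet> (B *\<^sub>v v)"
    unfolding qs using assms by (simp add: algebra_simps sum.distrib)
  show "v \<bullet> ((A - B) *\<^sub>v v) = v \<bullet> (A *\<^sub>v v) - v \<bullet> (B *\<^sub>v v)"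
    unfolding qs using assms by (simp add: left_diff_distrib right_diff_distrib sum_subtractf)
  show "v \<bullet> ((k \<cdot>\<^sub>m A) *\<^sub>v v) = k * (v \<bullet> (A *\<^sub>v v))"
    unfolding qs using assms by (simp add: sum_distrib_left mult_ac)
  show "v \<bullet> (- A *\<^sub>v v) = - (v \<bullet> (A *\<^sub>v v))"
    unfolding qs using assms by (simp add: sum_negf)
qed

section \<open>The quadratic form of \<open>\<Phi>\<^sub>N\<close>\<close>

lemma sum_list_upt: "(\<Sum>i\<leftarrow>[0..<N]. f i) = (\<Sum>i<N. f i :: real)"
  by (simp add: interv_sum_list_conv_sum_set_nat atLeast0LessThan)

context
  fixes n N :: nat and a b c :: "real Matrix.vec" and \<omega> :: "nat \<Rightarrow> real Matrix.vec"
  assumes car: "a \<in> carrier_vec n" "b \<in> carrier_vec n" "c \<in> carrier_vec n" "\<And>q. \<omega> q \<in> carrier_vec n"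
begin

abbreviation xi :: "real Matrix.vec" where
  "xi \<equiv> vcat ([a, b, c] @ map \<omega> [0..<N])"

lemma xi_carrier: "xi \<in> carrier_vec ((N + 3) * n)"
proof -
  have "xi \<in> carrier_vec (length ([a, b, c] @ map \<omega> [0..<N]) * n)"
    by (rule vcat_carrier) (use car in auto)
  moreover have "length ([a, b, c] @ map \<omega> [0..<N]) * n = (N + 3) * n" by (simp add: algebra_simps)
  ultimately show ?thesis by metis
qed

text \<open>The matrices \<open>F_mat\<close>, \<open>G_mat\<close>, \<open>S_tilde\<close> and the
  slack row treat the last \<open>N\<close> blocks as one block of width \<open>n * N\<close>, while
  \<open>Gamma_mat\<close> splits them; both readings of \<open>xi\<close> are needed.\<close>

lemma xi_four: "xi = vcat [a, b, c, vcat (map \<omega> [0..<N])]"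
  by (simp add: vcat_append)

lemma tail_carrier: "vcat (map \<omega> [0..<N]) \<in> carrier_vec (n * N)"
proof -
  have "vcat (map \<omega> [0..<N]) \<in> carrier_vec (length (map \<omega> [0..<N]) * n)"
    by (rule vcat_carrier) (use car in auto)
  then show ?thesis by (simp add: mult.commute)
qed

lemma xi_self: "xi \<bullet> xi = a \<bullet> a + b \<bullet> b + c \<bullet> c + (\<Sum>q<N. \<omega> q \<bullet> \<omega> q)"
proof -
  have "xi \<bullet> xi = (\<Sum>(u, v)\<leftarrow>zip ([a, b, c] @ map \<omega> [0..<N]) ([a, b, c] @ map \<omega> [0..<N]). u \<bullet> v)"
    by (rule scalar_prod_vcat) (simp add: list_all2_same)
  then show ?thesis by (simp add: zip_same_conv_map o_def sum_list_upt del: vcat_Cons)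
qed

lemma block_row_four:
  assumes "A1 \<in> carrier_mat m n" "A2 \<in> carrier_mat m n" "A3 \<in> carrier_mat m n" "A4 \<in> carrier_mat m (n * N)"
  shows "block_row m [A1, A2, A3, A4] \<in> carrier_mat m ((N + 3) * n)"
    and "block_row m [A1, A2, A3, A4] *\<^sub>v xi = A1 *\<^sub>v a + A2 *\<^sub>v b + A3 *\<^sub>v c + A4 *\<^sub>v vcat (map \<omega> [0..<N])"
proof -
  have "block_row m [A1, A2, A3, A4] \<in> carrier_mat m (sum_list (map dim_col [A1, A2, A3, A4]))"
  proof (rule block_row_carrier)
    fix M assume "M \<in> set [A1, A2, A3, A4]"
    then show "dim_row M = m" using assms[THEN carrier_matD(1)] by auto
  qed
  moreover have "sum_list (map dim_col [A1, A2, A3, A4]) = (N + 3) * n"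
    using assms[THEN carrier_matD(2)] by (simp add: algebra_simps)
  ultimately show *: "block_row m [A1, A2, A3, A4] \<in> carrier_mat m ((N + 3) * n)" by (simp only:)
  show "block_row m [A1, A2, A3, A4] *\<^sub>v xi = A1 *\<^sub>v a + A2 *\<^sub>v b + A3 *\<^sub>v c + A4 *\<^sub>v vcat (map \<omega> [0..<N])"
  proof (rule eq_vecI)
    fix i assume "i < dim_vec (A1 *\<^sub>v a + A2 *\<^sub>v b + A3 *\<^sub>v c + A4 *\<^sub>v vcat (map \<omega> [0..<N]))"
    then have i: "i < m" using assms by simp
    have "list_all2 (\<lambda>M v. dim_row M = m \<and> v \<in> carrier_vec (dim_col M)) [A1, A2, A3, A4] [a, b, c, vcat (map \<omega> [0..<N])]"
      using assms car tail_carrier by (auto simp del: carrier_vec_dim_vec)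
    from block_row_mult_vec[OF this i]
    show "(block_row m [A1, A2, A3, A4] *\<^sub>v xi) $ i =
        (A1 *\<^sub>v a + A2 *\<^sub>v b + A3 *\<^sub>v c + A4 *\<^sub>v vcat (map \<omega> [0..<N])) $ i"
      unfolding xi_four using assms i by (simp del: index_mult_mat_vec)
  qed (use * assms in simp)
qed

lemma zero_mult_vec [simp]: "0\<^sub>m m n' *\<^sub>v v = (0\<^sub>v m :: real Matrix.vec)" if "v \<in> carrier_vec n'" for v m n'
  using that by (intro eq_vecI) auto

lemma F_mat_xi: "F_mat n N \<in> carrier_mat n ((N + 3) * n)" "F_mat n N *\<^sub>v xi = a"
  using block_row_four[of "1\<^sub>m n" n "0\<^sub>m n n" "0\<^sub>m n n" "0\<^sub>m n (n * N)"] car tail_carrier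
  by (auto simp: F_mat_def zero_mult_vec simp del: vcat_Cons)

lemma Gamma_mat_xi:
  "Gamma_mat n N q \<in> carrier_mat n ((N + 3) * n)"
  "Gamma_mat n N q *\<^sub>v xi = Matrix.vec n (\<lambda>i.
     b $ i + (-1) ^ (q + 1) * c $ i + (\<Sum>j<N. gamma_coeff q j * \<omega> j $ i))"
proof -
  let ?Ms = "[0\<^sub>m n n, 1\<^sub>m n, (-1) ^ (q + 1) \<cdot>\<^sub>m 1\<^sub>m n] @ map (\<lambda>i. gamma_coeff q i \<cdot>\<^sub>m 1\<^sub>m n) [0..<N] :: real mat list"
  have "block_row n ?Ms \<in> carrier_mat n (sum_list (map dim_col ?Ms))"
    by (rule block_row_carrier) auto
  moreover have "sum_list (map dim_col ?Ms) = (N + 3) * n"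
    by (simp add: o_def sum_list_triv algebra_simps)
  ultimately show *: "Gamma_mat n N q \<in> carrier_mat n ((N + 3) * n)" unfolding Gamma_mat_def by (simp only:)
  have sm: "(k \<cdot>\<^sub>m 1\<^sub>m n *\<^sub>v v) $ i = k * v $ i" if "v \<in> carrier_vec n" "i < n" for k :: real and v i
    using that by simp
  have l2: "list_all2 (\<lambda>M v. dim_row M = n \<and> v \<in> carrier_vec (dim_col M)) ?Ms ([a, b, c] @ map \<omega> [0..<N])"
    using car by (intro list_all2_appendI) (auto simp: list_all2_map1 list_all2_map2 list_all2_same)
  show "Gamma_mat n N q *\<^sub>v xi = Matrix.vec n (\<lambda>i.
     b $ i + (-1) ^ (q + 1) * c $ i + (\<Sum>j<N. gamma_coeff q j * \<omega> j $ i))"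
  proof (rule eq_vecI)
    fix i assume "i < dim_vec (Matrix.vec n (\<lambda>i. b $ i + (-1) ^ (q + 1) * c $ i + (\<Sum>j<N. gamma_coeff q j * \<omega> j $ i)))"
    then have i: "i < n" by simp
    show "(Gamma_mat n N q *\<^sub>v xi) $ i = Matrix.vec n (\<lambda>i.
       b $ i + (-1) ^ (q + 1) * c $ i + (\<Sum>j<N. gamma_coeff q j * \<omega> j $ i)) $ i"
      unfolding Gamma_mat_def block_row_mult_vec[OF l2 i]
      using car i sm[OF car(4) i]
      by (simp add: zip_map_map zip_same_conv_map o_def sum_list_upt sm zero_mult_vec del: index_mult_mat_vec)
  qed (use * in simp)
qed

text \<open>The factor \<open>h\<close> undoes the normalisation of the components
  \<open>\<omega> q\<close>: for moments divided by \<open>h\<close>, the image is the stack of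
  \<open>w\<close> and its unscaled moments, that is, the state on which \<open>P\<close>
  acts.\<close>

lemma G_mat_xi:
  "G_mat n N h \<in> carrier_mat ((N + 1) * n) ((N + 3) * n)"
  "G_mat n N h *\<^sub>v xi = vcat (b # map (\<lambda>q. h \<cdot>\<^sub>v \<omega> q) [0..<N])"
proof -
  let ?G1 = "block_row n [0\<^sub>m n n, 1\<^sub>m n, 0\<^sub>m n n, 0\<^sub>m n (n * N)]"
  let ?G2 = "block_row (n * N) [0\<^sub>m (n * N) n, 0\<^sub>m (n * N) n, 0\<^sub>m (n * N) n, h \<cdot>\<^sub>m 1\<^sub>m (n * N)]"
  have 1: "?G1 \<in> carrier_mat n ((N + 3) * n)" "?G1 *\<^sub>v xi = b"
    using block_row_four[of "0\<^sub>m n n" n "1\<^sub>m n" "0\<^sub>m n n" "0\<^sub>m n (n * N)"] car tail_carrier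
    by (auto simp: zero_mult_vec simp del: vcat_Cons)
  have "h \<cdot>\<^sub>m 1\<^sub>m (n * N) *\<^sub>v vcat (map \<omega> [0..<N]) = h \<cdot>\<^sub>v vcat (map \<omega> [0..<N])"
    using tail_carrier by (intro eq_vecI) auto
  then have 2: "?G2 \<in> carrier_mat (n * N) ((N + 3) * n)" "?G2 *\<^sub>v xi = h \<cdot>\<^sub>v vcat (map \<omega> [0..<N])"
    using block_row_four[of "0\<^sub>m (n * N) n" "n * N" "0\<^sub>m (n * N) n" "0\<^sub>m (n * N) n" "h \<cdot>\<^sub>m 1\<^sub>m (n * N)"] car tail_carrier
    by (auto simp: zero_mult_vec simp del: vcat_Cons)
  have "block_col ((N + 3) * n) [?G1, ?G2] \<in> carrier_mat (sum_list (map dim_row [?G1, ?G2])) ((N + 3) * n)"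
    by (rule block_col_carrier) (use 1 2 in auto)
  moreover have "sum_list (map dim_row [?G1, ?G2]) = (N + 1) * n"
    using carrier_matD(1)[OF 1(1)] carrier_matD(1)[OF 2(1)] by (simp add: algebra_simps)
  ultimately show "G_mat n N h \<in> carrier_mat ((N + 1) * n) ((N + 3) * n)" unfolding G_mat_def by (simp only:)
  show "G_mat n N h *\<^sub>v xi = vcat (b # map (\<lambda>q. h \<cdot>\<^sub>v \<omega> q) [0..<N])"
    unfolding G_mat_def using 1 2 by (subst block_col_mult_vec[OF _ xi_carrier]) (auto simp: smult_vcat o_def)
qed

lemma H_mat_xi:
  "H_mat n N \<in> carrier_mat ((N + 1) * n) ((N + 3) * n)"
  "H_mat n N *\<^sub>v xi = vcat (a # map (\<lambda>q. Gamma_mat n N q *\<^sub>v xi) [0..<N])"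
proof -
  have "dim_row (F_mat n N) = n" "dim_col (F_mat n N) = (N + 3) * n" "dim_row (Gamma_mat n N q) = n"
    "dim_col (Gamma_mat n N q) = (N + 3) * n" for q using F_mat_xi(1) Gamma_mat_xi(1)[of q] by auto
  note dims = this
  have "block_col ((N + 3) * n) (F_mat n N # map (Gamma_mat n N) [0..<N])
      \<in> carrier_mat (sum_list (map dim_row (F_mat n N # map (Gamma_mat n N) [0..<N]))) ((N + 3) * n)"
    by (rule block_col_carrier) (use dims in auto)
  moreover have "sum_list (map dim_row (F_mat n N # map (Gamma_mat n N) [0..<N])) = (N + 1) * n"
    using dims by (simp add: o_def sum_list_triv)
  ultimately show "H_mat n N \<in> carrier_mat ((N + 1) * n) ((N + 3) * n)" unfolding H_mat_def by (simp only:)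
  show "H_mat n N *\<^sub>v xi = vcat (a # map (\<lambda>q. Gamma_mat n N q *\<^sub>v xi) [0..<N])"
    unfolding H_mat_def using dims F_mat_xi(2)
    by (subst block_col_mult_vec[OF _ xi_carrier]) (auto simp: o_def simp del: vcat_append)
qed

text \<open>The four summands of \<open>Phi_mat\<close> are evaluated separately and reproduce
  \<open>dissipation\<close> term by term, with \<open>z q\<close> equal to
  \<open>h \<cdot>\<^sub>v \<omega> q\<close>.\<close>

lemma Phi_mat_xi:
  assumes P: "P \<in> carrier_mat ((N + 1) * n) ((N + 1) * n)" and S: "S \<in> carrier_mat n n" and R: "R \<in> carrier_mat n n"
  defines "g \<equiv> \<lambda>q. Gamma_mat n N q *\<^sub>v xi"
  shows "Phi_mat n N h P S R \<in> carrier_mat ((N + 3) * n) ((N + 3) * n)"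
    and "xi \<bullet> (Phi_mat n N h P S R *\<^sub>v xi) = dissipation n N h P S R a b c (\<lambda>q. h \<cdot>\<^sub>v \<omega> q) g"
proof -
  let ?m = "(N + 3) * n"
  let ?\<Gamma> = "block_col ?m (map (Gamma_mat n N) [0..<N + 1])"
  let ?M1 = "transpose_mat (G_mat n N h) * P * H_mat n N"
  let ?M3 = "transpose_mat (F_mat n N) * R * F_mat n N"
  let ?M4 = "transpose_mat ?\<Gamma> * R_diag N R * ?\<Gamma>"
  have dims: "dim_row (Gamma_mat n N q) = n" "dim_col (Gamma_mat n N q) = ?m" for q
    using Gamma_mat_xi(1)[of q] by auto
  have g: "g q \<in> carrier_vec n" for q unfolding g_def using Gamma_mat_xi(1)[of q] xi_carrier by auto
  have \<Gamma>c: "?\<Gamma> \<in> carrier_mat ((N + 1) * n) ?m"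
  proof -
    have "?\<Gamma> \<in> carrier_mat (sum_list (map dim_row (map (Gamma_mat n N) [0..<N + 1]))) ?m"
      by (rule block_col_carrier) (use dims in auto)
    moreover have "sum_list (map dim_row (map (Gamma_mat n N) [0..<N + 1])) = (N + 1) * n"
      using dims by (simp add: o_def sum_list_triv del: upt_Suc)
    ultimately show ?thesis by (simp only:)
  qed
  have \<Gamma>x: "?\<Gamma> *\<^sub>v xi = vcat (map g [0..<N + 1])"
    using dims by (subst block_col_mult_vec[OF _ xi_carrier]) (auto simp: o_def g_def simp del: upt_Suc)
  have l2R: "list_all2 (\<lambda>M v. M \<in> carrier_mat (dim_vec v) (dim_vec v))
      (map (\<lambda>q. (2 * real q + 1) \<cdot>\<^sub>m R) [0..<N + 1]) (map g [0..<N + 1])"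
    using R by (auto simp: list_all2_map1 list_all2_map2 list_all2_same carrier_vecD[OF g] simp del: upt_Suc)
  have dg: "dim_vec (vcat (map g [0..<N + 1])) = (N + 1) * n"
    using g by (simp add: dim_vcat o_def sum_list_triv carrier_vecD[OF g] del: upt_Suc)
  have Rc: "R_diag N R \<in> carrier_mat ((N + 1) * n) ((N + 1) * n)"
    using diag_block_mat_mult_vcat(2)[OF l2R] unfolding R_diag_def dg .
  have "(k \<cdot>\<^sub>m R) *\<^sub>v g q = k \<cdot>\<^sub>v (R *\<^sub>v g q)" for k q
    using R g[of q] by (intro eq_vecI) auto
  then have Rx: "R_diag N R *\<^sub>v vcat (map g [0..<N + 1]) = vcat (map (\<lambda>q. (2 * real q + 1) \<cdot>\<^sub>v (R *\<^sub>v g q)) [0..<N + 1])"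
    unfolding R_diag_def diag_block_mat_mult_vcat(1)[OF l2R]
    by (simp add: zip_map_map zip_same_conv_map o_def del: upt_Suc)
  have q4: "xi \<bullet> (?M4 *\<^sub>v xi) = (\<Sum>q<N + 1. (2 * real q + 1) * (g q \<bullet> (R *\<^sub>v g q)))"
  proof -
    have "xi \<bullet> (?M4 *\<^sub>v xi) = vcat (map g [0..<N + 1]) \<bullet> vcat (map (\<lambda>q. (2 * real q + 1) \<cdot>\<^sub>v (R *\<^sub>v g q)) [0..<N + 1])"
      unfolding quad_form_triple[OF \<Gamma>c Rc \<Gamma>c xi_carrier] \<Gamma>x Rx ..
    also have "\<dots> = (\<Sum>q\<leftarrow>[0..<N + 1]. g q \<bullet> ((2 * real q + 1) \<cdot>\<^sub>v (R *\<^sub>v g q)))"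
      using R carrier_vecD[OF g] by (subst scalar_prod_vcat)
        (auto simp: list_all2_conv_all_nth zip_map_map zip_same_conv_map o_def simp del: upt_Suc)
    also have "\<dots> = (\<Sum>q<N + 1. g q \<bullet> ((2 * real q + 1) \<cdot>\<^sub>v (R *\<^sub>v g q)))" by (rule sum_list_upt)
    also have "\<dots> = (\<Sum>q<N + 1. (2 * real q + 1) * (g q \<bullet> (R *\<^sub>v g q)))"
      using R g by (intro sum.cong refl scalar_prod_smult_distrib[of _ n]) auto
    finally show ?thesis .
  qed
  have l2S: "list_all2 (\<lambda>M v. M \<in> carrier_mat (dim_vec v) (dim_vec v))
      [0\<^sub>m n n, S, - S, 0\<^sub>m (n * N) (n * N)] [a, b, c, vcat (map \<omega> [0..<N])]"
    using S car tail_carrier by auto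
  have S_c: "S_tilde n N S \<in> carrier_mat ?m ?m"
  proof -
    have "dim_vec (vcat [a, b, c, vcat (map \<omega> [0..<N])]) = ?m"
      using carrier_vecD[OF xi_carrier] unfolding xi_four .
    with diag_block_mat_mult_vcat(2)[OF l2S] show ?thesis unfolding S_tilde_def by (simp only:)
  qed
  have qS: "xi \<bullet> (S_tilde n N S *\<^sub>v xi) = b \<bullet> (S *\<^sub>v b) - c \<bullet> (S *\<^sub>v c)"
    unfolding S_tilde_def xi_four diag_block_mat_mult_vcat(1)[OF l2S]
    using S car tail_carrier carrier_vecD[OF tail_carrier]
    by (subst scalar_prod_vcat) (auto simp: zero_mult_vec)
  have c1: "?M1 \<in> carrier_mat ?m ?m" using G_mat_xi(1) H_mat_xi(1) P by (meson mult_carrier_mat transpose_carrier_mat)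
  have c3: "?M3 \<in> carrier_mat ?m ?m" using F_mat_xi(1) R by (meson mult_carrier_mat transpose_carrier_mat)
  have c4: "?M4 \<in> carrier_mat ?m ?m" using \<Gamma>c Rc by (meson mult_carrier_mat transpose_carrier_mat)
  have cH: "He ?M1 \<in> carrier_mat ?m ?m" using c1 by (simp add: He_def)
  have k3: "h\<^sup>2 \<cdot>\<^sub>m ?M3 \<in> carrier_mat ?m ?m" using c3 by (rule smult_carrier_mat)
  have c12: "He ?M1 + S_tilde n N S \<in> carrier_mat ?m ?m" using S_c by (rule add_carrier_mat)
  have c123: "He ?M1 + S_tilde n N S + h\<^sup>2 \<cdot>\<^sub>m ?M3 \<in> carrier_mat ?m ?m" using k3 by (rule add_carrier_mat)
  have \<Phi>: "Phi_mat n N h P S R = He ?M1 + S_tilde n N S + h\<^sup>2 \<cdot>\<^sub>m ?M3 - ?M4"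
    by (simp add: Phi_mat_def Let_def)
  show "Phi_mat n N h P S R \<in> carrier_mat ?m ?m" unfolding \<Phi> by (rule minus_carrier_mat[OF c4])
  have "xi \<bullet> (Phi_mat n N h P S R *\<^sub>v xi) = xi \<bullet> (He ?M1 *\<^sub>v xi) + xi \<bullet> (S_tilde n N S *\<^sub>v xi)
      + h\<^sup>2 * (xi \<bullet> (?M3 *\<^sub>v xi)) - xi \<bullet> (?M4 *\<^sub>v xi)"
    unfolding \<Phi> quad_form_add(2)[OF c123 c4 xi_carrier] quad_form_add(1)[OF c12 k3 xi_carrier]
      quad_form_add(1)[OF cH S_c xi_carrier] quad_form_add(3)[OF c3 c3 xi_carrier] ..
  also have "xi \<bullet> (He ?M1 *\<^sub>v xi) = 2 * (vcat (b # map (\<lambda>q. h \<cdot>\<^sub>v \<omega> q) [0..<N]) \<bullet> (P *\<^sub>v vcat (a # map g [0..<N])))"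
    unfolding quad_form_He[OF c1 xi_carrier] quad_form_triple[OF G_mat_xi(1) P H_mat_xi(1) xi_carrier]
      G_mat_xi(2) H_mat_xi(2) g_def ..
  also have "xi \<bullet> (?M3 *\<^sub>v xi) = a \<bullet> (R *\<^sub>v a)"
    unfolding quad_form_triple[OF F_mat_xi(1) R F_mat_xi(1) xi_carrier] F_mat_xi(2) ..
  finally show "xi \<bullet> (Phi_mat n N h P S R *\<^sub>v xi) = dissipation n N h P S R a b c (\<lambda>q. h \<cdot>\<^sub>v \<omega> q) g"
    unfolding q4 qS dissipation_def by simp
qed

end

section \<open>The closed loop\<close>

lemma vcat_zero: "(\<And>v. v \<in> set vs \<Longrightarrow> v = 0\<^sub>v n) \<Longrightarrow> vcat vs = 0\<^sub>v (length vs * n)"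
proof (induction vs)
  case (Cons v vs)
  have "vcat vs = 0\<^sub>v (length vs * n)" by (rule Cons.IH) (rule Cons.prems, simp)
  moreover have "v = 0\<^sub>v n" by (rule Cons.prems) simp
  ultimately have "vcat (v # vs) = 0\<^sub>v n @\<^sub>v 0\<^sub>v (length vs * n)" by simp
  also have "\<dots> = 0\<^sub>v (length (v # vs) * n)" by (intro eq_vecI) auto
  finally show ?case .
qed simp

lemma F_W_carrier: "F_W n N k r \<epsilon> \<in> carrier_mat n ((N + 3) * n)"
proof -
  let ?Ms = "map (\<lambda>i. sum_mats n (\<lambda>j. \<epsilon> i j \<cdot>\<^sub>m (transpose_mat (J_mat n r j) * J_mat n r j)) k) [0..<N + 3]"
  have "block_row n ?Ms \<in> carrier_mat n (sum_list (map dim_col ?Ms))"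
    by (rule block_row_carrier) (auto simp: sum_mats_def)
  moreover have "sum_list (map dim_col ?Ms) = (N + 3) * n"
    by (simp add: o_def sum_list_triv sum_mats_def del: upt_Suc)
  ultimately show ?thesis unfolding F_W_def by (simp only:)
qed

text \<open>The value is the residual of the closed loop in the coordinates \<open>X w\<close>. The
  delayed vector meets \<open>D\<close> without \<open>X\<close>, since \<open>D\<close> will be
  \<open>Bt * Kbar\<close> and \<open>Kbar\<close> already absorbs \<open>X\<close>.\<close>

lemma closed_loop_row_mult_vec:
  fixes n N :: nat and X At D :: "real mat"
  assumes car: "a \<in> carrier_vec n" "b \<in> carrier_vec n" "c \<in> carrier_vec n" "\<And>q. \<omega> q \<in> carrier_vec n"
    and X: "X \<in> carrier_mat n n" and At: "At \<in> carrier_mat n n" and D: "D \<in> carrier_mat n n"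
  defines "Y \<equiv> block_row n [1\<^sub>m n, - At, 0\<^sub>m n n, 0\<^sub>m n (n * N)] * diag_block_mat (replicate (N + 3) X)
      + block_row n [0\<^sub>m n n, 0\<^sub>m n n, - D, 0\<^sub>m n (n * N)]"
  shows "Y \<in> carrier_mat n ((N + 3) * n)"
    and "Y *\<^sub>v vcat ([a, b, c] @ map \<omega> [0..<N]) = X *\<^sub>v a - At *\<^sub>v (X *\<^sub>v b) - D *\<^sub>v c"
proof -
  let ?xs = "[a, b, c] @ map \<omega> [0..<N]"
  let ?L = "block_row n [1\<^sub>m n, - At, 0\<^sub>m n n, 0\<^sub>m n (n * N)]"
  let ?Z = "block_row n [0\<^sub>m n n, 0\<^sub>m n n, - D, 0\<^sub>m n (n * N)]"
  let ?Xt = "diag_block_mat (replicate (N + 3) X)"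
  note xc = xi_carrier[where \<omega> = \<omega> and N = N, OF car]
  have rep: "replicate (N + 3) X = map (\<lambda>_. X) ?xs"
    by (simp add: map_replicate_const numeral_3_eq_3)
  have l2: "list_all2 (\<lambda>M v. M \<in> carrier_mat (dim_vec v) (dim_vec v)) (replicate (N + 3) X) ?xs"
    unfolding rep using X car by (auto simp: list_all2_map1 list_all2_map2 list_all2_same carrier_vecD[OF car(4)])
  have Xt: "?Xt \<in> carrier_mat ((N + 3) * n) ((N + 3) * n)"
    using diag_block_mat_mult_vcat(2)[OF l2] unfolding carrier_vecD[OF xc] .
  have Xtx: "?Xt *\<^sub>v vcat ?xs = vcat ([X *\<^sub>v a, X *\<^sub>v b, X *\<^sub>v c] @ map (\<lambda>q. X *\<^sub>v \<omega> q) [0..<N])"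
    unfolding diag_block_mat_mult_vcat(1)[OF l2] unfolding rep
    by (simp add: zip_map1 zip_map2 zip_same_conv_map o_def case_prod_beta)
  have Xcar: "X *\<^sub>v a \<in> carrier_vec n" "X *\<^sub>v b \<in> carrier_vec n" "X *\<^sub>v c \<in> carrier_vec n" "X *\<^sub>v \<omega> q \<in> carrier_vec n" for q
    using X car by auto
  note Xtail = tail_carrier[where \<omega> = "\<lambda>q. X *\<^sub>v \<omega> q" and N = N, OF Xcar]
  note tail = tail_carrier[where \<omega> = \<omega> and N = N, OF car]
  have L: "?L \<in> carrier_mat n ((N + 3) * n)"
    "?L *\<^sub>v vcat ([X *\<^sub>v a, X *\<^sub>v b, X *\<^sub>v c] @ map (\<lambda>q. X *\<^sub>v \<omega> q) [0..<N])
      = 1\<^sub>m n *\<^sub>v (X *\<^sub>v a) + - At *\<^sub>v (X *\<^sub>v b) + 0\<^sub>m n n *\<^sub>v (X *\<^sub>v c) + 0\<^sub>m n (n * N) *\<^sub>v vcat (map (\<lambda>q. X *\<^sub>v \<omega> q) [0..<N])"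
    by (rule block_row_four[where \<omega> = "\<lambda>q. X *\<^sub>v \<omega> q", OF Xcar]; use At in simp)+
  have Z: "?Z \<in> carrier_mat n ((N + 3) * n)"
    "?Z *\<^sub>v vcat ?xs = 0\<^sub>m n n *\<^sub>v a + 0\<^sub>m n n *\<^sub>v b + - D *\<^sub>v c + 0\<^sub>m n (n * N) *\<^sub>v vcat (map \<omega> [0..<N])"
    by (rule block_row_four[where \<omega> = \<omega>, OF car]; use D in simp)+
  show "Y \<in> carrier_mat n ((N + 3) * n)" unfolding Y_def using L(1) Xt Z(1) by (intro add_carrier_mat)
  have "Y *\<^sub>v vcat ?xs = ?L *\<^sub>v (?Xt *\<^sub>v vcat ?xs) + ?Z *\<^sub>v vcat ?xs"
    unfolding Y_def using L(1) Xt Z(1) xc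
    by (subst add_mult_distrib_mat_vec[OF mult_carrier_mat[OF L(1) Xt] Z(1) xc])
      (subst assoc_mult_mat_vec[OF L(1) Xt xc], rule refl)
  also have "\<dots> = X *\<^sub>v a - At *\<^sub>v (X *\<^sub>v b) - D *\<^sub>v c"
    unfolding Xtx L(2) Z(2) zero_mult_vec[where \<omega> = \<omega>, OF car car(1)] zero_mult_vec[where \<omega> = \<omega>, OF car car(2)]
      zero_mult_vec[where \<omega> = \<omega>, OF car Xcar(3)] zero_mult_vec[where \<omega> = \<omega>, OF car tail] zero_mult_vec[where \<omega> = \<omega>, OF car Xtail]
    using X At D car Xcar by (intro eq_vecI) auto
  finally show "Y *\<^sub>v vcat ?xs = X *\<^sub>v a - At *\<^sub>v (X *\<^sub>v b) - D *\<^sub>v c" .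
qed

locale closed_loop_lmi =
  fixes n N :: nat and h :: real and P S R X At D W :: "real mat"
  assumes h: "h > 0"
    and P: "pos_def ((N + 1) * n) P" and S: "pos_def n S" and R: "pos_def n R"
    and X: "X \<in> carrier_mat n n" and At: "At \<in> carrier_mat n n" and D: "D \<in> carrier_mat n n"
    and W: "W \<in> carrier_mat n ((N + 3) * n)"
    and lmi: "neg_def ((N + 3) * n) (Phi_mat n N h P S R + He (transpose_mat
      (block_row n [1\<^sub>m n, - At, 0\<^sub>m n n, 0\<^sub>m n (n * N)] * diag_block_mat (replicate (N + 3) X)
        + block_row n [0\<^sub>m n n, 0\<^sub>m n n, - D, 0\<^sub>m n (n * N)]) * W))"
begin

text \<open>On vectors annihilated by the closed-loop row the slack term drops out.\<close>

lemma dissipation_coercive: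
  obtains \<delta> where "\<delta> > 0"
    "\<And>a b c \<omega>. a \<in> carrier_vec n \<Longrightarrow> b \<in> carrier_vec n \<Longrightarrow> c \<in> carrier_vec n \<Longrightarrow> (\<And>q. \<omega> q \<in> carrier_vec n) \<Longrightarrow>
      X *\<^sub>v a = At *\<^sub>v (X *\<^sub>v b) + D *\<^sub>v c \<Longrightarrow>
      dissipation n N h P S R a b c (\<lambda>q. h \<cdot>\<^sub>v \<omega> q) (legendre_moment n N h b c (\<lambda>q. h \<cdot>\<^sub>v \<omega> q))
        \<le> - \<delta> * (a \<bullet> a + b \<bullet> b)"
proof -
  let ?m = "(N + 3) * n"
  let ?Y = "block_row n [1\<^sub>m n, - At, 0\<^sub>m n n, 0\<^sub>m n (n * N)] * diag_block_mat (replicate (N + 3) X)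
        + block_row n [0\<^sub>m n n, 0\<^sub>m n n, - D, 0\<^sub>m n (n * N)]"
  let ?\<Phi> = "Phi_mat n N h P S R"
  let ?Q = "?\<Phi> + He (transpose_mat ?Y * W)"
  have Q: "?Q \<in> carrier_mat ?m ?m" and QT: "transpose_mat ?Q = ?Q"
    and Qneg: "\<And>v. v \<in> carrier_vec ?m \<Longrightarrow> v \<noteq> 0\<^sub>v ?m \<Longrightarrow> v \<bullet> (?Q *\<^sub>v v) < 0"
    using lmi by (auto simp: neg_def_def sym_mat_def)
  have Pc: "P \<in> carrier_mat ((N + 1) * n) ((N + 1) * n)" and Sc: "S \<in> carrier_mat n n" and Rc: "R \<in> carrier_mat n n"
    using P S R by (auto simp: pos_def_def sym_mat_def)
  have mQ: "v \<bullet> (- ?Q *\<^sub>v v) = - (v \<bullet> (?Q *\<^sub>v v))" if "v \<in> carrier_vec ?m" for v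
    by (rule quad_form_add(4)[OF Q Q that])
  have "transpose_mat (- ?Q) = - transpose_mat ?Q" using Q by (intro eq_matI) auto
  then have "sym_mat ?m (- ?Q)" unfolding sym_mat_def QT using Q by simp
  \<comment> \<open>Passing to the negative lets \<open>pos_def_coercive\<close> turn strict
    negativity into a uniform rate \<open>\<delta>\<close>.\<close>
  then have "pos_def ?m (- ?Q)" unfolding pos_def_def using mQ Qneg by auto
  then obtain \<delta> where \<delta>: "\<delta> > 0" "\<And>v. v \<in> carrier_vec ?m \<Longrightarrow> \<delta> * (v \<bullet> v) \<le> v \<bullet> (- ?Q *\<^sub>v v)"
    using pos_def_coercive by blast
  show thesis
  proof (rule that[OF \<delta>(1)])
    fix a b c :: "real Matrix.vec" and \<omega> :: "nat \<Rightarrow> real Matrix.vec"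
    assume car: "a \<in> carrier_vec n" "b \<in> carrier_vec n" "c \<in> carrier_vec n" "\<And>q. \<omega> q \<in> carrier_vec n"
      and eq: "X *\<^sub>v a = At *\<^sub>v (X *\<^sub>v b) + D *\<^sub>v c"
    let ?x = "vcat ([a, b, c] @ map \<omega> [0..<N])"
    note x = xi_carrier[where \<omega> = \<omega> and N = N, OF car]
    note Y = closed_loop_row_mult_vec[where \<omega> = \<omega> and N = N, OF car X At D]
    note \<Phi> = Phi_mat_xi[where \<omega> = \<omega> and h = h, OF car Pc Sc Rc]
    have Yx: "?Y *\<^sub>v ?x = 0\<^sub>v n"
      unfolding Y(2) eq using X At D car by (intro eq_vecI) auto
    have YW: "transpose_mat ?Y * W \<in> carrier_mat ?m ?m" using Y(1) W by (meson mult_carrier_mat transpose_carrier_mat)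
    have "(transpose_mat ?Y * W) *\<^sub>v ?x = transpose_mat ?Y *\<^sub>v (W *\<^sub>v ?x)"
      using Y(1) W x by (meson assoc_mult_mat_vec transpose_carrier_mat)
    moreover have "?x \<bullet> (transpose_mat ?Y *\<^sub>v (W *\<^sub>v ?x)) = (transpose_mat ?Y *\<^sub>v (W *\<^sub>v ?x)) \<bullet> ?x"
      by (rule comm_scalar_prod[OF x])
        (rule mult_mat_vec_carrier[OF _ mult_mat_vec_carrier[OF W x]], use Y(1) in \<open>meson transpose_carrier_mat\<close>)
    moreover have "\<dots> = (W *\<^sub>v ?x) \<bullet> (?Y *\<^sub>v ?x)"
      by (rule transpose_vec_mult_scalar[OF Y(1) x mult_mat_vec_carrier[OF W x]])
    moreover have "\<dots> = 0" unfolding Yx using mult_mat_vec_carrier[OF W x] by (rule scalar_prod_right_zero)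
    ultimately have "?x \<bullet> ((transpose_mat ?Y * W) *\<^sub>v ?x) = 0" by (simp only:)
    then have "?x \<bullet> (He (transpose_mat ?Y * W) *\<^sub>v ?x) = 0"
      unfolding quad_form_He[OF YW x] by simp
    moreover have HeC: "He (transpose_mat ?Y * W) \<in> carrier_mat ?m ?m"
      unfolding He_def using YW by (meson add_carrier_mat transpose_carrier_mat)
    ultimately have "?x \<bullet> (?Q *\<^sub>v ?x) = ?x \<bullet> (?\<Phi> *\<^sub>v ?x)"
      unfolding quad_form_add(1)[OF \<Phi>(1) HeC x] by simp
    then have "?x \<bullet> (?\<Phi> *\<^sub>v ?x) \<le> - \<delta> * (?x \<bullet> ?x)"
      using \<delta>(2)[OF x] mQ[OF x] by linarith
    moreover have "(\<lambda>q. Gamma_mat n N q *\<^sub>v ?x) = legendre_moment n N h b c (\<lambda>q. h \<cdot>\<^sub>v \<omega> q)"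
    proof (rule ext, rule eq_vecI)
      fix q i assume "i < dim_vec (legendre_moment n N h b c (\<lambda>q. h \<cdot>\<^sub>v \<omega> q) q)"
      then have i: "i < n" by (simp add: legendre_moment_def)
      then have sc: "(h \<cdot>\<^sub>v \<omega> j) $ i / h = \<omega> j $ i" for j using h carrier_vecD[OF car(4)[of j]] by simp
      show "(Gamma_mat n N q *\<^sub>v ?x) $ i = legendre_moment n N h b c (\<lambda>q. h \<cdot>\<^sub>v \<omega> q) q $ i"
        unfolding Gamma_mat_xi(2)[where \<omega> = \<omega>, OF car] legendre_moment_def
        using i by (simp add: sc del: times_divide_eq_right)
    next
      fix q
      show "dim_vec (Gamma_mat n N q *\<^sub>v ?x) = dim_vec (legendre_moment n N h b c (\<lambda>q. h \<cdot>\<^sub>v \<omega> q) q)"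
        unfolding Gamma_mat_xi(2)[where \<omega> = \<omega>, OF car] legendre_moment_def by simp
    qed
    ultimately have "dissipation n N h P S R a b c (\<lambda>q. h \<cdot>\<^sub>v \<omega> q) (legendre_moment n N h b c (\<lambda>q. h \<cdot>\<^sub>v \<omega> q))
        \<le> - \<delta> * (?x \<bullet> ?x)" unfolding \<Phi>(2) by (simp only:)
    also have "\<dots> \<le> - \<delta> * (a \<bullet> a + b \<bullet> b)"
    proof -
      have "a \<bullet> a + b \<bullet> b \<le> ?x \<bullet> ?x"
      proof -
        have "(\<Sum>q<N. \<omega> q \<bullet> \<omega> q) \<ge> 0" by (intro sum_nonneg scalar_prod_self_nonneg)
        then show ?thesis
          unfolding xi_self[where \<omega> = \<omega>, OF car] using scalar_prod_self_nonneg[of c] by linarith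
      qed
      from mult_left_mono[OF this less_imp_le[OF \<delta>(1)]] show ?thesis by linarith
    qed
    finally show "dissipation n N h P S R a b c (\<lambda>q. h \<cdot>\<^sub>v \<omega> q) (legendre_moment n N h b c (\<lambda>q. h \<cdot>\<^sub>v \<omega> q))
        \<le> - \<delta> * (a \<bullet> a + b \<bullet> b)" .
  qed
qed

lemma X_kernel_trivial:
  assumes v: "v \<in> carrier_vec n" "v \<noteq> 0\<^sub>v n"
  shows "X *\<^sub>v v \<noteq> 0\<^sub>v n"
proof
  assume Xv: "X *\<^sub>v v = 0\<^sub>v n"
  \<comment> \<open>Test the inequality with \<open>x' = v\<close> and all other components zero: only \<open>h\<^sup>2 v\<^sup>T R v\<close> survives.\<close>
  obtain \<delta> where \<delta>: "\<delta> > 0"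
    "\<And>a b c \<omega>. a \<in> carrier_vec n \<Longrightarrow> b \<in> carrier_vec n \<Longrightarrow> c \<in> carrier_vec n \<Longrightarrow> (\<And>q. \<omega> q \<in> carrier_vec n) \<Longrightarrow>
      X *\<^sub>v a = At *\<^sub>v (X *\<^sub>v b) + D *\<^sub>v c \<Longrightarrow>
      dissipation n N h P S R a b c (\<lambda>q. h \<cdot>\<^sub>v \<omega> q) (legendre_moment n N h b c (\<lambda>q. h \<cdot>\<^sub>v \<omega> q))
        \<le> - \<delta> * (a \<bullet> a + b \<bullet> b)"
    using dissipation_coercive by blast
  let ?z = "\<lambda>_ :: nat. h \<cdot>\<^sub>v 0\<^sub>v n" and ?o = "0\<^sub>v n :: real Matrix.vec"
  have mz: "M *\<^sub>v ?o = ?o" if "M \<in> carrier_mat n n" for M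
    using that by (intro eq_vecI) auto
  have "X *\<^sub>v v = At *\<^sub>v (X *\<^sub>v ?o) + D *\<^sub>v ?o"
    unfolding Xv mz[OF X] mz[OF At] mz[OF D] by simp
  then have "dissipation n N h P S R v ?o ?o ?z (legendre_moment n N h ?o ?o ?z) \<le> - \<delta> * (v \<bullet> v + ?o \<bullet> ?o)"
    by (intro \<delta>(2)[of v ?o ?o "\<lambda>_. ?o"]) (use v in auto)
  moreover have "dissipation n N h P S R v ?o ?o ?z (legendre_moment n N h ?o ?o ?z) = h\<^sup>2 * (v \<bullet> (R *\<^sub>v v))"
  proof -
    have g: "legendre_moment n N h ?o ?o ?z = (\<lambda>q. ?o)"
      unfolding legendre_moment_def by (intro ext eq_vecI) auto
    have z: "vcat (?o # map ?z [0..<N]) = 0\<^sub>v ((N + 1) * n)"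
    proof -
      have "h \<cdot>\<^sub>v 0\<^sub>v n = 0\<^sub>v n" by (intro eq_vecI) auto
      then have "vcat (?o # map ?z [0..<N]) = 0\<^sub>v (length (?o # map ?z [0..<N]) * n)"
        by (intro vcat_zero) auto
      moreover have "length (?o # map ?z [0..<N]) * n = (N + 1) * n" by simp
      ultimately show ?thesis by (simp only:)
    qed
    have "P *\<^sub>v u \<in> carrier_vec ((N + 1) * n)" for u
      using P by (auto simp: pos_def_def sym_mat_def intro: carrier_vecI)
    from scalar_prod_left_zero[OF this]
    have "0\<^sub>v ((N + 1) * n) \<bullet> (P *\<^sub>v u) = 0" for u .
    moreover have "S *\<^sub>v ?o = ?o" "R *\<^sub>v ?o = ?o" using S R by (auto intro!: mz simp: pos_def_def sym_mat_def)
    ultimately show ?thesis unfolding dissipation_def g z by simp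
  qed
  moreover have "v \<bullet> (R *\<^sub>v v) > 0" using R v by (auto simp: pos_def_def)
  moreover have "\<delta> * (v \<bullet> v) \<ge> 0" using \<delta>(1) scalar_prod_self_nonneg[of v] by simp
  moreover have "h\<^sup>2 * (v \<bullet> (R *\<^sub>v v)) > 0" using \<open>v \<bullet> (R *\<^sub>v v) > 0\<close> h by simp
  moreover have "?o \<bullet> ?o = 0" by simp
  ultimately show False by (simp add: distrib_left)
qed

lemmas X_inv = kernel_trivial_imp_inverse[OF X X_kernel_trivial]

text \<open>Once \<open>X\<close> is invertible, the constraint \<open>X a = At X b + D c\<close>
  can be solved for \<open>a\<close>, and the solution is the right-hand side of a delay system with
  coefficients \<open>mat_inv X * (At * X)\<close> and \<open>mat_inv X * D\<close>.\<close>

lemma lyapunov_krasovskii_transformed: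
  obtains \<delta> where "lyapunov_krasovskii n h (mat_inv X * (At * X)) (mat_inv X * D) N P S R \<delta>"
proof -
  obtain \<delta> where \<delta>: "\<delta> > 0"
    "\<And>a b c \<omega>. a \<in> carrier_vec n \<Longrightarrow> b \<in> carrier_vec n \<Longrightarrow> c \<in> carrier_vec n \<Longrightarrow> (\<And>q. \<omega> q \<in> carrier_vec n) \<Longrightarrow>
      X *\<^sub>v a = At *\<^sub>v (X *\<^sub>v b) + D *\<^sub>v c \<Longrightarrow>
      dissipation n N h P S R a b c (\<lambda>q. h \<cdot>\<^sub>v \<omega> q) (legendre_moment n N h b c (\<lambda>q. h \<cdot>\<^sub>v \<omega> q))
        \<le> - \<delta> * (a \<bullet> a + b \<bullet> b)"
    using dissipation_coercive by blast
  let ?A0 = "mat_inv X * (At * X)" and ?A1 = "mat_inv X * D"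
  have A: "?A0 \<in> carrier_mat n n" "?A1 \<in> carrier_mat n n" using X_inv(1) X At D by (meson mult_carrier_mat)+
  show thesis
  proof (rule that[of \<delta>], unfold_locales)
    fix b c :: "real Matrix.vec" and z :: "nat \<Rightarrow> real Matrix.vec"
    assume car: "b \<in> carrier_vec n" "c \<in> carrier_vec n" "\<And>q. z q \<in> carrier_vec n"
    let ?a = "?A0 *\<^sub>v b + ?A1 *\<^sub>v c"
    have a: "?a \<in> carrier_vec n" using A car by auto
    have XA: "X * ?A0 = At * X" "X * ?A1 = D"
    proof -
      have "X * (mat_inv X * M) = M" if M: "M \<in> carrier_mat n n" for M
      proof -
        have "X * (mat_inv X * M) = (X * mat_inv X) * M" using assoc_mult_mat[OF X X_inv(1) M] by simp
        then show ?thesis using X_inv(2) M by simp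
      qed
      then show "X * ?A0 = At * X" "X * ?A1 = D" using At X D by auto
    qed
    have "X *\<^sub>v ?a = X *\<^sub>v (?A0 *\<^sub>v b) + X *\<^sub>v (?A1 *\<^sub>v c)"
      using X A car by (intro mult_add_distrib_mat_vec) auto
    also have "X *\<^sub>v (?A0 *\<^sub>v b) = At *\<^sub>v (X *\<^sub>v b)"
      using assoc_mult_mat_vec[OF X A(1) car(1)] assoc_mult_mat_vec[OF At X car(1)] XA(1) by simp
    also have "X *\<^sub>v (?A1 *\<^sub>v c) = D *\<^sub>v c"
      using assoc_mult_mat_vec[OF X A(2) car(2)] XA(2) by simp
    finally have eq: "X *\<^sub>v ?a = At *\<^sub>v (X *\<^sub>v b) + D *\<^sub>v c" .
    \<comment> \<open>Any family \<open>z\<close> is reached by taking \<open>z q / h\<close> for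
      the normalised components.\<close>
    have "(\<lambda>q. h \<cdot>\<^sub>v ((1 / h) \<cdot>\<^sub>v z q)) = z" using h by (auto intro!: ext eq_vecI)
    with \<delta>(2)[OF a car(1,2) _ eq, of "\<lambda>q. (1 / h) \<cdot>\<^sub>v z q"] car(3)
    have "dissipation n N h P S R ?a b c z (legendre_moment n N h b c z) \<le> - \<delta> * (?a \<bullet> ?a + b \<bullet> b)"
      by simp
    also have "\<dots> \<le> - \<delta> * (b \<bullet> b)"
      using mult_nonneg_nonneg[OF less_imp_le[OF \<delta>(1)] scalar_prod_self_nonneg[of ?a]] by (simp add: distrib_left)
    finally show "dissipation n N h P S R ?a b c z (legendre_moment n N h b c z) \<le> - \<delta> * (b \<bullet> b)" .
  qed (rule h A P S R \<delta>(1))+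
qed

end

section \<open>Return to the original coordinates\<close>

lemma index_mult_mat_vec_sum:
  assumes "M \<in> carrier_mat n m" "v \<in> carrier_vec m" "i < n"
  shows "(M *\<^sub>v v) $ i = (\<Sum>j<m. M $$ (i, j) * v $ j)"
  using assms by (auto simp: scalar_prod_def atLeast0LessThan intro!: sum.cong)

text \<open>The intertwining relations \<open>ZA\<close> and \<open>ZB\<close> push \<open>Z\<close>
  through the right-hand side of the closed loop, so that \<open>Z x\<close> solves the system with
  coefficients \<open>A0\<close> and \<open>A1\<close>.\<close>

lemma transformed_solution:
  fixes A B K Z A0 A1 :: "real mat"
  assumes sys: "delay_system n h A0 A1"
    and Z: "Z \<in> carrier_mat n n" and A: "A \<in> carrier_mat n n"
    and B: "B \<in> carrier_mat n m" and K: "K \<in> carrier_mat m n"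
    and ZA: "Z * A = A0 * Z" and ZB: "Z * (B * K) = A1 * Z"
    and x: "closed_loop_solution n h A B (1\<^sub>m n) K \<phi> x"
  shows "\<exists>w. delay_system.sol n h A0 A1 w \<and> (\<forall>t\<ge>- h. w t = Z *\<^sub>v x t)"
proof -
  interpret delay_system n h A0 A1 by (rule sys)
  have xc: "vec_continuous_on n {-h..} x" and xcar: "\<And>t. t \<ge> - h \<Longrightarrow> x t \<in> carrier_vec n"
    and xd: "\<And>t i. t > 0 \<Longrightarrow> i < n \<Longrightarrow> ((\<lambda>s. x s $ i) has_real_derivative
        (A *\<^sub>v x t + B *\<^sub>v (K *\<^sub>v (1\<^sub>m n *\<^sub>v x (t - h)))) $ i) (at t)"
    using x by (auto simp: closed_loop_solution_def vec_continuous_on_def)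
  \<comment> \<open>\<open>x\<close> is unconstrained before \<open>-h\<close>; a sum over coordinates stays differentiable and of dimension \<open>n\<close> there.\<close>
  define w where "w t = Matrix.vec n (\<lambda>i. \<Sum>j<n. Z $$ (i, j) * x t $ j)" for t
  have w: "w t = Z *\<^sub>v x t" if "t \<ge> - h" for t
  proof (rule eq_vecI)
    fix i assume "i < dim_vec (Z *\<^sub>v x t)"
    then have "i < n" using Z by simp
    then show "w t $ i = (Z *\<^sub>v x t) $ i"
      using index_mult_mat_vec_sum[OF Z xcar[OF that]] by (simp add: w_def)
  qed (use Z in \<open>simp add: w_def\<close>)
  have Zc: "vec_continuous_on n {-h..} (\<lambda>t. Z *\<^sub>v x t)" by (rule continuous_on_mult_mat_vec[OF Z xc])
  have wc: "vec_continuous_on n {-h..} w"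
    unfolding vec_continuous_on_def
  proof (intro conjI ballI allI impI)
    fix i assume "i < n"
    then have "continuous_on {-h..} (\<lambda>t. (Z *\<^sub>v x t) $ i)" using Zc by (simp add: vec_continuous_on_def)
    then show "continuous_on {-h..} (\<lambda>t. w t $ i)" by (rule continuous_on_eq) (simp add: w)
  qed (simp add: w_def)
  have "vec_deriv n w (rhs w t) t" if t: "t > 0" for t
  proof -
    let ?y = "A *\<^sub>v x t + B *\<^sub>v (K *\<^sub>v (1\<^sub>m n *\<^sub>v x (t - h)))"
    have xt: "x t \<in> carrier_vec n" "x (t - h) \<in> carrier_vec n" using xcar t h by auto
    have Ax: "A *\<^sub>v x t \<in> carrier_vec n" by (rule mult_mat_vec_carrier[OF A xt(1)])
    have BK: "B * K \<in> carrier_mat n n" by (rule mult_carrier_mat[OF B K])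
    have BKx: "B *\<^sub>v (K *\<^sub>v (1\<^sub>m n *\<^sub>v x (t - h))) = (B * K) *\<^sub>v x (t - h)"
      unfolding one_mult_mat_vec[OF xt(2)] by (rule assoc_mult_mat_vec[OF B K xt(2), symmetric])
    have BKc: "(B * K) *\<^sub>v x (t - h) \<in> carrier_vec n" by (rule mult_mat_vec_carrier[OF BK xt(2)])
    have y: "?y \<in> carrier_vec n" unfolding BKx using Ax BKc by (rule add_carrier_vec)
    have "Z *\<^sub>v ?y = Z *\<^sub>v (A *\<^sub>v x t) + Z *\<^sub>v ((B * K) *\<^sub>v x (t - h))"
      unfolding BKx by (rule mult_add_distrib_mat_vec[OF Z Ax BKc])
    also have "Z *\<^sub>v (A *\<^sub>v x t) = A0 *\<^sub>v (Z *\<^sub>v x t)"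
      unfolding assoc_mult_mat_vec[OF Z A xt(1), symmetric] ZA by (rule assoc_mult_mat_vec[OF A0 Z xt(1)])
    also have "Z *\<^sub>v ((B * K) *\<^sub>v x (t - h)) = A1 *\<^sub>v (Z *\<^sub>v x (t - h))"
      unfolding assoc_mult_mat_vec[OF Z BK xt(2), symmetric] ZB by (rule assoc_mult_mat_vec[OF A1 Z xt(2)])
    finally have rhs: "rhs w t = Z *\<^sub>v ?y" using w[of t] w[of "t - h"] t h by (simp add: rhs_def)
    have "((\<lambda>s. w s $ i) has_real_derivative (Z *\<^sub>v ?y) $ i) (at t)" if i: "i < n" for i
    proof -
      have "((\<lambda>s. \<Sum>j<n. Z $$ (i, j) * x s $ j) has_real_derivative (\<Sum>j<n. Z $$ (i, j) * ?y $ j)) (at t)"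
        by (intro DERIV_sum DERIV_cmult xd t) simp
      then show ?thesis unfolding index_mult_mat_vec_sum[OF Z y i] using i by (simp add: w_def)
    qed
    moreover have "Z *\<^sub>v ?y \<in> carrier_vec n" by (rule mult_mat_vec_carrier[OF Z y])
    ultimately show ?thesis unfolding vec_deriv_def rhs by (auto simp: w_def)
  qed
  then have "sol w" using wc unfolding sol_def by (auto simp: w_def)
  with w show ?thesis by blast
qed

lemma stable_by_transformation:
  fixes A B K Z Zi :: "real mat"
  assumes LK: "lyapunov_krasovskii n h A0 A1 N P S R \<delta>"
    and Z: "Z \<in> carrier_mat n n" and Zi: "Zi \<in> carrier_mat n n" and ZiZ: "Zi * Z = 1\<^sub>m n"
    and A: "A \<in> carrier_mat n n" and B: "B \<in> carrier_mat n m" and K: "K \<in> carrier_mat m n"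
    and ZA: "Z * A = A0 * Z" and ZB: "Z * (B * K) = A1 * Z"
  shows "closed_loop_asymptotically_stable n h A B (1\<^sub>m n) K"
proof -
  interpret lyapunov_krasovskii n h A0 A1 N P S R \<delta> by (rule LK)
  obtain c where c: "c > 0" "\<And>v. v \<in> carrier_vec n \<Longrightarrow> (Z *\<^sub>v v) \<bullet> (Z *\<^sub>v v) \<le> c * (v \<bullet> v)"
    using mult_mat_vec_bound[OF Z] by auto
  obtain c' where c': "c' > 0" "\<And>v. v \<in> carrier_vec n \<Longrightarrow> (Zi *\<^sub>v v) \<bullet> (Zi *\<^sub>v v) \<le> c' * (v \<bullet> v)"
    using mult_mat_vec_bound[OF Zi] by auto
  obtain C where C: "C > 0"
      "\<And>w D t. sol w \<Longrightarrow> (\<And>s. s \<in> {-h..0} \<Longrightarrow> w s \<bullet> w s \<le> D) \<Longrightarrow> t \<ge> - h \<Longrightarrow> w t \<bullet> w t \<le> C * D"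
    using sol_bounded by blast
  have inverse_bound: "v \<bullet> v \<le> c' * ((Z *\<^sub>v v) \<bullet> (Z *\<^sub>v v))" if v: "v \<in> carrier_vec n" for v
  proof -
    have "Zi *\<^sub>v (Z *\<^sub>v v) = v"
      unfolding assoc_mult_mat_vec[OF Zi Z v, symmetric] ZiZ by (rule one_mult_mat_vec[OF v])
    with c'(2)[OF mult_mat_vec_carrier[OF Z v]] show ?thesis by simp
  qed
  have transf: "\<exists>w. sol w \<and> (\<forall>t\<ge>- h. w t = Z *\<^sub>v x t) \<and> (\<forall>t\<ge>- h. x t \<in> carrier_vec n)"
    if x: "closed_loop_solution n h A B (1\<^sub>m n) K \<phi> x" for \<phi> x
  proof -
    have "\<forall>t\<ge>- h. x t \<in> carrier_vec n"
      using x by (auto simp: closed_loop_solution_def vec_continuous_on_def)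
    moreover obtain w where "sol w \<and> (\<forall>t\<ge>- h. w t = Z *\<^sub>v x t)"
      using transformed_solution[OF delay_system_axioms Z A B K ZA ZB x] by (rule exE)
    ultimately show ?thesis by (intro exI[of _ w]) simp
  qed
  show ?thesis unfolding closed_loop_asymptotically_stable_def
  proof (intro conjI allI impI)
    fix e :: real assume e: "e > 0"
    \<comment> \<open>The squared norm passes from the initial \<open>x\<close> to \<open>w\<close>
      with factor \<open>c\<close>, along the solution with factor \<open>C\<close>, and back to
      \<open>x(t)\<close> with factor \<open>c'\<close>.\<close>
    define L where "L = c' * (C * c)"
    have L: "L > 0" unfolding L_def using c C c' by simp
    \<comment> \<open>The 1 added to \<open>sqrt L\<close> makes the final bound strict:
      \<open>sqrt L * d < e\<close>.\<close>
    define d where "d = e / (sqrt L + 1)"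
    have sL: "sqrt L + 1 > 0" using L by (simp add: add_pos_pos)
    then have d: "d > 0" using e by (simp add: d_def)
    have "\<forall>t\<ge>0. vnorm (x t) < e"
      if x: "closed_loop_solution n h A B (1\<^sub>m n) K \<phi> x" and \<phi>: "\<forall>t\<in>{-h..0}. vnorm (\<phi> t) < d" for \<phi> x
    proof (intro allI impI)
      fix t :: real assume t: "t \<ge> 0"
      obtain w where w: "sol w" "\<And>t. t \<ge> - h \<Longrightarrow> w t = Z *\<^sub>v x t" "\<And>t. t \<ge> - h \<Longrightarrow> x t \<in> carrier_vec n"
        using transf[OF x] by blast
      have "w s \<bullet> w s \<le> c * d\<^sup>2" if s: "s \<in> {-h..0}" for s
      proof -
        have "sqrt (x s \<bullet> x s) < d" using x \<phi> s by (auto simp: closed_loop_solution_def vnorm_def)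
        then have "(sqrt (x s \<bullet> x s))\<^sup>2 \<le> d\<^sup>2"
          by (intro power_mono) (simp_all add: scalar_prod_self_nonneg)
        then have "x s \<bullet> x s \<le> d\<^sup>2" by (simp add: scalar_prod_self_nonneg)
        then have "c * (x s \<bullet> x s) \<le> c * d\<^sup>2" using c(1) by simp
        moreover have "w s \<bullet> w s \<le> c * (x s \<bullet> x s)" using c(2)[OF w(3)] w(2) s by auto
        ultimately show ?thesis by linarith
      qed
      from C(2)[OF w(1) this, of t] have "w t \<bullet> w t \<le> C * (c * d\<^sup>2)" using t h by simp
      then have "c' * (w t \<bullet> w t) \<le> L * d\<^sup>2"
        unfolding L_def using c'(1) by (simp add: mult.assoc)
      moreover have "x t \<bullet> x t \<le> c' * (w t \<bullet> w t)" using inverse_bound[OF w(3)] w(2) t h by simp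
      ultimately have "x t \<bullet> x t \<le> L * d\<^sup>2" by linarith
      then have "vnorm (x t) \<le> sqrt (L * d\<^sup>2)" unfolding vnorm_def by (rule real_sqrt_le_mono)
      also have "\<dots> = sqrt L * d" using d by (simp add: real_sqrt_mult)
      also have "\<dots> < (sqrt L + 1) * d" using d by simp
      also have "\<dots> = e" using sL by (simp add: d_def)
      finally show "vnorm (x t) < e" .
    qed
    with d show "\<exists>d>0. \<forall>\<phi> x. vec_continuous_on n {- h..0} \<phi> \<and> closed_loop_solution n h A B (1\<^sub>m n) K \<phi> x \<and>
        (\<forall>t\<in>{- h..0}. vnorm (\<phi> t) < d) \<longrightarrow> (\<forall>t\<ge>0. vnorm (x t) < e)"
      by blast
  next
    fix \<phi> x assume "vec_continuous_on n {- h..0} \<phi> \<and> closed_loop_solution n h A B (1\<^sub>m n) K \<phi> x"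
    then obtain w where w: "sol w" "\<And>t. t \<ge> - h \<Longrightarrow> w t = Z *\<^sub>v x t" "\<And>t. t \<ge> - h \<Longrightarrow> x t \<in> carrier_vec n"
      using transf by blast
    have "((\<lambda>t. sqrt (c' * (w t \<bullet> w t))) \<longlongrightarrow> sqrt (c' * 0)) at_top"
      by (intro tendsto_real_sqrt tendsto_mult tendsto_const sol_tendsto_0 w)
    then have lim: "((\<lambda>t. sqrt (c' * (w t \<bullet> w t))) \<longlongrightarrow> 0) at_top" by simp
    show "((\<lambda>t. vnorm (x t)) \<longlongrightarrow> 0) at_top"
    proof (rule tendsto_sandwich[OF _ _ tendsto_const lim])
      show "eventually (\<lambda>t. 0 \<le> vnorm (x t)) at_top"
        by (intro always_eventually allI) (simp add: vnorm_def scalar_prod_self_nonneg)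
      show "eventually (\<lambda>t. vnorm (x t) \<le> sqrt (c' * (w t \<bullet> w t))) at_top"
        using eventually_ge_at_top[of "0::real"]
      proof eventually_elim
        case (elim t)
        then show ?case using inverse_bound[OF w(3)[of t]] w(2)[of t] h by (simp add: vnorm_def)
      qed
    qed
  qed
qed

text \<open>Invertibility of \<open>X\<close> is part of the conclusion because
  \<open>mat_inv X\<close>, and with it the gain, would otherwise be unspecified.\<close>

theorem corollary2:
  fixes n m N k :: nat and h :: real
    and A B T At Bt P S R Kbar X Xt M :: "real mat"
    and gs :: jordan_groups and r :: "nat \<Rightarrow> nat"
    and \<epsilon> :: "nat \<Rightarrow> nat \<Rightarrow> real" and Xb :: "nat \<Rightarrow> real mat"
  assumes "A \<in> carrier_mat n n" and "B \<in> carrier_mat n m" and "N > 0" and "h > 0"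
    and "T \<in> carrier_mat n n" and "invertible_mat T"
    and "wf_groups gs" and "mat_inv T * (- A) * T = real_jordan_mat gs"
    and "k = length gs" and "\<And>j. j < k \<Longrightarrow> r j = group_size gs j"
    and "At = mat_inv T * A * T" and "Bt = mat_inv T * B"
    and "M = block_row n [1\<^sub>m n, - At, 0\<^sub>m n n, 0\<^sub>m n (n * N)]"
    and "pos_def ((N + 1) * n) P" and "pos_def n S" and "pos_def n R"
    and "Kbar \<in> carrier_mat m n" and "\<And>j. j < k \<Longrightarrow> Xb j \<in> carrier_mat (r j) (r j)"
    and "X = sum_mats n (\<lambda>j. transpose_mat (J_mat n r j) * Xb j * J_mat n r j) k"
    and "Xt = diag_block_mat (replicate (N + 3) X)"
    and "neg_def ((N + 3) * n)
      (Phi_mat n N h P S R +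
       He (transpose_mat (M * Xt + block_row n [0\<^sub>m n n, 0\<^sub>m n n, - (Bt * Kbar), 0\<^sub>m n (n * N)])
           * F_W n N k r \<epsilon>))"
  shows "invertible_mat X \<and>
    closed_loop_asymptotically_stable n h A B (1\<^sub>m n) (Kbar * mat_inv X * mat_inv T)"
proof -
  note Ti = invertible_mat_inv[OF assms(5,6)]
  let ?Ti = "mat_inv T" and ?Xi = "mat_inv X"
  have At: "At \<in> carrier_mat n n"
    unfolding assms(11) by (rule mult_carrier_mat[OF mult_carrier_mat[OF Ti(1) assms(1)] assms(5)])
  have Bt: "Bt \<in> carrier_mat n m" unfolding assms(12) by (rule mult_carrier_mat[OF Ti(1) assms(2)])
  have D: "Bt * Kbar \<in> carrier_mat n n" by (rule mult_carrier_mat[OF Bt assms(17)])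
  have X: "X \<in> carrier_mat n n" unfolding assms(19) sum_mats_def by simp
  interpret closed_loop_lmi n N h P S R X At "Bt * Kbar" "F_W n N k r \<epsilon>"
    using assms(21) unfolding assms(13,20)
    by unfold_locales (rule assms X At D F_W_carrier | assumption)+
  note Xi = X_inv
  obtain \<delta> where LK: "lyapunov_krasovskii n h (?Xi * (At * X)) (?Xi * (Bt * Kbar)) N P S R \<delta>"
    using lyapunov_krasovskii_transformed by blast
  \<comment> \<open>The change of coordinates from \<open>x\<close> to \<open>w\<close>; its inverse
    is \<open>T * X\<close>.\<close>
  let ?Z = "?Xi * ?Ti"
  have Z: "?Z \<in> carrier_mat n n" by (rule mult_carrier_mat[OF Xi(1) Ti(1)])
  have TX: "T * X \<in> carrier_mat n n" by (rule mult_carrier_mat[OF assms(5) X])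
  have cancel: "X * ?Z = ?Ti"
  proof -
    have "X * ?Z = (X * ?Xi) * ?Ti" by (rule assoc_mult_mat[OF X Xi(1) Ti(1), symmetric])
    then show ?thesis using Xi(2) Ti(1) by simp
  qed
  have TiA: "?Ti * A \<in> carrier_mat n n" by (rule mult_carrier_mat[OF Ti(1) assms(1)])
  have AtTi: "At * ?Ti = ?Ti * A"
  proof -
    have "At * ?Ti = (?Ti * A) * (T * ?Ti)" unfolding assms(11) by (rule assoc_mult_mat[OF TiA assms(5) Ti(1)])
    then show ?thesis unfolding Ti(2) right_mult_one_mat[OF TiA] .
  qed
  have KXi: "Kbar * ?Xi \<in> carrier_mat m n" by (rule mult_carrier_mat[OF assms(17) Xi(1)])
  have K: "Kbar * ?Xi * ?Ti \<in> carrier_mat m n" by (rule mult_carrier_mat[OF KXi Ti(1)])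
  have "closed_loop_asymptotically_stable n h A B (1\<^sub>m n) (Kbar * ?Xi * ?Ti)"
  proof (rule stable_by_transformation[OF LK Z TX _ assms(1,2) K])
    have "(T * X) * ?Z = T * (X * ?Z)" by (rule assoc_mult_mat[OF assms(5) X Z])
    also have "\<dots> = 1\<^sub>m n" unfolding cancel by (rule Ti(2))
    finally show "T * X * ?Z = 1\<^sub>m n" .
    \<comment> \<open>First intertwining relation: \<open>At\<close> is \<open>A\<close> conjugated
      by \<open>T\<close>, so \<open>A\<close> passes through \<open>mat_inv T\<close> as
      \<open>At\<close>, and \<open>mat_inv T\<close> is rewritten as \<open>X * ?Z\<close>.\<close>
    have "?Z * A = ?Xi * (?Ti * A)" by (rule assoc_mult_mat[OF Xi(1) Ti(1) assms(1)])
    also have "\<dots> = ?Xi * (At * (X * ?Z))" unfolding cancel AtTi ..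
    also have "\<dots> = ?Xi * ((At * X) * ?Z)" unfolding assoc_mult_mat[OF At X Z] ..
    also have "\<dots> = (?Xi * (At * X)) * ?Z"
      by (rule assoc_mult_mat[OF Xi(1) mult_carrier_mat[OF At X] Z, symmetric])
    finally show "?Z * A = ?Xi * (At * X) * ?Z" .
    have KZ: "Kbar * ?Z \<in> carrier_mat m n" by (rule mult_carrier_mat[OF assms(17) Z])
    \<comment> \<open>Second intertwining relation: the gain is \<open>Kbar * ?Z\<close>, so a
      factor \<open>?Z\<close> already stands on the right and \<open>mat_inv T\<close> merges with
      \<open>B\<close> into \<open>Bt\<close>.\<close>
    have "?Z * (B * (Kbar * ?Z)) = ?Xi * (?Ti * (B * (Kbar * ?Z)))"
      by (rule assoc_mult_mat[OF Xi(1) Ti(1) mult_carrier_mat[OF assms(2) KZ]])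
    also have "?Ti * (B * (Kbar * ?Z)) = Bt * (Kbar * ?Z)"
      unfolding assms(12) by (rule assoc_mult_mat[OF Ti(1) assms(2) KZ, symmetric])
    also have "\<dots> = (Bt * Kbar) * ?Z" by (rule assoc_mult_mat[OF Bt assms(17) Z, symmetric])
    also have "?Xi * \<dots> = (?Xi * (Bt * Kbar)) * ?Z"
      by (rule assoc_mult_mat[OF Xi(1) D Z, symmetric])
    finally have "?Z * (B * (Kbar * ?Z)) = ?Xi * (Bt * Kbar) * ?Z" .
    moreover have "Kbar * ?Xi * ?Ti = Kbar * ?Z" by (rule assoc_mult_mat[OF assms(17) Xi(1) Ti(1)])
    ultimately show "?Z * (B * (Kbar * ?Xi * ?Ti)) = ?Xi * (Bt * Kbar) * ?Z" by (simp only:)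
  qed
  with Xi(4) show ?thesis by blast
qed

end
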